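(* For every finite connected graph $G$ with maximum degree $3$ that is not isomorphic to the complete bipartite graph $K_{3,3}$, we have $$\chi_{\mathrm{ss}}'(G) \le 8,$$ where $\chi_{\mathrm{ss}}'(G)$ denotes the semistrong chromatic index of $G$.
   Context: Graphs are finite and without loops; parallel edges are allowed, and degrees count edges with multiplicity. A proper edge-coloring assigns colors to edges so that any two distinct edges sharing an endvertex receive distinct colors. For a set $M$ of edges, $V(M)$ is the set of endvertices of edges of $M$, and $G[V(M)]$ is the subgraph of $G$ induced by $V(M)$. A matching $M$ in a simple graph $G$ is semistrong if every edge of $M$ has an endvertex of degree one in $G[V(M)]$. A semistrong edge-coloring of a simple graph $G$ is a proper edge-coloring in which the edges of every color class form a semistrong matching. If $G$ has parallel edges, a semistrong edge-coloring of $G$ is a proper edge-coloring of $G$ in which the edges of every color class form a semistrong matching in the underlying simple graph of $G$ (the graph in which every two vertices adjacent in $G$ are joined by exactly one edge). The semistrong chromatic index $\chi_{\mathrm{ss}}'(G)$ is the least integer $k$ such that $G$ admits a semistrong edge-coloring with at most $k$ colors. *)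

theory Defs
  imports Main
begin

text \<open>Each edge name is mapped to the set of its endvertices, so distinct edge names with the same
  set of endvertices are parallel edges.\<close>

record ('a, 'e) multigraph =
  verts :: "'a set"
  edges :: "'e set"
  endverts :: "'e \<Rightarrow> 'a set"

definition finite_loopless :: "('a, 'e) multigraph \<Rightarrow> bool" where
  "finite_loopless G \<longleftrightarrow> finite (verts G) \<and> finite (edges G) \<and>
     (\<forall>e\<in>edges G. endverts G e \<subseteq> verts G \<and> card (endverts G e) = 2)"

definition simple_graph :: "('a, 'e) multigraph \<Rightarrow> bool" where
  "simple_graph G \<longleftrightarrow> inj_on (endverts G) (edges G)"

definition vertex_degree :: "('a, 'e) multigraph \<Rightarrow> 'a \<Rightarrow> nat" where
  "vertex_degree G v = card {e \<in> edges G. v \<in> endverts G e}"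

definition max_degree :: "('a, 'e) multigraph \<Rightarrow> nat" where
  "max_degree G = Max (vertex_degree G ` verts G)"

definition adjacent :: "('a, 'e) multigraph \<Rightarrow> 'a \<Rightarrow> 'a \<Rightarrow> bool" where
  "adjacent G u v \<longleftrightarrow> (\<exists>e\<in>edges G. endverts G e = {u, v})"

definition connected_graph :: "('a, 'e) multigraph \<Rightarrow> bool" where
  "connected_graph G \<longleftrightarrow> verts G \<noteq> {} \<and> (\<forall>u\<in>verts G. \<forall>v\<in>verts G. (adjacent G)\<^sup>*\<^sup>* u v)"

definition isomorphic_graph :: "('a, 'e) multigraph \<Rightarrow> ('b, 'f) multigraph \<Rightarrow> bool" where
  "isomorphic_graph G H \<longleftrightarrow> (\<exists>f g. bij_betw f (verts G) (verts H) \<and> bij_betw g (edges G) (edges H) \<and>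
     (\<forall>e\<in>edges G. endverts H (g e) = f ` endverts G e))"

definition complete_bipartite :: "nat \<Rightarrow> nat \<Rightarrow> (nat + nat, (nat + nat) set) multigraph" where
  "complete_bipartite m n =
     \<lparr>verts = Inl ` {..<m} \<union> Inr ` {..<n},
      edges = {{Inl i, Inr j} | i j. i < m \<and> j < n},
      endverts = (\<lambda>e. e)\<rparr>"

definition induced_subgraph :: "('a, 'e) multigraph \<Rightarrow> 'a set \<Rightarrow> ('a, 'e) multigraph" where
  "induced_subgraph G S =
     \<lparr>verts = verts G \<inter> S,
      edges = {e \<in> edges G. endverts G e \<subseteq> S},
      endverts = endverts G\<rparr>"

definition underlying_simple :: "('a, 'e) multigraph \<Rightarrow> ('a, 'a set) multigraph" where
  "underlying_simple G =
     \<lparr>verts = verts G, edges = endverts G ` edges G, endverts = (\<lambda>e. e)\<rparr>"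

definition covered_verts :: "('a, 'e) multigraph \<Rightarrow> 'e set \<Rightarrow> 'a set" where
  "covered_verts G M = \<Union> (endverts G ` M)"

definition matching :: "('a, 'e) multigraph \<Rightarrow> 'e set \<Rightarrow> bool" where
  "matching G M \<longleftrightarrow> M \<subseteq> edges G \<and>
     (\<forall>e\<in>M. \<forall>f\<in>M. e \<noteq> f \<longrightarrow> endverts G e \<inter> endverts G f = {})"

text \<open>Intended for simple graphs only.\<close>

definition semistrong_matching :: "('a, 'e) multigraph \<Rightarrow> 'e set \<Rightarrow> bool" where
  "semistrong_matching G M \<longleftrightarrow> matching G M \<and>
     (\<forall>e\<in>M. \<exists>v\<in>endverts G e. vertex_degree (induced_subgraph G (covered_verts G M)) v = 1)"

definition proper_edge_coloring :: "('a, 'e) multigraph \<Rightarrow> ('e \<Rightarrow> 'c) \<Rightarrow> bool" where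
  "proper_edge_coloring G c \<longleftrightarrow>
     (\<forall>e\<in>edges G. \<forall>f\<in>edges G. e \<noteq> f \<and> endverts G e \<inter> endverts G f \<noteq> {} \<longrightarrow> c e \<noteq> c f)"

definition color_class :: "('a, 'e) multigraph \<Rightarrow> ('e \<Rightarrow> 'c) \<Rightarrow> 'c \<Rightarrow> 'e set" where
  "color_class G c k = {e \<in> edges G. c e = k}"

definition semistrong_edge_coloring :: "('a, 'e) multigraph \<Rightarrow> ('e \<Rightarrow> 'c) \<Rightarrow> bool" where
  "semistrong_edge_coloring G c \<longleftrightarrow> proper_edge_coloring G c \<and>
     (\<forall>k. if simple_graph G then semistrong_matching G (color_class G c k)
          else semistrong_matching (underlying_simple G) (endverts G ` color_class G c k))"

definition semistrong_chromatic_index :: "('a, 'e) multigraph \<Rightarrow> nat" where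
  "semistrong_chromatic_index G =
     (LEAST k. \<exists>c :: 'e \<Rightarrow> nat. semistrong_edge_coloring G c \<and> card (c ` edges G) \<le> k)"

text \<open>The minimum is attained: giving every edge its own color is a semistrong edge-coloring.\<close>

lemma semistrong_matching_singleton:
  assumes "finite_loopless G" "simple_graph G" "e \<in> edges G"
  shows "semistrong_matching G {e}"
proof -
  have card2: "card (endverts G f) = 2" if "f \<in> edges G" for f
    using assms(1) that by (simp add: finite_loopless_def)
  have fin: "finite (endverts G e)" "endverts G e \<noteq> {}"
    using card2[OF assms(3)] by (auto intro: card_ge_0_finite)
  have only: "f = e" if "f \<in> edges G" "endverts G f \<subseteq> endverts G e" for f
    using card_subset_eq[OF fin(1) that(2)] card2 that(1) assms(2,3)
    by (auto simp: simple_graph_def inj_on_def)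
  obtain v where v: "v \<in> endverts G e" using fin(2) by blast
  have "{f \<in> edges (induced_subgraph G (covered_verts G {e})).
          v \<in> endverts (induced_subgraph G (covered_verts G {e})) f} = {e}"
    using only assms(3) v by (auto simp: induced_subgraph_def covered_verts_def)
  then have "vertex_degree (induced_subgraph G (covered_verts G {e})) v = 1"
    unfolding vertex_degree_def by simp
  with v assms(3) show ?thesis
    by (auto simp: semistrong_matching_def matching_def)
qed

lemma semistrong_matching_empty: "semistrong_matching G {}"
  by (simp add: semistrong_matching_def matching_def)

lemma semistrong_edge_coloring_inj:
  assumes G: "finite_loopless G" and inj: "inj_on c (edges G)"
  shows "semistrong_edge_coloring G c"
proof -
  let ?U = "underlying_simple G"
  have U: "finite_loopless ?U" "simple_graph ?U"
    using G by (auto simp: finite_loopless_def simple_graph_def underlying_simple_def)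
  have class_cases: "color_class G c k = {} \<or> (\<exists>e\<in>edges G. color_class G c k = {e})" for k
  proof (cases "color_class G c k = {}")
    case False
    then obtain e where "e \<in> edges G" "c e = k" by (auto simp: color_class_def)
    moreover from this have "color_class G c k = {e}"
      using inj by (auto simp: color_class_def inj_on_def)
    ultimately show ?thesis by blast
  qed simp
  have "if simple_graph G then semistrong_matching G (color_class G c k)
        else semistrong_matching ?U (endverts G ` color_class G c k)" for k
  proof (cases "color_class G c k = {}")
    case True
    then show ?thesis by (simp add: semistrong_matching_empty)
  next
    case False
    then obtain e where e: "e \<in> edges G" "color_class G c k = {e}"
      using class_cases by blast
    have "semistrong_matching ?U {endverts G e}"
      using e by (intro semistrong_matching_singleton U) (simp add: underlying_simple_def)
    with e G show ?thesis by (simp add: semistrong_matching_singleton)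
  qed
  moreover have "proper_edge_coloring G c"
    using inj by (auto simp: proper_edge_coloring_def inj_on_def)
  ultimately show ?thesis by (simp add: semistrong_edge_coloring_def)
qed

lemma semistrong_chromatic_index_attained:
  fixes G :: "('a, 'e) multigraph"
  assumes "finite_loopless G"
  shows "\<exists>c :: 'e \<Rightarrow> nat. semistrong_edge_coloring G c \<and>
           card (c ` edges G) \<le> semistrong_chromatic_index G"
proof -
  have "finite (edges G)" using assms by (simp add: finite_loopless_def)
  then obtain c :: "'e \<Rightarrow> nat" where "inj_on c (edges G)"
    using finite_imp_inj_to_nat_seg by blast
  then have "\<exists>k. \<exists>c :: 'e \<Rightarrow> nat. semistrong_edge_coloring G c \<and> card (c ` edges G) \<le> k"
    using semistrong_edge_coloring_inj[OF assms] by blast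
  then show ?thesis
    unfolding semistrong_chromatic_index_def by (rule LeastI_ex)
qed

end

theory Submission
  imports Defs
begin

section \<open>Private ends\<close>

text \<open>Give every coloured edge \<open>e\<close> a private end \<open>p e\<close>. A colouring is semistrong as soon as, for distinct
  edges \<open>e\<close>, \<open>f\<close> of one colour, \<open>f\<close> misses the closed neighbourhood of \<open>p e\<close>. A new edge \<open>xy\<close> with private
  end \<open>x\<close> must then avoid the colours of the edges that meet the closed neighbourhood of \<open>x\<close> (six of
  them in a cubic graph, besides the edges at \<open>y\<close>) and of the edges whose private end is a neighbour
  of \<open>y\<close>. So everything hinges on having few private ends near the edges that are coloured late.

  If no component is cubic, induction on the vertices gives a colouring with eight colours in which
  every vertex of degree at most two is the private end of at most one edge, and in which a prescribed
  vertex \<open>u\<close> of degree at most two is the private end of no edge: delete \<open>u\<close> and demand the latter of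
  one of its neighbours instead.

  In a connected cubic graph, two vertices with the same open or the same closed neighbourhood are
  treated directly, and \<open>K\<^sub>3\<^sub>,\<^sub>3\<close> appears there. Otherwise delete a shortest cycle \<open>c\<^sub>0 \<dots> c\<^sub>g\<^sub>-\<^sub>1\<close>, colour the rest so that
  the outer neighbour \<open>d\<^sub>0\<close> of \<open>c\<^sub>0\<close> is no private end, and colour the remaining edges greedily around the
  cycle; a coincidence of two colours arranged at the start saves the last edge.\<close>

text \<open>A vertex of degree two cannot always be kept free of private edges. In a component that
  is a cycle there are as many edges as vertices, so if every vertex is the private end of at most
  one edge, every vertex is the private end of exactly one. Hence freeing a vertex of degree two is
  proved only next to a vertex of degree three, and a deleted cycle whose outer vertices have no
  such neighbour is a case of its own. Around the cycle the order of colouring decides. The list of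
  a pendant edge exceeds the number of pendant edges in conflict with it by two. One further colour
  can thus be avoided, so a pendant edge can wait for the cycle edge that leaves its foot. That
  cycle edge then sees two pendant edges, two cycle edges and three outside colours: seven. The
  first cycle edge finds its pendant edge already coloured, and the freedom of \<open>d 0\<close>
  pays for this. The closing edge would see eight, hence the coincidence. Parallel edges come last:
  the ends of a repeated edge have at most two neighbours each, which leaves a free colour.\<close>

locale subcubic =
  fixes V :: "'a set" and N :: "'a \<Rightarrow> 'a set"
  assumes finV: "finite V"
    and N_sym: "\<And>x y. y \<in> N x \<Longrightarrow> x \<in> N y"
    and N_irrefl: "\<And>x. x \<notin> N x"
    and N_V: "\<And>x. N x \<subseteq> V"
    and N_le3: "\<And>x. card (N x) \<le> 3"
begin

lemma finN [simp]: "finite (N x)"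
  using finV N_V finite_subset by blast

definition E :: "'a set \<Rightarrow> 'a set set" where
  "E A = {{x, y} | x y. x \<in> A \<and> y \<in> A \<and> y \<in> N x}"

definition ball :: "'a \<Rightarrow> 'a set" where
  "ball x = insert x (N x)"

definition deg :: "'a set \<Rightarrow> 'a \<Rightarrow> nat" where
  "deg A v = card (N v \<inter> A)"

text \<open>Properness is contained in the last clause: an edge \<open>e\<close> of the graph lies
  inside \<open>ball (p e)\<close>, so a second edge of its colour is disjoint from it. The clause
  is asymmetric in \<open>e\<close> and \<open>f\<close> but is imposed in both orders.\<close>

definition valid :: "('a set \<Rightarrow> nat) \<Rightarrow> ('a set \<Rightarrow> 'a) \<Rightarrow> 'a set set \<Rightarrow> bool" where
  "valid c p M \<longleftrightarrow> (\<forall>e\<in>M. p e \<in> e \<and> c e < 8) \<and>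
     (\<forall>e\<in>M. \<forall>f\<in>M. e \<noteq> f \<and> c e = c f \<longrightarrow> f \<inter> ball (p e) = {})"

definition K :: "('a set \<Rightarrow> 'a) \<Rightarrow> 'a set set \<Rightarrow> 'a \<Rightarrow> 'a set set" where
  "K p M v = {e \<in> M. p e = v}"

definition near :: "'a set set \<Rightarrow> 'a \<Rightarrow> 'a set set" where
  "near M x = {f \<in> M. f \<inter> ball x \<noteq> {}}"

text \<open>These are the edges whose colours are barred from a new edge \<open>{x, y}\<close> with
  private end \<open>x\<close>: \<open>near\<close> protects \<open>x\<close> from old edges, the
  second set protects old private ends from \<open>y\<close>.\<close>

definition blocked :: "('a set \<Rightarrow> 'a) \<Rightarrow> 'a set set \<Rightarrow> 'a \<Rightarrow> 'a \<Rightarrow> 'a set set" where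
  "blocked p M x y = near M x \<union> {f \<in> M. p f \<in> N y}"

definition star :: "'a set set \<Rightarrow> 'a \<Rightarrow> 'a set set" where
  "star M v = {e \<in> M. v \<in> e}"

section \<open>Edges and degrees in induced subgraphs\<close>

lemma E_iff: "{x, y} \<in> E A \<longleftrightarrow> x \<in> A \<and> y \<in> A \<and> y \<in> N x"
  using N_sym by (auto simp: E_def doubleton_eq_iff)

lemma E_elim:
  assumes "e \<in> E A"
  obtains x y where "e = {x, y}" "x \<in> A" "y \<in> A" "y \<in> N x" "x \<in> N y" "x \<noteq> y"
proof -
  from assms obtain x y where "e = {x, y}" "x \<in> A" "y \<in> A" "y \<in> N x" by (auto simp: E_def)
  then show ?thesis using that[of x y] N_sym N_irrefl by blast
qed

lemma E_subset: "e \<in> E A \<Longrightarrow> e \<subseteq> A"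
  by (auto simp: E_def)

lemma E_mono: "A \<subseteq> B \<Longrightarrow> E A \<subseteq> E B"
  by (auto simp: E_def)

lemma E_sub_V: "E A \<subseteq> Pow V"
  using N_sym N_V by (fastforce simp: E_def)

lemma finE [simp]: "finite (E A)"
  using E_sub_V finV finite_subset by blast

lemma star_E: "x \<in> A \<Longrightarrow> star (E A) x = (\<lambda>y. {x, y}) ` (N x \<inter> A)"
proof (intro set_eqI iffI)
  fix e assume x: "x \<in> A" and "e \<in> star (E A) x"
  then obtain a b where ab: "e = {a, b}" "a \<in> A" "b \<in> A" "b \<in> N a" "a \<in> N b" and "x \<in> e"
    by (auto simp: star_def elim: E_elim)
  then consider "x = a" | "x = b" by blast
  then show "e \<in> (\<lambda>y. {x, y}) ` (N x \<inter> A)"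
    by cases (use ab in \<open>auto simp: insert_commute\<close>)
next
  fix e assume "x \<in> A" "e \<in> (\<lambda>y. {x, y}) ` (N x \<inter> A)"
  then show "e \<in> star (E A) x" by (auto simp: star_def E_iff)
qed

lemma star_E_out: "x \<notin> A \<Longrightarrow> star (E A) x = {}"
  using E_subset by (auto simp: star_def)

lemma card_star: "card (star (E A) x) \<le> deg A x"
  by (cases "x \<in> A") (auto simp: star_E star_E_out deg_def intro: card_image_le)

lemma deg_le3: "deg A x \<le> 3"
  unfolding deg_def using N_le3[of x] card_mono[of "N x" "N x \<inter> A"] by simp

lemma deg_mono: "A \<subseteq> B \<Longrightarrow> deg A x \<le> deg B x"
  unfolding deg_def by (intro card_mono) auto

lemma deg_remove: "u \<in> N x \<Longrightarrow> u \<in> A \<Longrightarrow> deg A x = Suc (deg (A - {u}) x)"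
proof -
  assume "u \<in> N x" "u \<in> A"
  then have "N x \<inter> A = insert u (N x \<inter> (A - {u}))" by auto
  then show ?thesis unfolding deg_def by simp
qed

lemma deg_remove': "u \<notin> N x \<Longrightarrow> deg (A - {u}) x = deg A x"
  unfolding deg_def by (rule arg_cong[where f = card]) auto

text \<open>Even an edge at \<open>x\<close> itself has its other end among the neighbours of
  \<open>x\<close>, so counting at the neighbours catches all edges that meet the closed
  neighbourhood.\<close>

lemma near_E_subset: "x \<in> B \<Longrightarrow> near (E B) x \<subseteq> (\<Union>z\<in>N x \<inter> B. star (E B) z)"
proof
  fix f assume x: "x \<in> B" and "f \<in> near (E B) x"
  then have f: "f \<in> E B" "f \<inter> ball x \<noteq> {}" by (auto simp: near_def)
  from f(1) obtain a b where ab: "f = {a, b}" "a \<in> B" "b \<in> B" "b \<in> N a" "a \<in> N b" by (rule E_elim)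
  then show "f \<in> (\<Union>z\<in>N x \<inter> B. star (E B) z)"
    using f by (auto simp: star_def ball_def)
qed

lemma card_near: "x \<in> B \<Longrightarrow> card (near (E B) x) \<le> (\<Sum>z\<in>N x \<inter> B. deg B z)"
proof -
  assume x: "x \<in> B"
  have "card (near (E B) x) \<le> card (\<Union>z\<in>N x \<inter> B. star (E B) z)"
    by (intro card_mono near_E_subset x) (auto simp: star_def)
  also have "\<dots> \<le> (\<Sum>z\<in>N x \<inter> B. card (star (E B) z))" by (intro card_UN_le) simp
  also have "\<dots> \<le> (\<Sum>z\<in>N x \<inter> B. deg B z)" by (intro sum_mono card_star)
  finally show ?thesis .
qed

lemma card_near_le: "x \<in> B \<Longrightarrow> card (near (E B) x) \<le> 3 * deg B x"
proof -
  assume x: "x \<in> B"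
  have "(\<Sum>z\<in>N x \<inter> B. deg B z) \<le> (\<Sum>z\<in>N x \<inter> B. 3)" by (intro sum_mono deg_le3)
  with card_near[OF x] show ?thesis by (simp add: deg_def)
qed

lemma finite_near [simp]: "finite M \<Longrightarrow> finite (near M x)"
  by (simp add: near_def)

section \<open>Adding one edge to a colouring\<close>

lemma validD:
  assumes "valid c p M" "e \<in> M"
  shows "p e \<in> e" "c e < 8"
  using assms by (auto simp: valid_def)

text \<open>An old edge outside \<open>near M x\<close> misses \<open>ball x\<close>, so its private
  end is neither \<open>x\<close> nor \<open>y\<close> nor a neighbour of \<open>x\<close>. The one
  danger left is a private end adjacent to \<open>y\<close>, which the second part of
  \<open>blocked\<close> rules out.\<close>

lemma add_edge:
  assumes v: "valid c p M" and xy: "y \<in> N x" and new: "{x, y} \<notin> M"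
    and k: "k < 8" "k \<notin> c ` blocked p M x y"
  shows "valid (c({x, y} := k)) (p({x, y} := x)) (insert {x, y} M)"
  unfolding valid_def
proof (intro conjI ballI impI)
  fix e assume "e \<in> insert {x, y} M"
  then show "(p({x, y} := x)) e \<in> e" "(c({x, y} := k)) e < 8"
    using v k by (auto simp: valid_def)
next
  fix e f
  assume e: "e \<in> insert {x, y} M" and f: "f \<in> insert {x, y} M"
    and ef: "e \<noteq> f \<and> (c({x, y} := k)) e = (c({x, y} := k)) f"
  consider "e = {x, y}" "f \<in> M" "f \<noteq> {x, y}" | "f = {x, y}" "e \<in> M" "e \<noteq> {x, y}"
    | "e \<in> M" "f \<in> M" "e \<noteq> {x, y}" "f \<noteq> {x, y}"
    using e f ef new by fastforce
  then show "f \<inter> ball ((p({x, y} := x)) e) = {}"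
  proof cases
    case 1
    then have "c f = k" using ef by simp
    with k 1 have "f \<notin> near M x" by (auto simp: blocked_def)
    with 1 show ?thesis by (auto simp: near_def)
  next
    case 2
    then have "c e = k" using ef by simp
    with k 2 have *: "e \<inter> ball x = {}" "p e \<notin> N y" by (auto simp: blocked_def near_def)
    have "p e \<in> e" using v 2 by (auto simp: valid_def)
    with * xy have "p e \<noteq> x" "p e \<notin> N x" "p e \<noteq> y" by (auto simp: ball_def)
    with * have "{x, y} \<inter> ball (p e) = {}" using N_sym by (auto simp: ball_def)
    with 2 show ?thesis by simp
  next
    case 3
    with ef v show ?thesis by (auto simp: valid_def)
  qed
qed

lemma ex_colour:
  assumes "finite S" "card S \<le> 7"
  shows "\<exists>k<8. k \<notin> (c ` S :: nat set)"
proof (rule ccontr)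
  assume "\<not> ?thesis"
  then have "{..<8} \<subseteq> c ` S" by auto
  then have "card {..<8::nat} \<le> card (c ` S)" using assms by (intro card_mono) auto
  then show False using assms card_image_le[of S c] by simp
qed

lemma add_edge_ex:
  assumes "valid c p M" "y \<in> N x" "{x, y} \<notin> M" "finite M" "card (blocked p M x y) \<le> 7"
  obtains k where "valid (c({x, y} := k)) (p({x, y} := x)) (insert {x, y} M)" "k < 8"
    "k \<notin> c ` blocked p M x y"
proof -
  have "finite (blocked p M x y)" using assms(4) by (simp add: blocked_def)
  then obtain k where "k < 8" "k \<notin> c ` blocked p M x y" using ex_colour assms(5) by metis
  with that add_edge assms show ?thesis by blast
qed

section \<open>Adding a vertex with one or two neighbours\<close>

lemma E_insert: "u \<notin> B \<Longrightarrow> E (insert u B) = E B \<union> (\<lambda>z. {z, u}) ` (N u \<inter> B)"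
proof (intro set_eqI iffI)
  fix e assume u: "u \<notin> B" and "e \<in> E (insert u B)"
  then obtain a b where ab: "e = {a, b}" "a \<in> insert u B" "b \<in> insert u B" "b \<in> N a" "a \<in> N b" "a \<noteq> b"
    by (auto elim: E_elim)
  show "e \<in> E B \<union> (\<lambda>z. {z, u}) ` (N u \<inter> B)"
  proof (cases "a = u \<or> b = u")
    case True
    then show ?thesis using ab by (auto simp: insert_commute)
  next
    case False
    then show ?thesis using ab by (auto simp: E_iff)
  qed
next
  fix e assume "u \<notin> B" "e \<in> E B \<union> (\<lambda>z. {z, u}) ` (N u \<inter> B)"
  then show "e \<in> E (insert u B)"
    using E_mono[of B "insert u B"] N_sym by (auto simp: E_iff)
qed

lemma deg_insert: "u \<notin> B \<Longrightarrow> deg (insert u B) v = deg B v + (if v \<in> N u then 1 else 0)"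
  using N_sym deg_remove[of u v "insert u B"] deg_remove'[of u v "insert u B"] by fastforce

lemma K_sub_near: "valid c p M \<Longrightarrow> K p M x \<subseteq> near M x"
  by (auto simp: K_def near_def valid_def ball_def)

lemma K_out: "valid c p (E B) \<Longrightarrow> u \<notin> B \<Longrightarrow> K p (E B) u = {}"
  using E_subset by (fastforce simp: K_def valid_def)

lemma priv_nbr: "valid c p (E B) \<Longrightarrow> {f \<in> E B. p f \<in> N u} = (\<Union>z\<in>N u \<inter> B. K p (E B) z)"
  using E_subset by (fastforce simp: K_def valid_def)

lemma finite_K [simp]: "finite M \<Longrightarrow> finite (K p M x)"
  by (simp add: K_def)

lemma card_K_le: "valid c p (E B) \<Longrightarrow> card (K p (E B) x) \<le> deg B x"
proof -
  assume "valid c p (E B)"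
  then have "K p (E B) x \<subseteq> star (E B) x" by (auto simp: K_def star_def valid_def)
  then have "card (K p (E B) x) \<le> card (star (E B) x)" by (intro card_mono) (auto simp: star_def)
  with card_star show ?thesis using order_trans by blast
qed

text \<open>The private end goes to the old vertex \<open>z\<close>, so \<open>u\<close> starts out
  free. The private ends adjacent to \<open>u\<close> can only be \<open>z\<close>, and those edges
  are already near \<open>z\<close>. Before the insertion \<open>z\<close> has degree at most two,
  which bars at most six colours.\<close>

lemma add1:
  assumes u: "u \<notin> B" "N u \<inter> B = {z}" and v: "valid c p (E B)"
  obtains c' p' where "valid c' p' (E (insert u B))"
    "\<And>w. K p' (E (insert u B)) w = (if w = z then insert {z, u} (K p (E B) z) else K p (E B) w)"
proof -
  have z: "z \<in> N u" "z \<in> B" "u \<in> N z" using u N_sym by auto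
  have new: "{z, u} \<notin> E B" using u by (auto simp: E_iff)
  have "blocked p (E B) z u = near (E B) z"
    using K_sub_near[OF v, of z] priv_nbr[OF v, of u] u by (auto simp: blocked_def)
  moreover have "deg B z \<le> 2"
    using deg_insert[OF u(1), of z] deg_le3[of "insert u B" z] z by simp
  ultimately have "card (blocked p (E B) z u) \<le> 7" using card_near_le[OF z(2)] by simp
  then obtain k where k: "valid (c({z, u} := k)) (p({z, u} := z)) (insert {z, u} (E B))"
    using add_edge_ex[OF v z(3) new finE] by metis
  have EE: "E (insert u B) = insert {z, u} (E B)" using E_insert[OF u(1)] u(2) by auto
  show ?thesis
    by (rule that[of "c({z, u} := k)" "p({z, u} := z)"]) (use k new in \<open>auto simp: EE K_def\<close>)
qed

text \<open>Both private ends go to the old vertices, and again \<open>u\<close> stays free. The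
  second edge also sees the first one, hence the bound 6 instead of 7 and the importance of which
  neighbour is called \<open>x\<close>.\<close>

lemma add2:
  assumes u: "u \<notin> B" "N u \<inter> B = {x, y}" "x \<noteq> y" and v: "valid c p (E B)"
    and sx: "card (near (E B) x) + card (K p (E B) y) \<le> 7"
    and sy: "card (near (E B) y) + card (K p (E B) x) \<le> 6"
  obtains c' p' where "valid c' p' (E (insert u B))"
    "\<And>w. K p' (E (insert u B)) w = (if w = x then insert {x, u} (K p (E B) x)
       else if w = y then insert {y, u} (K p (E B) y) else K p (E B) w)"
proof -
  have x: "x \<in> N u" "x \<in> B" "u \<in> N x" and y: "y \<in> N u" "y \<in> B" "u \<in> N y" using u N_sym by auto
  have xu: "x \<noteq> u" "y \<noteq> u" using u x y by auto
  have new: "{x, u} \<notin> E B" "{y, u} \<notin> E B" using u by (auto simp: E_iff)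
  have ne: "{x, u} \<noteq> {y, u}" using u by (auto simp: doubleton_eq_iff)
  have "blocked p (E B) x u \<subseteq> near (E B) x \<union> K p (E B) y"
    using K_sub_near[OF v, of x] priv_nbr[OF v, of u] u by (auto simp: blocked_def)
  then have "card (blocked p (E B) x u) \<le> card (near (E B) x \<union> K p (E B) y)" by (intro card_mono) auto
  with sx card_Un_le[of "near (E B) x" "K p (E B) y"]
  have "card (blocked p (E B) x u) \<le> 7" by linarith
  then obtain k where k: "valid (c({x, u} := k)) (p({x, u} := x)) (insert {x, u} (E B))"
    using add_edge_ex[OF v x(3) new(1) finE] by metis
  let ?p = "p({x, u} := x)" and ?M = "insert {x, u} (E B)"
  have "blocked ?p ?M y u \<subseteq> insert {x, u} (near (E B) y \<union> K p (E B) x)"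
    using K_sub_near[OF v, of y] priv_nbr[OF v, of u] u by (auto simp: blocked_def near_def K_def)
  then have "card (blocked ?p ?M y u) \<le> card (insert {x, u} (near (E B) y \<union> K p (E B) x))"
    by (intro card_mono) auto
  also have "\<dots> \<le> Suc (card (near (E B) y \<union> K p (E B) x))" by (simp add: card_insert_if)
  also have "\<dots> \<le> 7"
    using sy card_Un_le[of "near (E B) y" "K p (E B) x"] by linarith
  finally have "card (blocked ?p ?M y u) \<le> 7" .
  moreover have "{y, u} \<notin> ?M" using new ne by auto
  ultimately obtain l where l: "valid (c({x, u} := k, {y, u} := l)) (?p({y, u} := y)) (insert {y, u} ?M)"
    using add_edge_ex[OF k y(3)] by (metis finE finite_insert)
  have EE: "E (insert u B) = insert {y, u} ?M" using E_insert[OF u(1)] u(2) by auto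
  show ?thesis
    by (rule that[of "c({x, u} := k, {y, u} := l)" "?p({y, u} := y)"])
      (use l new ne u(3) in \<open>auto simp: EE K_def\<close>)
qed

text \<open>The limit is imposed where it can matter later: only a vertex of degree at most two in
  \<open>A\<close> can still have a neighbour outside \<open>A\<close>.\<close>

definition good :: "('a set \<Rightarrow> nat) \<Rightarrow> ('a set \<Rightarrow> 'a) \<Rightarrow> 'a set \<Rightarrow> bool" where
  "good c p A \<longleftrightarrow> valid c p (E A) \<and> (\<forall>v\<in>A. deg A v \<le> 2 \<longrightarrow> card (K p (E A) v) \<le> 1)"

text \<open>Either \<open>z\<close> reaches degree three, where \<open>good\<close> asks for
  nothing, or the new edge is the only one with private end \<open>z\<close>.\<close>

lemma good_add1:
  assumes u: "u \<notin> B" "N u \<inter> B = {z}" and g: "good c p B"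
    and z: "2 \<le> deg B z \<or> K p (E B) z = {}"
  shows "\<exists>c p. good c p (insert u B) \<and> K p (E (insert u B)) u = {}"
proof -
  have v: "valid c p (E B)" using g by (simp add: good_def)
  from add1[OF u v] obtain c' p' where v': "valid c' p' (E (insert u B))" and
    K: "\<And>w. K p' (E (insert u B)) w = (if w = z then insert {z, u} (K p (E B) z) else K p (E B) w)"
    by metis
  have zu: "z \<noteq> u" "z \<in> N u" "z \<in> B" using u by auto
  have Ku: "K p' (E (insert u B)) u = {}" using K K_out[OF v u(1)] zu by simp
  have "good c' p' (insert u B)"
    unfolding good_def
  proof (intro conjI ballI impI)
    fix w assume w: "w \<in> insert u B" "deg (insert u B) w \<le> 2"
    have d: "deg B w \<le> deg (insert u B) w" by (intro deg_mono) auto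
    consider "w = u" | "w = z" | "w \<in> B" "w \<noteq> z" using w by auto
    then show "card (K p' (E (insert u B)) w) \<le> 1"
    proof cases
      case 2
      then have "K p (E B) z = {}" using w z deg_insert[OF u(1), of z] zu by auto
      then show ?thesis using K 2 by simp
    qed (use Ku K g w d in \<open>auto simp: good_def\<close>)
  qed (rule v')
  with Ku show ?thesis by blast
qed


text \<open>The vertex \<open>y\<close> may end up with two private edges at degree two. The
  conclusion that spares \<open>y\<close> is kept apart from \<open>good\<close>, because one case
  of the cycle argument has to live with such a vertex.\<close>

lemma good_add2:
  assumes u: "u \<notin> B" "N u \<inter> B = {x, y}" "x \<noteq> y" and g: "good c p B"
    and sx: "card (near (E B) x) + card (K p (E B) y) \<le> 7"
    and sy: "card (near (E B) y) + card (K p (E B) x) \<le> 6"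
    and x: "2 \<le> deg B x \<or> K p (E B) x = {}"
  obtains c' p' where "valid c' p' (E (insert u B))" "K p' (E (insert u B)) u = {}"
    "\<And>v. v \<in> insert u B \<Longrightarrow> v \<noteq> y \<Longrightarrow> deg (insert u B) v \<le> 2 \<Longrightarrow> card (K p' (E (insert u B)) v) \<le> 1"
    "2 \<le> deg B y \<or> K p (E B) y = {} \<Longrightarrow> good c' p' (insert u B)"
proof -
  have v: "valid c p (E B)" using g by (simp add: good_def)
  from add2[OF u v sx sy] obtain c' p' where v': "valid c' p' (E (insert u B))" and
    K: "\<And>w. K p' (E (insert u B)) w = (if w = x then insert {x, u} (K p (E B) x)
       else if w = y then insert {y, u} (K p (E B) y) else K p (E B) w)"
    by metis
  have xy: "x \<noteq> u" "x \<in> N u" "x \<in> B" "y \<noteq> u" "y \<in> N u" "y \<in> B" using u by auto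
  have Ku: "K p' (E (insert u B)) u = {}" using K K_out[OF v u(1)] xy by simp
  have *: "card (K p' (E (insert u B)) w) \<le> 1"
    if w: "w \<in> insert u B" "w \<noteq> y" "deg (insert u B) w \<le> 2" for w
  proof -
    have d: "deg B w \<le> deg (insert u B) w" by (intro deg_mono) auto
    consider "w = u" | "w = x" | "w \<in> B" "w \<noteq> x" using w by auto
    then show ?thesis
    proof cases
      case 2
      then have "K p (E B) x = {}" using w x deg_insert[OF u(1), of x] xy by auto
      then show ?thesis using K 2 by simp
    qed (use Ku K g w d in \<open>auto simp: good_def\<close>)
  qed
  have "good c' p' (insert u B)" if y: "2 \<le> deg B y \<or> K p (E B) y = {}"
    unfolding good_def
  proof (intro conjI ballI impI)
    fix w assume w: "w \<in> insert u B" "deg (insert u B) w \<le> 2"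
    show "card (K p' (E (insert u B)) w) \<le> 1"
    proof (cases "w = y")
      case True
      then have "K p (E B) y = {}" using w y deg_insert[OF u(1), of y] xy by auto
      then show ?thesis using K True u(3) by simp
    qed (use * w in auto)
  qed (rule v')
  with that v' Ku * show ?thesis by blast
qed

section \<open>Graphs without cubic components\<close>

text \<open>This is 2-degeneracy; at maximum degree three it says that no component is cubic, in a
  form that passes to subsets.\<close>

definition sparse :: "'a set \<Rightarrow> bool" where
  "sparse A \<longleftrightarrow> A \<subseteq> V \<and> (\<forall>B\<subseteq>A. B \<noteq> {} \<longrightarrow> (\<exists>v\<in>B. deg B v \<le> 2))"

lemma sparse_mono: "sparse A \<Longrightarrow> B \<subseteq> A \<Longrightarrow> sparse B"
  by (auto simp: sparse_def)

definition colourable :: "'a set \<Rightarrow> bool" where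
  "colourable A \<longleftrightarrow> (\<exists>c p. good c p A)"

definition rooted :: "'a set \<Rightarrow> 'a \<Rightarrow> bool" where
  "rooted A u \<longleftrightarrow> (\<exists>c p. good c p A \<and> K p (E A) u = {})"

lemma deg2_obtain:
  assumes "deg A u = 2"
  obtains x y where "N u \<inter> A = {x, y}" "x \<noteq> y"
  using assms unfolding deg_def card_2_iff by metis

lemma card_near2:
  assumes "x \<in> B" "N x \<inter> B = {a, b}" "a \<noteq> b"
  shows "card (near (E B) x) \<le> deg B a + deg B b"
  using card_near[OF assms(1)] assms by simp

lemma card_near_deg2: "x \<in> B \<Longrightarrow> deg B x \<le> 2 \<Longrightarrow> card (near (E B) x) \<le> 6"
  using card_near_le[of x B] by simp

text \<open>The new edge gets its private end at the neighbour \<open>z\<close>. Either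
  \<open>z\<close> reaches degree three, or \<open>z\<close> has degree at most one in the rest and
  can be freed there first.\<close>

lemma rooted_leaf:
  assumes u: "u \<in> A" "deg A u \<le> 1"
    and colourable: "colourable (A - {u})"
    and rooted: "\<And>v. v \<in> A - {u} \<Longrightarrow> deg (A - {u}) v \<le> 1 \<Longrightarrow> rooted (A - {u}) v"
  shows "rooted A u"
proof (cases "deg A u = 0")
  case True
  then have N0: "N u \<inter> A = {}" by (simp add: deg_def)
  have iA: "insert u (A - {u}) = A" using u by auto
  have EA: "E A = E (A - {u})" using E_insert[of u "A - {u}", unfolded iA] N0 by auto
  have dA: "deg A v = deg (A - {u}) v" if "v \<in> A" for v
    using N0 that N_sym deg_remove'[of u v A] by (metis Int_iff empty_iff)
  obtain c p where g: "good c p (A - {u})" using colourable by (auto simp: colourable_def)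
  have Ku: "K p (E (A - {u})) u = {}" using g by (intro K_out[of c]) (auto simp: good_def)
  have "good c p A"
    unfolding good_def EA
  proof (intro conjI ballI impI)
    show "valid c p (E (A - {u}))" using g by (simp add: good_def)
    fix v assume v: "v \<in> A" "deg A v \<le> 2"
    then show "card (K p (E (A - {u})) v) \<le> 1"
      using g Ku dA[OF v(1)] by (cases "v = u") (auto simp: good_def)
  qed
  with Ku EA show ?thesis by (auto simp: rooted_def)
next
  case False
  then have "deg A u = 1" using u by simp
  then obtain z where z: "N u \<inter> A = {z}" unfolding deg_def by (rule card_1_singletonE)
  let ?B = "A - {u}"
  have B: "insert u ?B = A" "u \<notin> ?B" "N u \<inter> ?B = {z}" "z \<in> ?B" using u z N_irrefl by auto
  show ?thesis
  proof (cases "2 \<le> deg ?B z")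
    case True
    obtain c p where "good c p ?B" using colourable by (auto simp: colourable_def)
    from good_add1[OF B(2,3) this, unfolded B(1)] True show ?thesis unfolding rooted_def by blast
  next
    case False
    then have "rooted ?B z" using rooted B by simp
    then obtain c p where "good c p ?B" "K p (E ?B) z = {}" by (auto simp: rooted_def)
    from good_add1[OF B(2,3) this(1), unfolded B(1)] this(2) show ?thesis unfolding rooted_def by blast
  qed
qed

text \<open>The neighbour \<open>y\<close> returns to degree three and may collect private edges.
  The other neighbour \<open>x\<close> can be freed in the rest, except when it has degree two there
  and only neighbours of degree at most two; then few edges are near \<open>x\<close> and it can be
  treated second.\<close>

lemma rooted_deg2:
  assumes u: "u \<in> A" "deg A u = 2" and y: "y \<in> N u \<inter> A" "deg A y = 3"
    and colourable: "colourable (A - {u})"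
    and leaf: "\<And>v. v \<in> A - {u} \<Longrightarrow> deg (A - {u}) v \<le> 1 \<Longrightarrow> rooted (A - {u}) v"
    and rooted: "\<And>v z. v \<in> A - {u} \<Longrightarrow> deg (A - {u}) v = 2 \<Longrightarrow> z \<in> N v \<inter> (A - {u}) \<Longrightarrow>
       deg (A - {u}) z = 3 \<Longrightarrow> rooted (A - {u}) v"
  shows "rooted A u"
proof -
  let ?B = "A - {u}"
  obtain x where x: "N u \<inter> A = {x, y}" "x \<noteq> y"
  proof -
    obtain a b where "N u \<inter> A = {a, b}" "a \<noteq> b" using deg2_obtain[OF u(2)] by blast
    with y that[of a] that[of b] show ?thesis by (cases "y = a") (auto simp: insert_commute)
  qed
  have B: "insert u ?B = A" "u \<notin> ?B" "N u \<inter> ?B = {x, y}" "N u \<inter> ?B = {y, x}" "x \<in> ?B" "y \<in> ?B" "u \<in> N x" "u \<in> N y"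
    using u x N_irrefl N_sym by auto
  have dx: "deg A x = Suc (deg ?B x)" and dy: "deg ?B y = 2"
    using deg_remove[of u x A] deg_remove[of u y A] B u y by auto
  have ny: "card (near (E ?B) y) \<le> 6" using card_near_deg2[OF B(6)] dy by simp
  have dx2: "deg ?B x \<le> 2" using dx deg_le3[of A x] by simp
  have root_x: "rooted A u" if r: "rooted ?B x"
  proof -
    from r obtain c p where g: "good c p ?B" "K p (E ?B) x = {}" by (auto simp: rooted_def)
    have ky: "card (K p (E ?B) y) \<le> 1" using g(1) dy B by (auto simp: good_def)
    have nx: "card (near (E ?B) x) \<le> 6" using card_near_deg2[OF B(5)] dx2 by simp
    have 1: "card (near (E ?B) x) + card (K p (E ?B) y) \<le> 7" using ky nx by simp
    have 2: "card (near (E ?B) y) + card (K p (E ?B) x) \<le> 6" using ny g(2) by simp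
    show ?thesis
    proof (rule good_add2[OF B(2,3) x(2) g(1) 1 2, unfolded B(1)])
      show "2 \<le> deg ?B x \<or> K p (E ?B) x = {}" using g(2) by simp
    qed (use dy in \<open>auto simp: rooted_def\<close>)
  qed
  show ?thesis
  proof (cases "deg ?B x = 2")
    case False
    then show ?thesis using root_x leaf[of x] dx2 B by simp
  next
    case dx2: True
    then obtain a b where ab: "N x \<inter> ?B = {a, b}" "a \<noteq> b" using deg2_obtain by blast
    show ?thesis
    proof (cases "deg ?B a = 3 \<or> deg ?B b = 3")
      case True
      then have "rooted ?B x" using rooted[of x a] rooted[of x b] ab dx2 B by blast
      then show ?thesis by (rule root_x)
    next
      case False
      then have "deg ?B a \<le> 2" "deg ?B b \<le> 2" using deg_le3[of ?B a] deg_le3[of ?B b] by linarith+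
      then have nx: "card (near (E ?B) x) \<le> 4" using card_near2[OF B(5) ab] by simp
      obtain c p where g: "good c p ?B" using colourable by (auto simp: colourable_def)
      have kx: "card (K p (E ?B) x) \<le> 1" "card (K p (E ?B) y) \<le> 1"
        using g dx2 dy B by (auto simp: good_def)
      \<comment> \<open>The roles are exchanged: \<open>y\<close> goes first with 6 + 1 barred
        colours, then \<open>x\<close> with 4 + 1.\<close>
      have 1: "card (near (E ?B) y) + card (K p (E ?B) x) \<le> 7" using ny kx by simp
      have 2: "card (near (E ?B) x) + card (K p (E ?B) y) \<le> 6" using nx kx by simp
      show ?thesis
      proof (rule good_add2[OF B(2,4) x(2)[symmetric] g 1 2, unfolded B(1)])
        show "2 \<le> deg ?B y \<or> K p (E ?B) y = {}" using dy by simp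
      qed (use dx2 in \<open>auto simp: rooted_def\<close>)
    qed
  qed
qed

text \<open>Here \<open>u\<close> is freed without a neighbour of degree three; the price is that
  nothing is known about the private edges at \<open>y\<close>.\<close>

lemma rooted_flat:
  assumes u: "u \<in> A" and N: "N u \<inter> A = {x, y}" "x \<noteq> y" and x: "deg A x \<le> 2"
    and r: "rooted (A - {u}) x"
  obtains c p where "valid c p (E A)" "K p (E A) u = {}"
    "\<And>v. v \<in> A \<Longrightarrow> v \<noteq> y \<Longrightarrow> deg A v \<le> 2 \<Longrightarrow> card (K p (E A) v) \<le> 1"
proof -
  let ?B = "A - {u}"
  have B: "insert u ?B = A" "u \<notin> ?B" "N u \<inter> ?B = {x, y}" "x \<in> ?B" "y \<in> ?B" "u \<in> N x" "u \<in> N y"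
    using u N N_irrefl N_sym by auto
  have dx: "deg ?B x \<le> 1" "deg ?B y \<le> 2"
    using deg_remove[of u x A] deg_remove[of u y A] B u x deg_le3[of A y] by auto
  from r obtain c p where g: "good c p ?B" "K p (E ?B) x = {}" by (auto simp: rooted_def)
  have ky: "card (K p (E ?B) y) \<le> 1" using g(1) dx B by (auto simp: good_def)
  have ny: "card (near (E ?B) y) \<le> 6" using card_near_deg2[OF B(5)] dx by simp
  have nx: "card (near (E ?B) x) \<le> 3" using card_near_le[OF B(4)] dx by simp
  have 1: "card (near (E ?B) x) + card (K p (E ?B) y) \<le> 7" using ky nx by simp
  have 2: "card (near (E ?B) y) + card (K p (E ?B) x) \<le> 6" using ny g(2) by simp
  show ?thesis
  proof (rule good_add2[OF B(2,3) N(2) g(1) 1 2, unfolded B(1)])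
    show "2 \<le> deg ?B x \<or> K p (E ?B) x = {}" using g(2) by simp
  qed (rule that)
qed

lemma colourable_flat:
  assumes u: "u \<in> A" and N: "N u \<inter> A = {x, y}" "x \<noteq> y" and dx: "deg A x \<le> 2" and dy: "deg A y \<le> 2"
    and r: "rooted (A - {u}) x"
  shows "colourable A"
proof -
  let ?B = "A - {u}" and ?C = "A - {u} - {y}"
  have B: "insert u ?B = A" "u \<notin> ?B" "N u \<inter> ?B = {x, y}" "x \<in> ?B" "y \<in> ?B" "u \<in> N x" "u \<in> N y"
    using u N N_irrefl N_sym by auto
  have ne: "x \<noteq> u" "y \<noteq> u" using B by auto
  have d: "deg ?B x \<le> 1" "deg ?B y \<le> 1"
    using deg_remove[of u x A] deg_remove[of u y A] B u dx dy by auto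
  from r obtain c p where g: "good c p ?B" "K p (E ?B) x = {}" by (auto simp: rooted_def)
  have v: "valid c p (E ?B)" using g by (simp add: good_def)
  have new: "{x, u} \<notin> E ?B" "{u, y} \<notin> E ?B" using u by (auto simp: E_iff)
  have ne2: "{x, u} \<noteq> {u, y}" using N ne by (auto simp: doubleton_eq_iff)
  have K1: "card (K p (E ?B) y) \<le> 1" using card_K_le[OF v, of y] d by simp
  have "blocked p (E ?B) x u \<subseteq> near (E ?B) x \<union> K p (E ?B) y"
    using K_sub_near[OF v, of x] priv_nbr[OF v, of u] B by (auto simp: blocked_def)
  then have "card (blocked p (E ?B) x u) \<le> card (near (E ?B) x \<union> K p (E ?B) y)" by (intro card_mono) auto
  with card_near_le[OF B(4)] d K1 card_Un_le[of "near (E ?B) x" "K p (E ?B) y"]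
  have "card (blocked p (E ?B) x u) \<le> 7" by linarith
  then obtain k where k: "valid (c({x, u} := k)) (p({x, u} := x)) (insert {x, u} (E ?B))"
    using add_edge_ex[OF v B(6) new(1) finE] by metis
  let ?p = "p({x, u} := x)" and ?M = "insert {x, u} (E ?B)"
  have nearu: "near (E ?B) u \<subseteq> star (E ?B) x \<union> star (E ?B) y"
  proof
    fix f assume f: "f \<in> near (E ?B) u"
    then have "f \<subseteq> ?B" using E_subset by (auto simp: near_def)
    with f B(3) show "f \<in> star (E ?B) x \<union> star (E ?B) y"
      by (auto simp: near_def star_def ball_def)
  qed
  have "card (near (E ?B) u) \<le> card (star (E ?B) x \<union> star (E ?B) y)"
    by (intro card_mono nearu) (auto simp: star_def)
  also have "\<dots> \<le> 2"
    using card_Un_le[of "star (E ?B) x" "star (E ?B) y"] card_star[of ?B x] card_star[of ?B y] d by linarith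
  finally have nu: "card (near (E ?B) u) \<le> 2" .
  have pn: "{f \<in> E ?B. p f \<in> N y} = (\<Union>z\<in>N y \<inter> ?B. K p (E ?B) z)" by (rule priv_nbr[OF v])
  have "card (\<Union>z\<in>N y \<inter> ?B. K p (E ?B) z) \<le> (\<Sum>z\<in>N y \<inter> ?B. card (K p (E ?B) z))"
    by (intro card_UN_le) auto
  also have "\<dots> \<le> (\<Sum>z\<in>N y \<inter> ?B. 3)"
    using card_K_le[OF v] deg_le3 order_trans by (intro sum_mono) blast
  also have "\<dots> \<le> 3" using d(2) by (simp add: deg_def)
  finally have pn3: "card {f \<in> E ?B. p f \<in> N y} \<le> 3" using pn by simp
  \<comment> \<open>At most 1 + 2 + 3 colours: the first new edge, the old edges at \<open>x\<close>
    and \<open>y\<close>, and the private edges of the one remaining neighbour of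
    \<open>y\<close>.\<close>
  have "blocked ?p ?M u y \<subseteq> insert {x, u} (near (E ?B) u \<union> {f \<in> E ?B. p f \<in> N y})"
    by (auto simp: blocked_def near_def)
  then have "card (blocked ?p ?M u y) \<le> card (insert {x, u} (near (E ?B) u \<union> {f \<in> E ?B. p f \<in> N y}))"
    by (intro card_mono) auto
  also have "\<dots> \<le> Suc (card (near (E ?B) u \<union> {f \<in> E ?B. p f \<in> N y}))" by (simp add: card_insert_if)
  also have "\<dots> \<le> 7"
    using nu pn3 card_Un_le[of "near (E ?B) u" "{f \<in> E ?B. p f \<in> N y}"] by linarith
  finally have "card (blocked ?p ?M u y) \<le> 7" .
  moreover have "{u, y} \<notin> ?M" using new ne2 by auto
  moreover have "y \<in> N u" using B(3) by auto
  ultimately obtain l where l: "valid (c({x, u} := k, {u, y} := l)) (?p({u, y} := u)) (insert {u, y} ?M)"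
    using add_edge_ex[OF k] by (metis finE finite_insert)
  have EE: "E A = insert {u, y} ?M" using E_insert[OF B(2)] B(1,3) by (auto simp: insert_commute)
  let ?q = "?p({u, y} := u)"
  have Kq: "K ?q (E A) w = (if w = x then {{x, u}} else if w = u then {{u, y}} else K p (E ?B) w)" for w
    using new ne2 ne g(2) K_out[OF v B(2)] by (auto simp: EE K_def)
  have "good (c({x, u} := k, {u, y} := l)) ?q A"
    unfolding good_def
  proof (intro conjI ballI impI)
    show "valid (c({x, u} := k, {u, y} := l)) ?q (E A)" using l EE by simp
    fix w assume w: "w \<in> A" "deg A w \<le> 2"
    moreover have "deg ?B w \<le> deg A w" by (intro deg_mono) auto
    ultimately show "card (K ?q (E A) w) \<le> 1" using g(1) Kq[of w] by (auto simp: good_def)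
  qed
  then show ?thesis by (auto simp: colourable_def)
qed

text \<open>One induction over vertex sets proves all three claims, since deleting a vertex turns
  each of them into instances of the others. The neighbour of degree three in the last claim
  excludes cycle components, where no vertex can be freed.\<close>

theorem sparse_colourings:
  assumes "sparse A"
  shows "colourable A" and "\<And>u. u \<in> A \<Longrightarrow> deg A u \<le> 1 \<Longrightarrow> rooted A u"
    and "\<And>u y. u \<in> A \<Longrightarrow> deg A u = 2 \<Longrightarrow> y \<in> N u \<inter> A \<Longrightarrow> deg A y = 3 \<Longrightarrow> rooted A u"
proof -
  have "finite A" using assms finV finite_subset by (auto simp: sparse_def)
  then have "colourable A \<and> (\<forall>u\<in>A. deg A u \<le> 1 \<longrightarrow> rooted A u) \<and>
    (\<forall>u\<in>A. \<forall>y. deg A u = 2 \<and> y \<in> N u \<inter> A \<and> deg A y = 3 \<longrightarrow> rooted A u)"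
    using assms
  proof (induction A rule: finite_psubset_induct)
    case (psubset A)
    have IH: "colourable (A - {u})" "\<And>v. v \<in> A - {u} \<Longrightarrow> deg (A - {u}) v \<le> 1 \<Longrightarrow> rooted (A - {u}) v"
      "\<And>v z. v \<in> A - {u} \<Longrightarrow> deg (A - {u}) v = 2 \<Longrightarrow> z \<in> N v \<inter> (A - {u}) \<Longrightarrow>
         deg (A - {u}) z = 3 \<Longrightarrow> rooted (A - {u}) v" if "u \<in> A" for u
    proof -
      have "sparse (A - {u})" using psubset.prems by (rule sparse_mono) auto
      then have *: "colourable (A - {u}) \<and> (\<forall>v\<in>A - {u}. deg (A - {u}) v \<le> 1 \<longrightarrow> rooted (A - {u}) v) \<and>
        (\<forall>v\<in>A - {u}. \<forall>y. deg (A - {u}) v = 2 \<and> y \<in> N v \<inter> (A - {u}) \<and> deg (A - {u}) y = 3 \<longrightarrow> rooted (A - {u}) v)"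
        using that by (intro psubset.IH) auto
      show "colourable (A - {u})" "\<And>v. v \<in> A - {u} \<Longrightarrow> deg (A - {u}) v \<le> 1 \<Longrightarrow> rooted (A - {u}) v"
        "\<And>v z. v \<in> A - {u} \<Longrightarrow> deg (A - {u}) v = 2 \<Longrightarrow> z \<in> N v \<inter> (A - {u}) \<Longrightarrow>
         deg (A - {u}) z = 3 \<Longrightarrow> rooted (A - {u}) v"
        using * by blast+
    qed
    have leaf: "rooted A u" if "u \<in> A" "deg A u \<le> 1" for u
      by (rule rooted_leaf[OF that IH(1,2)[OF that(1)]])
    have deg2: "rooted A u" if "u \<in> A" "deg A u = 2" "y \<in> N u \<inter> A" "deg A y = 3" for u y
      by (rule rooted_deg2[OF that IH[OF that(1)]])
    have "colourable A"
    proof (cases "A = {}")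
      case True
      then show ?thesis by (auto simp: colourable_def good_def valid_def E_def)
    next
      case False
      then obtain v where v: "v \<in> A" "deg A v \<le> 2" using psubset.prems by (auto simp: sparse_def)
      show ?thesis
      proof (cases "deg A v = 2")
        case False
        then have "rooted A v" using v leaf[of v] by simp
        then show ?thesis by (auto simp: rooted_def colourable_def)
      next
        case True
        then obtain x y where xy: "N v \<inter> A = {x, y}" "x \<noteq> y" using deg2_obtain by blast
        show ?thesis
        proof (cases "deg A x = 3 \<or> deg A y = 3")
          case True
          then have "rooted A v"
            using deg2[of v x, OF v(1) \<open>deg A v = 2\<close>] deg2[of v y, OF v(1) \<open>deg A v = 2\<close>] xy(1) by auto
          then show ?thesis by (auto simp: rooted_def colourable_def)
        next
          case False
          then have d: "deg A x \<le> 2" "deg A y \<le> 2" using deg_le3[of A x] deg_le3[of A y] by linarith+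
          have x: "x \<in> A - {v}" "v \<in> N x" using xy(1) N_irrefl[of v] N_sym[of x v] by auto
          have "deg (A - {v}) x \<le> 1" using deg_remove[OF x(2) v(1)] d by simp
          then have "rooted (A - {v}) x" by (rule IH(2)[OF v(1) x(1)])
          then show ?thesis by (rule colourable_flat[OF v(1) xy d])
        qed
      qed
    qed
    moreover have "\<forall>u\<in>A. deg A u \<le> 1 \<longrightarrow> rooted A u" using leaf by simp
    moreover have "\<forall>u\<in>A. \<forall>y. deg A u = 2 \<and> y \<in> N u \<inter> A \<and> deg A y = 3 \<longrightarrow> rooted A u"
      using deg2 by metis
    ultimately show ?case by simp
  qed
  then show "colourable A" "\<And>u. u \<in> A \<Longrightarrow> deg A u \<le> 1 \<Longrightarrow> rooted A u"
    "\<And>u y. u \<in> A \<Longrightarrow> deg A u = 2 \<Longrightarrow> y \<in> N u \<inter> A \<Longrightarrow> deg A y = 3 \<Longrightarrow> rooted A u"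
    by blast+
qed

end

section \<open>List colouring around a cycle\<close>

lemma ex_fresh_colour:
  assumes "finite S" "card S \<le> 7"
  shows "\<exists>k<8::nat. k \<notin> S"
proof -
  have "\<not> {..<8} \<subseteq> S" using assms card_mono[of S "{..<8}"] by auto
  then show ?thesis by auto
qed

text \<open>\<open>L i\<close> is the list of the pendant edge at \<open>c i\<close>, \<open>D i\<close> are the colours at its outer end \<open>d i\<close>, \<open>P i\<close> those
  of edges with private end \<open>d i\<close>, and \<open>R i l\<close> says that \<open>d i\<close> and \<open>d l\<close> are adjacent.\<close>

locale cycle_lists =
  fixes g :: nat and L D P :: "nat \<Rightarrow> nat set" and R :: "nat \<Rightarrow> nat \<Rightarrow> bool"
  assumes g3: "3 \<le> g"
    and R_sym: "\<And>i j. R i j \<Longrightarrow> R j i" and R_irrefl: "\<And>i. \<not> R i i"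
    and L_card: "\<And>i. i < g \<Longrightarrow> 2 + card {l. l < g \<and> R i l} \<le> card (L i)"
    and fin [simp]: "\<And>i. finite (L i)" "\<And>i. finite (D i)" "\<And>i. finite (P i)"
    and L8: "\<And>i. L i \<subseteq> {..<8}"
    and D8: "\<And>i. D i \<subseteq> {..<8}"
    and D_card: "\<And>i. i < g \<Longrightarrow> card (D i) \<le> 2"
    and P0: "P 0 = {}"
    and DP: "\<And>i. 1 \<le> i \<Longrightarrow> i + 3 \<le> g \<Longrightarrow> card (D (i + 1) \<union> P i) \<le> 3"
    and DP': "card (D (g - 2) \<union> P (g - 1)) \<le> 3"
begin

section \<open>Colouring the pendant edges from their lists\<close>

definition ok :: "(nat \<Rightarrow> nat) \<Rightarrow> nat set \<Rightarrow> bool" where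
  "ok v S \<longleftrightarrow> (\<forall>i\<in>S. v i \<in> L i) \<and> (\<forall>i\<in>S. \<forall>l\<in>S. R i l \<longrightarrow> v i \<noteq> v l)"

lemma ok_subset: "ok v S \<Longrightarrow> T \<subseteq> S \<Longrightarrow> ok v T"
  unfolding ok_def by blast

text \<open>The surplus of two in \<open>L_card\<close> leaves room for one forbidden colour
  \<open>x\<close> beyond those of the conflicting pendant edges. This spare colour drives the whole
  order of colouring.\<close>

lemma ok_update:
  assumes "ok v S" "i < g" "S \<subseteq> {..<g}"
  obtains a where "a \<noteq> x" "ok (v(i := a)) (insert i S)"
proof -
  let ?T = "insert x (v ` {l. l < g \<and> R i l})"
  have "card ?T \<le> Suc (card {l. l < g \<and> R i l})"
    using card_image_le[of "{l. l < g \<and> R i l}" v] by (simp add: card_insert_if)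
  then have "card ?T < card (L i)" using L_card[OF assms(2)] by simp
  then have "\<not> L i \<subseteq> ?T" using card_mono[of ?T "L i"] by auto
  then obtain a where a: "a \<in> L i" "a \<noteq> x" "\<And>l. l < g \<Longrightarrow> R i l \<Longrightarrow> a \<noteq> v l" by auto
  have "ok (v(i := a)) (insert i S)"
    using assms a R_sym R_irrefl unfolding ok_def by (auto simp: subset_iff)
  with a that show ?thesis by blast
qed

lemma ok_extend:
  assumes "ok v S" "S \<subseteq> {..<g}" "finite T" "T \<subseteq> {..<g}"
  shows "\<exists>w. ok w (S \<union> T) \<and> (\<forall>i\<in>S. w i = v i)"
  using assms(3,4)
proof (induction T rule: finite_induct)
  case empty
  with assms show ?case by auto
next
  case (insert t T)
  then obtain w where w: "ok w (S \<union> T)" "\<forall>i\<in>S. w i = v i" by auto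
  show ?case
  proof (cases "t \<in> S")
    case True
    with w show ?thesis by (intro exI[of _ w]) (auto simp: insert_absorb)
  next
    case False
    have "t < g" "S \<union> T \<subseteq> {..<g}" using insert.prems assms(2) by auto
    from ok_update[OF w(1) this, of 0] obtain a where "ok (w(t := a)) (insert t (S \<union> T))" by blast
    moreover have "insert t (S \<union> T) = S \<union> insert t T" by auto
    ultimately have "ok (w(t := a)) (S \<union> insert t T)" by metis
    moreover have "\<forall>i\<in>S. (w(t := a)) i = v i" using w(2) False by auto
    ultimately show ?thesis by blast
  qed
qed

text \<open>Here \<open>e\<close> is the colour of the cycle edge \<open>g - 2\<close>. The closing
  edge \<open>g - 1\<close> must also avoid the cycle edges \<open>0\<close> and
  \<open>g - 3\<close>, so five is the most that eight colours allow.\<close>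

definition start :: "(nat \<Rightarrow> nat) \<Rightarrow> nat \<Rightarrow> bool" where
  "start v e \<longleftrightarrow> ok v {0, g - 3, g - 2, g - 1} \<and> e < 8 \<and>
     e \<notin> {v (g - 3), v (g - 2), v (g - 1)} \<union> (D (g - 2) \<union> P (g - 1)) \<and>
     card ({v (g - 2), v (g - 1), v 0, e} \<union> D (g - 1)) \<le> 5"

text \<open>The last edge of the cycle sees five colours of pendant edges and two more at its private
  end; one coincidence among these is arranged at the very beginning.\<close>

lemma start_from_partial:
  assumes g4: "4 \<le> g" and w: "ok w S" "S \<subseteq> {0, g - 3, g - 2, g - 1}"
    and small: "\<And>v. \<forall>i\<in>S. v i = w i \<Longrightarrow> card ({v (g - 2), v (g - 1), v 0} \<union> D (g - 1)) \<le> 4"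
  shows "\<exists>v e. start v e"
proof -
  let ?F = "D (g - 2) \<union> P (g - 1)" and ?T = "{0, g - 3, g - 2, g - 1}"
  have "S \<subseteq> {..<g}" "?T \<subseteq> {..<g}" using w(2) g4 by auto
  with ok_extend[OF w(1) this(1), of ?T] obtain v where v: "ok v (S \<union> ?T)" "\<forall>i\<in>S. v i = w i"
    by blast
  have ok: "ok v ?T" by (rule ok_subset[OF v(1)]) blast
  have "card (set [v (g - 3), v (g - 2), v (g - 1)] \<union> ?F) \<le> 3 + 3"
    using DP' card_Un_le[of "set [v (g - 3), v (g - 2), v (g - 1)]" ?F]
      card_length[of "[v (g - 3), v (g - 2), v (g - 1)]"] by simp
  then obtain e where e: "e < 8" "e \<notin> set [v (g - 3), v (g - 2), v (g - 1)] \<union> ?F"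
    using ex_fresh_colour[of "set [v (g - 3), v (g - 2), v (g - 1)] \<union> ?F"] by auto
  have "{v (g - 2), v (g - 1), v 0, e} \<union> D (g - 1) = insert e ({v (g - 2), v (g - 1), v 0} \<union> D (g - 1))"
    by blast
  then have "card ({v (g - 2), v (g - 1), v 0, e} \<union> D (g - 1)) \<le> Suc (card ({v (g - 2), v (g - 1), v 0} \<union> D (g - 1)))"
    by (simp add: card_insert_if)
  also have "\<dots> \<le> 5" using small[OF v(2)] by simp
  finally have "start v e" using ok e unfolding start_def by simp
  then show ?thesis by blast
qed

text \<open>Three colours and a set of two make at most five; each alternative makes one of them
  redundant.\<close>

lemma card_coincidence:
  assumes "x \<in> D i \<or> y \<in> D i \<or> z \<in> D i \<or> x = z \<or> y = z \<or> card (D i) < 2" "i < g"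
  shows "card ({x, y, z} \<union> D i) \<le> 4"
proof -
  have s2: "card ({x, y} \<union> D i) \<le> 4" for x y
    using card_Un_le[of "{x, y}" "D i"] D_card[OF assms(2)] card_length[of "[x, y]"] by simp
  have "card ({x, y, z} \<union> D i) \<le> 3 + card (D i)"
    using card_Un_le[of "{x, y, z}" "D i"] card_length[of "[x, y, z]"] by simp
  moreover have "{x, y, z} \<union> D i = {y, z} \<union> D i \<or> {x, y, z} \<union> D i = {x, z} \<union> D i \<or>
    {x, y, z} \<union> D i = {x, y} \<union> D i \<or> card (D i) < 2"
    using assms(1) by blast
  ultimately show ?thesis using s2 by (elim disjE) simp_all
qed

text \<open>The search is for a colour that can be used twice around the closing edge. If the
  pendant edges and \<open>D (g - 1)\<close> offer none, then \<open>L 0\<close> and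
  \<open>D (g - 1)\<close> are disjoint and hold at least four colours together. One of these is
  outside the at most three colours barred from the edge \<open>g - 2\<close>, and that edge itself
  then provides the coincidence.\<close>

lemma start_exists:
  assumes g4: "4 \<le> g"
  shows "\<exists>v e. start v e"
proof -
  let ?a = "g - 3" and ?b = "g - 2" and ?c = "g - 1"
  let ?F = "D ?b \<union> P ?c"
  have lt: "0 < g" "?a < g" "?b < g" "?c < g" using g4 by auto
  have ne: "?a \<noteq> 0" "?a \<noteq> ?b" "?a \<noteq> ?c" using g4 by auto
  have "card (D ?c) < 2 \<or> card (D ?c) = 2" using D_card[OF lt(4)] by linarith
  then consider (b) x where "x \<in> L ?b" "x \<in> D ?c" | (c) x where "x \<in> L ?c" "x \<in> D ?c"
    | (z) x where "x \<in> L 0" "x \<in> D ?c"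
    | (bz) x where "\<not> R ?b 0" "x \<in> L ?b" "x \<in> L 0" | (cz) x where "\<not> R ?c 0" "x \<in> L ?c" "x \<in> L 0"
    | (small) "card (D ?c) < 2"
    | (rest) "L ?b \<inter> D ?c = {}" "L ?c \<inter> D ?c = {}" "L 0 \<inter> D ?c = {}" "card (D ?c) = 2"
        "R ?b 0 \<or> L ?b \<inter> L 0 = {}" "R ?c 0 \<or> L ?c \<inter> L 0 = {}"
    by blast
  then show ?thesis
  proof cases
    case b
    show ?thesis
    proof (rule start_from_partial[OF g4])
      show "ok (\<lambda>_. x) {?b}" using b R_irrefl by (auto simp: ok_def)
      show "{?b} \<subseteq> {0, ?a, ?b, ?c}" by blast
      fix v :: "nat \<Rightarrow> nat" assume "\<forall>i\<in>{?b}. v i = x"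
      then show "card ({v ?b, v ?c, v 0} \<union> D ?c) \<le> 4" using b by (intro card_coincidence lt) simp
    qed
  next
    case c
    show ?thesis
    proof (rule start_from_partial[OF g4])
      show "ok (\<lambda>_. x) {?c}" using c R_irrefl by (auto simp: ok_def)
      show "{?c} \<subseteq> {0, ?a, ?b, ?c}" by blast
      fix v :: "nat \<Rightarrow> nat" assume "\<forall>i\<in>{?c}. v i = x"
      then show "card ({v ?b, v ?c, v 0} \<union> D ?c) \<le> 4" using c by (intro card_coincidence lt) simp
    qed
  next
    case z
    show ?thesis
    proof (rule start_from_partial[OF g4])
      show "ok (\<lambda>_. x) {0}" using z R_irrefl by (auto simp: ok_def)
      show "{0} \<subseteq> {0, ?a, ?b, ?c}" by blast
      fix v :: "nat \<Rightarrow> nat" assume "\<forall>i\<in>{0}. v i = x"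
      then show "card ({v ?b, v ?c, v 0} \<union> D ?c) \<le> 4" using z by (intro card_coincidence lt) simp
    qed
  next
    case bz
    show ?thesis
    proof (rule start_from_partial[OF g4])
      show "ok (\<lambda>_. x) {0, ?b}" using bz R_irrefl R_sym[of 0 ?b] by (auto simp: ok_def)
      show "{0, ?b} \<subseteq> {0, ?a, ?b, ?c}" by blast
      fix v :: "nat \<Rightarrow> nat" assume "\<forall>i\<in>{0, ?b}. v i = x"
      then show "card ({v ?b, v ?c, v 0} \<union> D ?c) \<le> 4" using bz by (intro card_coincidence lt) simp
    qed
  next
    case cz
    show ?thesis
    proof (rule start_from_partial[OF g4])
      show "ok (\<lambda>_. x) {0, ?c}" using cz R_irrefl R_sym[of 0 ?c] by (auto simp: ok_def)
      show "{0, ?c} \<subseteq> {0, ?a, ?b, ?c}" by blast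
      fix v :: "nat \<Rightarrow> nat" assume "\<forall>i\<in>{0, ?c}. v i = x"
      then show "card ({v ?b, v ?c, v 0} \<union> D ?c) \<le> 4" using cz by (intro card_coincidence lt) simp
    qed
  next
    case small
    show ?thesis
    proof (rule start_from_partial[OF g4])
      show "ok (\<lambda>_. 0) {}" by (simp add: ok_def)
      show "{} \<subseteq> {0, ?a, ?b, ?c}" by blast
      show "card ({v ?b, v ?c, v 0} \<union> D ?c) \<le> 4" for v :: "nat \<Rightarrow> nat" using small by (intro card_coincidence lt) simp
    qed
  next
    case rest
    have "card (L 0 \<union> D ?c) = card (L 0) + card (D ?c)" using rest(3) by (intro card_Un_disjoint) auto
    then have "card ?F < card (L 0 \<union> D ?c)" using L_card[OF lt(1)] rest(4) DP' by simp
    then have "\<not> L 0 \<union> D ?c \<subseteq> ?F" using card_mono[of ?F "L 0 \<union> D ?c"] by auto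
    then obtain e where e: "e \<in> L 0 \<union> D ?c" "e \<notin> ?F" by auto
    \<comment> \<open>If \<open>e\<close> comes from \<open>L 0\<close>, the pendant edge
      \<open>0\<close> is fixed to it; otherwise \<open>e\<close> already lies in
      \<open>D (g - 1)\<close>.\<close>
    define S where "S = (if e \<in> L 0 then {0::nat} else {})"
    have "ok (\<lambda>_. e) S" by (auto simp: ok_def S_def R_irrefl)
    moreover have S: "S \<subseteq> {..<g}" using lt by (auto simp: S_def)
    moreover have "{0, ?b, ?c} \<subseteq> {..<g}" using lt by auto
    ultimately obtain w where w: "ok w (S \<union> {0, ?b, ?c})" "\<forall>i\<in>S. w i = e"
      using ok_extend[of "\<lambda>_. e" S "{0, ?b, ?c}"] by blast
    have ok: "ok w {0, ?b, ?c}" by (rule ok_subset[OF w(1)]) auto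
    have "{0, ?b, ?c} \<subseteq> {..<g}" using lt by auto
    \<comment> \<open>The spare colour of the list keeps the pendant edge \<open>g - 3\<close> away
      from \<open>e\<close>.\<close>
    from ok_update[OF ok lt(2) this, of e] obtain x where
      x: "x \<noteq> e" "ok (w(?a := x)) (insert ?a {0, ?b, ?c})" by blast
    have ez: "e \<in> D ?c \<or> w 0 = e" using e w(2) by (auto simp: S_def)
    have "w ?b \<in> L ?b" "w ?c \<in> L ?c" "w 0 \<in> L 0" "R ?b 0 \<longrightarrow> w ?b \<noteq> w 0" "R ?c 0 \<longrightarrow> w ?c \<noteq> w 0"
      using ok by (simp_all add: ok_def)
    note wL = this
    \<comment> \<open>If this pendant edge had colour \<open>e\<close>, then \<open>e\<close> would
      be outside \<open>D (g - 1)\<close> and so be the colour of pendant edge \<open>0\<close>; but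
      these two edges are in conflict or have disjoint lists.\<close>
    have eb: "w ?b \<noteq> e"
    proof
      assume we: "w ?b = e"
      with wL have "e \<in> L ?b" by simp
      with rest(1) ez have "w 0 = e" by auto
      with we wL rest(5) show False by auto
    qed
    have ec: "w ?c \<noteq> e"
    proof
      assume we: "w ?c = e"
      with wL have "e \<in> L ?c" by simp
      with rest(2) ez have "w 0 = e" by auto
      with we wL rest(6) show False by auto
    qed
    have "{w ?b, w ?c, w 0, e} \<union> D ?c = {w ?b, w ?c, w 0} \<union> D ?c" using ez by auto
    moreover have "card ({w ?b, w ?c, w 0} \<union> D ?c) \<le> 3 + 2"
      using card_Un_le[of "{w ?b, w ?c, w 0}" "D ?c"] card_length[of "[w ?b, w ?c, w 0]"] rest(4) by simp
    ultimately have "card ({w ?b, w ?c, w 0, e} \<union> D ?c) \<le> 5" by simp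
    moreover have "e < 8" using e L8[of 0] D8[of ?c] by auto
    moreover have "insert ?a {0, ?b, ?c} = {0, ?a, ?b, ?c}" by auto
    ultimately have "start (w(?a := x)) e"
      using x(1) x(2)[unfolded \<open>insert ?a {0, ?b, ?c} = _\<close>] e(2) eb[symmetric] ec[symmetric] ne
      by (simp add: start_def del: One_nat_def)
    then show ?thesis by blast
  qed
qed

text \<open>The restriction \<open>i + 4 \<le> g\<close> leaves out \<open>i = g - 3\<close>, for
  which \<open>i + 2\<close> is the closing edge and is coloured last.\<close>

definition inner :: "(nat \<Rightarrow> nat) \<Rightarrow> (nat \<Rightarrow> nat) \<Rightarrow> nat \<Rightarrow> bool" where
  "inner v e i \<longleftrightarrow> e i < 8 \<and> e i \<notin> {v i, v (i + 1), v (i + 2)} \<union> (D (i + 1) \<union> P i) \<and> e i \<noteq> e (i + 1) \<and>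
     (i + 4 \<le> g \<longrightarrow> e i \<noteq> e (i + 2))"

lemma avoid:
  assumes "finite S" "card S \<le> n" "length xs + n \<le> 7"
  shows "\<exists>k<8::nat. k \<notin> set xs \<and> k \<notin> S"
proof -
  have "card (set xs \<union> S) \<le> 7"
    using assms card_Un_le[of "set xs" S] card_length[of xs] by linarith
  then show ?thesis using ex_fresh_colour[of "set xs \<union> S"] assms(1) by auto
qed

text \<open>Going down, the cycle edge \<open>i\<close> is coloured before the pendant edge
  \<open>i\<close>. It sees two pendant edges, two cycle edges and three colours in
  \<open>D (i + 1) \<union> P i\<close>; afterwards the spare colour in \<open>L i\<close> keeps the
  pendant edge away from it.\<close>

lemma descend:
  assumes g4: "4 \<le> g" and s: "start v0 e0" and m: "m + 4 \<le> g"
  shows "\<exists>v e. ok v (insert 0 {g - 3 - m..<g}) \<and> start v (e (g - 2)) \<and>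
    (\<forall>i. g - 3 - m \<le> i \<and> i + 3 \<le> g \<longrightarrow> inner v e i)"
  using m
proof (induction m)
  case 0
  have S: "{0, g - 3, g - 2, g - 1} = insert 0 {g - 3 - 0..<g}" using g4 by auto
  have g: "g - 3 + 1 = g - 2" "g - 3 + 2 = g - 1" "g - 2 \<noteq> g - 3" using g4 by auto
  have card: "card (D (g - 2) \<union> P (g - 3)) \<le> 3"
    using DP[of "g - 3", unfolded g(1)] g4 by simp
  \<comment> \<open>The pendant edge \<open>g - 3\<close> is coloured already, but the cycle edge
    \<open>g - 1\<close> is not, so the count is again 4 + 3.\<close>
  obtain x where x: "x < 8" "x \<notin> set [v0 (g - 3), v0 (g - 2), v0 (g - 1), e0]" "x \<notin> D (g - 2) \<union> P (g - 3)"
    using avoid[OF _ card, of "[v0 (g - 3), v0 (g - 2), v0 (g - 1), e0]"] by auto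
  let ?e = "(\<lambda>_. 0)(g - 2 := e0, g - 3 := x)"
  have "inner v0 ?e (g - 3)" unfolding inner_def g using x g4 by auto
  moreover have "\<forall>i. g - 3 - 0 \<le> i \<and> i + 3 \<le> g \<longrightarrow> i = g - 3" by auto
  moreover have "ok v0 (insert 0 {g - 3 - 0..<g})" using s S by (simp add: start_def)
  moreover have "start v0 (?e (g - 2))" using s g by simp
  ultimately have "ok v0 (insert 0 {g - 3 - 0..<g}) \<and> start v0 (?e (g - 2)) \<and>
    (\<forall>i. g - 3 - 0 \<le> i \<and> i + 3 \<le> g \<longrightarrow> inner v0 ?e i)"
    by metis
  then show ?case by blast
next
  case (Suc m)
  obtain v e where ok: "ok v (insert 0 {g - 3 - m..<g})" and st: "start v (e (g - 2))"
    and inn: "\<And>i. g - 3 - m \<le> i \<Longrightarrow> i + 3 \<le> g \<Longrightarrow> inner v e i"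
    using Suc.IH Suc.prems by (metis Suc_leD add_Suc)
  define i where "i = g - 3 - Suc m"
  have i: "1 \<le> i" "i + 4 \<le> g" "g - 3 - m = Suc i" "i < g" using Suc.prems by (auto simp: i_def)
  obtain x where x: "x < 8" "x \<notin> set [v (i + 1), v (i + 2), e (i + 1), e (i + 2)]" "x \<notin> D (i + 1) \<union> P i"
    using avoid[OF _ DP[of i], of "[v (i + 1), v (i + 2), e (i + 1), e (i + 2)]"] i by auto
  have "insert 0 {g - 3 - m..<g} \<subseteq> {..<g}" using i by auto
  from ok_update[OF ok i(4) this, of x] obtain a where
    a: "a \<noteq> x" "ok (v(i := a)) (insert i (insert 0 {g - 3 - m..<g}))" by blast
  have "insert i (insert 0 {g - 3 - m..<g}) = insert 0 {i..<g}" using i by auto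
  with a have ok': "ok (v(i := a)) (insert 0 {i..<g})" by simp
  have "inner (v(i := a)) (e(i := x)) l" if l: "i \<le> l" "l + 3 \<le> g" for l
  proof (cases "l = i")
    case True
    then show ?thesis using x a i by (auto simp: inner_def)
  next
    case False
    then show ?thesis using inn[of l] l i by (auto simp: inner_def)
  qed
  moreover have "start (v(i := a)) ((e(i := x)) (g - 2))"
  proof -
    have "ok (v(i := a)) {0, g - 3, g - 2, g - 1}" by (rule ok_subset[OF ok']) (use i in auto)
    moreover have "(v(i := a)) 0 = v 0" "(v(i := a)) (g - 3) = v (g - 3)" "(v(i := a)) (g - 2) = v (g - 2)"
      "(v(i := a)) (g - 1) = v (g - 1)" "(e(i := x)) (g - 2) = e (g - 2)"
      using i(1,2) by auto
    ultimately show ?thesis using st by (simp only: start_def simp_thms)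
  qed
  ultimately show ?case using ok' unfolding i_def[symmetric] by blast
qed

text \<open>\<open>v i\<close> is for the pendant edge at \<open>c i\<close>, and \<open>e i\<close> for the cycle edge from \<open>c i\<close> to \<open>c (i + 1)\<close>, whose private
  end is \<open>c (i + 1)\<close> except for the last two edges, where it is \<open>c i\<close>. Turning these two saves one conflict
  each.\<close>

theorem cycle_choice:
  obtains v e where "ok v {..<g}" "\<And>i. i < g \<Longrightarrow> e i < 8"
    "\<And>i. i + 3 \<le> g \<Longrightarrow> e i \<notin> {v i, v (i + 1), v (i + 2)} \<union> (D (i + 1) \<union> P i)"
    "\<And>i. i + 3 \<le> g \<Longrightarrow> e i \<noteq> e (i + 1) \<and> e i \<noteq> e (i + 2)"
    "e (g - 2) \<notin> {v (g - 3), v (g - 2), v (g - 1)} \<union> (D (g - 2) \<union> P (g - 1))" "e (g - 2) \<noteq> e (g - 1)"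
    "e (g - 1) \<notin> {v (g - 2), v (g - 1), v 0} \<union> D (g - 1)" "e (g - 1) \<noteq> e 0"
proof (cases "4 \<le> g")
  case g4: True
  obtain v0 e0 where "start v0 e0" using start_exists[OF g4] by blast
  moreover have g1: "g - 3 - (g - 4) = 1" "g - 4 + 4 \<le> g" using g4 by simp_all
  ultimately obtain v e where ok: "ok v (insert 0 {1..<g})"
    and st: "start v (e (g - 2))" and inn: "\<And>i. 1 \<le> i \<Longrightarrow> i + 3 \<le> g \<Longrightarrow> inner v e i"
    using descend[OF g4 _ g1(2)] unfolding g1(1) by blast
  have D1: "card (D 1) \<le> 2" using D_card g4 by simp
  \<comment> \<open>\<open>P 0\<close> is empty, so the count is 5 + 2 although the pendant edge
    \<open>0\<close> is coloured.\<close>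
  obtain x where x: "x < 8" "x \<notin> set [v 0, v 1, v 2, e 1, e 2]" "x \<notin> D 1"
    using avoid[OF _ D1, of "[v 0, v 1, v 2, e 1, e 2]"] by auto
  let ?S = "{v (g - 2), v (g - 1), v 0, e (g - 2)} \<union> D (g - 1)"
  have cS: "card ?S \<le> 5" using st by (simp add: start_def)
  \<comment> \<open>This is where the coincidence pays: five colours from \<open>start\<close> and
    two cycle edges.\<close>
  obtain y where y: "y < 8" "y \<notin> set [x, e (g - 3)]" "y \<notin> ?S"
    using avoid[OF _ cS, of "[x, e (g - 3)]"] by auto
  define f where "f = e(0 := x, g - 1 := y)"
  have f: "f 0 = x" "f (g - 1) = y" "\<And>i. 0 < i \<Longrightarrow> i < g - 1 \<Longrightarrow> f i = e i" using g4 by (auto simp: f_def)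
  have e8: "e i < 8" if "1 \<le> i" "i + 2 \<le> g" for i
    using that inn[of i] st by (cases "i = g - 2") (auto simp: inner_def start_def)
  show ?thesis
  proof (rule that[of v f])
    have "insert 0 {1..<g} = {..<g}" using g4 by auto
    with ok show "ok v {..<g}" by simp
    show "f i < 8" if "i < g" for i
      using that x y e8[of i] by (cases "i = 0"; cases "i = g - 1") (auto simp: f[simplified])
    show "f i \<notin> {v i, v (i + 1), v (i + 2)} \<union> (D (i + 1) \<union> P i)" if "i + 3 \<le> g" for i
      using that x inn[of i] P0 by (cases "i = 0") (auto simp: f[simplified] inner_def numeral_eq_Suc)
    show "f i \<noteq> f (i + 1) \<and> f i \<noteq> f (i + 2)" if i: "i + 3 \<le> g" for i
    proof (cases "i = 0")
      case True
      then show ?thesis using x f(3)[of 1] f(3)[of 2] g4 f(1) by (auto simp: numeral_eq_Suc)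
    next
      case False
      have "f (i + 2) \<noteq> e i"
      proof (cases "i + 3 = g")
        case True
        then have "i + 2 = g - 1" "i = g - 3" by auto
        then show ?thesis using y f(2) by auto
      next
        case False
        then show ?thesis using f(3)[of "i + 2"] inn[of i] i \<open>i \<noteq> 0\<close> by (auto simp: inner_def)
      qed
      then show ?thesis using inn[of i] i False f(3)[of i] f(3)[of "i + 1"] by (auto simp: inner_def)
    qed
    have fg: "f (g - 2) = e (g - 2)" using g4 by (intro f(3)) auto
    show "f (g - 2) \<notin> {v (g - 3), v (g - 2), v (g - 1)} \<union> (D (g - 2) \<union> P (g - 1))"
      using st fg by (simp add: start_def)
    show "f (g - 2) \<noteq> f (g - 1)" using y fg f(2) by auto
    show "f (g - 1) \<notin> {v (g - 2), v (g - 1), v 0} \<union> D (g - 1)" using y f(2) by auto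
    show "f (g - 1) \<noteq> f 0" using y f by auto
  qed
next
  case False
  then have g: "g = 3" using g3 by simp
  obtain v where v: "ok v {..<g}" using ok_extend[of "\<lambda>_. 0" "{}" "{..<g}"] by (auto simp: ok_def)
  have c: "card (D 1 \<union> P 2) \<le> 3" "card (D 1) \<le> 2" "card (D 2) \<le> 2"
    using DP' D_card[of 1] D_card[of 2] by (auto simp: g)
  \<comment> \<open>In a triangle the pendant edges come first and then the cycle edges
    \<open>1\<close>, \<open>0\<close>, \<open>2\<close>, which see at most 3 + 3, 4 + 2 and 5 + 2
    colours.\<close>
  obtain x where x: "x < 8" "x \<notin> set [v 0, v 1, v 2]" "x \<notin> D 1 \<union> P 2"
    using avoid[OF _ c(1), of "[v 0, v 1, v 2]"] by auto
  obtain y where y: "y < 8" "y \<notin> set [v 0, v 1, v 2, x]" "y \<notin> D 1"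
    using avoid[OF _ c(2), of "[v 0, v 1, v 2, x]"] by auto
  obtain z where z: "z < 8" "z \<notin> set [v 0, v 1, v 2, x, y]" "z \<notin> D 2"
    using avoid[OF _ c(3), of "[v 0, v 1, v 2, x, y]"] by auto
  show ?thesis
    by (rule that[of v "(\<lambda>_. 0)(0 := y, 1 := x, 2 := z)"])
      (use v x y z P0 in \<open>auto simp: g numeral_eq_Suc less_Suc_eq\<close>)
qed

end

section \<open>Colouring the edges at a cycle\<close>

locale cycle = subcubic V N for V :: "'a set" and N +
  fixes c d :: "nat \<Rightarrow> 'a" and g :: nat
  fixes suc prd :: "nat \<Rightarrow> nat" and C H :: "'a set"
  defines "suc i \<equiv> if Suc i = g then 0 else Suc i"
    and "prd i \<equiv> if i = 0 then g - 1 else i - 1"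
    and "C \<equiv> c ` {..<g}" and "H \<equiv> V - C"
  assumes g3: "3 \<le> g"
    and inj_c: "inj_on c {..<g}" and inj_d: "inj_on d {..<g}"
    and N_c: "\<And>i. i < g \<Longrightarrow> N (c i) = {c (prd i), c (suc i), d i}"
    and d_notin: "\<And>i. i < g \<Longrightarrow> d i \<notin> C"
begin

section \<open>Indices, neighbourhoods and edges at the cycle\<close>

lemma idx [simp]: "i < g \<Longrightarrow> suc i < g" "i < g \<Longrightarrow> prd i < g"
    "i < g \<Longrightarrow> suc (prd i) = i" "i < g \<Longrightarrow> prd (suc i) = i"
  using g3 by (auto simp: suc_def prd_def)

lemma suc_ne: "i < g \<Longrightarrow> suc i \<noteq> i" "i < g \<Longrightarrow> suc (suc i) \<noteq> i"
  using g3 by (auto simp: suc_def)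

lemma c_eq [simp]: "i < g \<Longrightarrow> l < g \<Longrightarrow> c i = c l \<longleftrightarrow> i = l"
  using inj_c by (auto simp: inj_on_def)

lemma d_eq [simp]: "i < g \<Longrightarrow> l < g \<Longrightarrow> d i = d l \<longleftrightarrow> i = l"
  using inj_d by (auto simp: inj_on_def)

lemma c_in [simp]: "i < g \<Longrightarrow> c i \<in> C"
  by (simp add: C_def)

lemma C_elim: "x \<in> C \<Longrightarrow> (\<And>i. i < g \<Longrightarrow> x = c i \<Longrightarrow> Q) \<Longrightarrow> Q"
  by (auto simp: C_def)

lemma cd_ne [simp]: "i < g \<Longrightarrow> l < g \<Longrightarrow> c i \<noteq> d l" "i < g \<Longrightarrow> l < g \<Longrightarrow> d l \<noteq> c i"
  by (metis c_in d_notin)+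

lemma d_in_N: "i < g \<Longrightarrow> d i \<in> N (c i)" "i < g \<Longrightarrow> c i \<in> N (d i)"
  using N_c[of i] N_sym[of "d i" "c i"] by auto

lemma in_V: "i < g \<Longrightarrow> d i \<in> V" "i < g \<Longrightarrow> c i \<in> V"
  using d_in_N[of i] N_V by blast+

lemma d_in_H [simp]: "i < g \<Longrightarrow> d i \<in> H"
  using in_V d_notin by (simp add: H_def)

lemma H_disj: "x \<in> H \<Longrightarrow> x \<notin> C"
  by (simp add: H_def)

lemma H_nbr: "i < g \<Longrightarrow> x \<notin> C \<Longrightarrow> x \<in> N (c i) \<or> c i \<in> N x \<Longrightarrow> x = d i"
  using N_c[of i] N_sym c_in idx by (metis empty_iff insert_iff)

definition Ve :: "nat \<Rightarrow> 'a set" where "Ve i = {c i, d i}"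
definition Ee :: "nat \<Rightarrow> 'a set" where "Ee i = {c i, c (suc i)}"

lemma Ee_eq: "i < g \<Longrightarrow> l < g \<Longrightarrow> Ee i = Ee l \<longleftrightarrow> i = l"
  using suc_ne[of l] by (auto simp: Ee_def doubleton_eq_iff)

lemma Ve_eq: "i < g \<Longrightarrow> l < g \<Longrightarrow> Ve i = Ve l \<longleftrightarrow> i = l"
  by (auto simp: Ve_def doubleton_eq_iff)

lemma Ee_C: "i < g \<Longrightarrow> Ee i \<subseteq> C"
  by (simp add: Ee_def)

lemma Ve_C: "i < g \<Longrightarrow> \<not> Ve i \<subseteq> C"
  using d_notin by (simp add: Ve_def)

lemma VE_H: "i < g \<Longrightarrow> \<not> Ve i \<subseteq> H" "i < g \<Longrightarrow> \<not> Ee i \<subseteq> H"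
  using H_disj[of "c i"] by (auto simp: Ve_def Ee_def)

lemma edge_cases:
  assumes "f \<in> E V"
  obtains (H) "f \<in> E H" "f \<subseteq> H" | (V) i where "i < g" "f = Ve i" | (E) i where "i < g" "f = Ee i"
proof -
  from assms obtain x y where xy: "f = {x, y}" "x \<in> V" "y \<in> V" "y \<in> N x" "x \<in> N y"
    by (rule E_elim)
  have *: thesis if ab: "f = {a, b}" "b \<in> N a" "i < g" "a = c i" for a b i
  proof -
    have "b = c (prd i) \<or> b = c (suc i) \<or> b = d i" using N_c ab by auto
    then show thesis
      using V[of i] E[of i] E[of "prd i"] ab by (auto simp: Ve_def Ee_def insert_commute)
  qed
  show thesis
  proof (cases "x \<in> C \<or> y \<in> C")
    case True
    then show thesis using *[of x y] *[of y x] xy by (auto elim!: C_elim simp: insert_commute)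
  next
    case False
    then show thesis using H xy by (auto simp: H_def E_iff)
  qed
qed

text \<open>\<open>j i\<close> selects the private end of the cycle edge \<open>i\<close>; a pendant
  edge always has its outer end \<open>d i\<close> private. So two pendant edges conflict only
  through adjacent outer ends, and old private ends endanger a cycle edge only at the outer vertices
  \<open>d i\<close> and \<open>d (suc i)\<close>.\<close>

lemma cycle_extension:
  assumes val: "valid \<phi> p (E H)"
    and j: "\<And>i. i < g \<Longrightarrow> j i = i \<or> j i = suc i"
    and v8: "\<And>i. i < g \<Longrightarrow> v i < 8" and e8: "\<And>i. i < g \<Longrightarrow> e i < 8"
    and v_near: "\<And>i. i < g \<Longrightarrow> v i \<notin> \<phi> ` near (E H) (d i)"
    and v_v: "\<And>i l. i < g \<Longrightarrow> l < g \<Longrightarrow> d l \<in> N (d i) \<Longrightarrow> v i \<noteq> v l"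
    and e_D: "\<And>i. i < g \<Longrightarrow> e i \<notin> \<phi> ` star (E H) (d (j i))"
    and e_K: "\<And>i. i < g \<Longrightarrow> e i \<notin> \<phi> ` K p (E H) (d i)" "\<And>i. i < g \<Longrightarrow> e i \<notin> \<phi> ` K p (E H) (d (suc i))"
    and e_v: "\<And>i l. i < g \<Longrightarrow> l \<in> {prd (j i), j i, suc (j i)} \<Longrightarrow> e i \<noteq> v l"
    and e_e: "\<And>i l. i < g \<Longrightarrow> l < g \<Longrightarrow> l \<noteq> i \<Longrightarrow>
       l \<in> {prd (j i), j i, suc (j i)} \<or> suc l \<in> {prd (j i), j i, suc (j i)} \<Longrightarrow> e i \<noteq> e l"
  shows "\<exists>c p. valid c p (E V)"
proof -
  define iV where "iV = inv_into {..<g} Ve"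
  define iE where "iE = inv_into {..<g} Ee"
  define col where "col f = (if f \<subseteq> H then \<phi> f else if f \<subseteq> C then e (iE f) else v (iV f))" for f
  define prv where "prv f = (if f \<subseteq> H then p f else if f \<subseteq> C then c (j (iE f)) else d (iV f))" for f
  have injs: "inj_on Ve {..<g}" "inj_on Ee {..<g}" using Ve_eq Ee_eq by (auto simp: inj_on_def)
  have inv: "iV (Ve i) = i" "iE (Ee i) = i" if "i < g" for i
    using injs that by (auto simp: iV_def iE_def)
  have cH: "col f = \<phi> f" "prv f = p f" if "f \<in> E H" for f
    using E_subset[OF that] by (auto simp: col_def prv_def)
  have cV: "col (Ve i) = v i" "prv (Ve i) = d i" if "i < g" for i
    using VE_H[OF that] Ve_C[OF that] inv[OF that] by (auto simp: col_def prv_def)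
  have cE: "col (Ee i) = e i" "prv (Ee i) = c (j i)" if "i < g" for i
    using VE_H[OF that] Ee_C[OF that] inv[OF that] by (auto simp: col_def prv_def)
  have jg: "j i < g" if "i < g" for i using j[OF that] that by auto
  have pin: "p f \<in> f" "p f \<in> H" if "f \<in> E H" for f
    using validD(1)[OF val that] E_subset[OF that] by auto
  have ball_c: "ball (c i) = {c i, c (prd i), c (suc i), d i}" if "i < g" for i
    using N_c[OF that] by (auto simp: ball_def)
  have "valid col prv (E V)"
    unfolding valid_def
  proof (intro conjI ballI impI)
    fix f assume "f \<in> E V"
    then show "prv f \<in> f"
    proof (cases rule: edge_cases)
      case (V i)
      then show ?thesis using cV(2)[of i] by (simp add: Ve_def)
    next
      case (E i)
      then show ?thesis using cE(2)[of i] j[of i] by (auto simp: Ee_def)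
    qed (use pin cH in auto)
    show "col f < 8"
      using \<open>f \<in> E V\<close> by (cases rule: edge_cases) (use v8 e8 validD(2)[OF val] in \<open>auto simp: cH cV cE\<close>)
  next
    fix f h assume f: "f \<in> E V" and h: "h \<in> E V" and fh: "f \<noteq> h \<and> col f = col h"
    from f show "h \<inter> ball (prv f) = {}"
    proof (cases rule: edge_cases)
      case f: H
      from h show ?thesis
      proof (cases rule: edge_cases)
        case h: H
        then show ?thesis using val f fh by (simp add: cH valid_def)
      next
        case h: (V i)
        have neq: "f \<notin> near (E H) (d i)" using v_near[OF h(1)] fh f h by (metis cH(1) cV(1) image_eqI)
        have "d i \<notin> ball (p f)"
          using neq pin[OF f(1)] f N_sym by (auto simp: near_def ball_def)
        \<comment> \<open>\<open>d i\<close> is the only vertex of \<open>H\<close> adjacent to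
          \<open>c i\<close>, so reaching \<open>c i\<close> would place \<open>p f\<close> at
          \<open>d i\<close>, which \<open>f\<close> misses.\<close>
        moreover have "c i \<notin> ball (p f)"
        proof
          assume "c i \<in> ball (p f)"
          then have "p f = d i"
            using H_nbr[OF h(1), of "p f"] pin[OF f(1)] H_disj c_in[OF h(1)] by (auto simp: ball_def)
          with neq pin[OF f(1)] f show False by (auto simp: near_def ball_def)
        qed
        ultimately show ?thesis using h f by (auto simp: Ve_def cH)
      next
        case h: (E i)
        have *: "c l \<notin> ball (p f)" if l: "l < g" "l = i \<or> l = suc i" for l
        proof
          assume "c l \<in> ball (p f)"
          then have "p f = d l"
            using H_nbr[OF l(1), of "p f"] pin[OF f(1)] H_disj c_in[OF l(1)] by (auto simp: ball_def)
          then have "f \<in> K p (E H) (d l)" using f by (simp add: K_def)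
          moreover have "\<phi> f = e i" using fh f h by (simp add: cH cE)
          ultimately have "e i \<in> \<phi> ` K p (E H) (d l)" by (metis image_eqI)
          with e_K[OF h(1)] l(2) show False by auto
        qed
        show ?thesis using *[of i] *[of "suc i"] h f by (auto simp: Ee_def cH)
      qed
    next
      case f: (V i)
      from h show ?thesis
      proof (cases rule: edge_cases)
        case h: H
        then have "h \<notin> near (E H) (d i)" using v_near[OF f(1)] fh f by (metis cH(1) cV(1) image_eqI)
        with h f show ?thesis by (auto simp: cV near_def)
      next
        case h: (V l)
        then have "i \<noteq> l" using fh f by auto
        have "d l \<notin> N (d i)" using v_v[OF f(1) h(1)] fh f h by (auto simp: cV)
        moreover have "c l \<notin> N (d i)"
          using H_nbr[OF h(1), of "d i"] d_notin[OF f(1)] \<open>i \<noteq> l\<close> f h by auto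
        moreover have "prv f = d i" using f cV by simp
        ultimately show ?thesis using \<open>i \<noteq> l\<close> f(1) h by (auto simp: Ve_def ball_def)
      next
        case h: (E l)
        have vl: "v i \<noteq> e l" if "i = l \<or> i = suc l"
        proof -
          have "i \<in> {prd (j l), j l, suc (j l)}" using that j[OF h(1)] h(1) by auto
          then show ?thesis using e_v[OF h(1), of i] by auto
        qed
        have *: "m \<noteq> i" if "m = l \<or> m = suc l" for m
          using that vl fh f h by (auto simp: cV cE)
        have "c m \<notin> ball (d i)" if "m < g" "m = l \<or> m = suc l" for m
          using *[OF that(2)] H_nbr[OF that(1), of "d i"] d_notin[OF f(1)] f that(1) by (auto simp: ball_def)
        then show ?thesis using f h by (auto simp: Ee_def cV)
      qed
    next
      case f: (E i)
      note jl = jg[OF f(1)]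
      from h show ?thesis
      proof (cases rule: edge_cases)
        case h: H
        have "d (j i) \<notin> h"
        proof
          assume "d (j i) \<in> h"
          then have "h \<in> star (E H) (d (j i))" using h by (simp add: star_def)
          with e_D[OF f(1)] fh f h show False by (metis cE(1) cH(1) image_eqI)
        qed
        moreover have "c l \<notin> h" if "l < g" for l using h that H_disj c_in by blast
        ultimately show ?thesis using f jl by (auto simp: cE ball_c)
      next
        case h: (V l)
        have "l \<notin> {prd (j i), j i, suc (j i)}" using e_v[OF f(1), of l] fh f h by (auto simp: cE cV)
        then show ?thesis using f h jl by (auto simp: cE ball_c Ve_def)
      next
        case h: (E l)
        then have "l \<noteq> i" using fh f by auto
        then have "\<not> (l \<in> {prd (j i), j i, suc (j i)} \<or> suc l \<in> {prd (j i), j i, suc (j i)})"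
          using e_e[OF f(1) h(1)] fh f h by (auto simp: cE)
        moreover have "prv f = c (j i)" using f cE by simp
        ultimately show ?thesis using h jl by (auto simp: ball_c Ee_def)
      qed
    qed
  qed
  then show ?thesis by blast
qed

lemma deg_d: "i < g \<Longrightarrow> deg H (d i) \<le> 2"
proof -
  assume i: "i < g"
  have "N (d i) \<inter> H \<subseteq> N (d i) - {c i}" using H_disj c_in[OF i] by auto
  then have "deg H (d i) \<le> card (N (d i) - {c i})" unfolding deg_def by (intro card_mono) auto
  then show ?thesis using N_le3[of "d i"] d_in_N(2)[OF i] by simp
qed

text \<open>An outer vertex adjacent to \<open>d i\<close> has lost its cycle edge in
  \<open>H\<close>, so it has degree at most two there. Each conflict among pendant edges is thus
  paid for by one missing edge, and each of the at most two neighbours accounts for three. This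
  gives \<open>L_card\<close>.\<close>

lemma near_d:
  assumes i: "i < g"
  shows "card (near (E H) (d i)) + card {l. l < g \<and> d l \<in> N (d i)} \<le> 6"
proof -
  let ?S = "N (d i) \<inter> H" and ?T = "N (d i) \<inter> H \<inter> d ` {..<g}"
  have "{l. l < g \<and> d l \<in> N (d i)} = {l \<in> {..<g}. d l \<in> ?S}" by auto
  moreover have "card {l \<in> {..<g}. d l \<in> ?S} = card (d ` {l \<in> {..<g}. d l \<in> ?S})"
    using inj_d by (intro card_image[symmetric]) (auto simp: inj_on_def)
  moreover have "d ` {l \<in> {..<g}. d l \<in> ?S} = ?T" by auto
  ultimately have T: "card {l. l < g \<and> d l \<in> N (d i)} = card ?T" by simp
  have "card (near (E H) (d i)) \<le> (\<Sum>z\<in>?S. deg H z)" by (intro card_near d_in_H i)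
  moreover have "(\<Sum>z\<in>?S. deg H z + (if z \<in> d ` {..<g} then 1 else 0)) \<le> (\<Sum>z\<in>?S. 3)"
    using deg_d deg_le3 by (intro sum_mono) fastforce
  moreover have "(\<Sum>z\<in>?S. if z \<in> d ` {..<g} then 1 else 0) = card ?T"
    by (simp add: sum.If_cases)
  moreover have "card ?S \<le> 2" using deg_d[OF i] by (simp add: deg_def)
  ultimately show ?thesis unfolding T by (simp add: sum.distrib)
qed

text \<open>The bounds mention private edges at \<open>d i\<close> for
  \<open>1 \<le> i \<le> g - 3\<close> and for \<open>i = g - 1\<close>, but not at
  \<open>d (g - 2)\<close>: both cycle edges at \<open>c (g - 2)\<close> have it as their private
  end, so they avoid every colour at \<open>d (g - 2)\<close> anyway. An overloaded outer vertex can
  be hidden there.\<close>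

theorem cycle_colourable:
  assumes val: "valid \<phi> p (E H)" and K0: "K p (E H) (d 0) = {}"
    and DK: "\<And>i. 1 \<le> i \<Longrightarrow> i + 3 \<le> g \<Longrightarrow> card (star (E H) (d (i + 1)) \<union> K p (E H) (d i)) \<le> 3"
    and DK': "card (star (E H) (d (g - 2)) \<union> K p (E H) (d (g - 1))) \<le> 3"
  shows "\<exists>c p. valid c p (E V)"
proof -
  let ?D = "\<lambda>i. \<phi> ` star (E H) (d i)" and ?P = "\<lambda>i. \<phi> ` K p (E H) (d i)"
  have K_star: "K p (E H) x \<subseteq> star (E H) x" for x
    using val by (auto simp: K_def star_def valid_def)
  have fin: "finite (star (E H) x)" for x by (simp add: star_def)
  interpret L: cycle_lists g "\<lambda>i. {..<8} - \<phi> ` near (E H) (d i)" ?D ?P "\<lambda>i l. d l \<in> N (d i)"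
  proof
    show "3 \<le> g" by (rule g3)
    show "d i \<in> N (d l)" if "d l \<in> N (d i)" for i l using N_sym that .
    show "d i \<notin> N (d i)" for i by (rule N_irrefl)
    fix i
    show "finite ({..<8} - \<phi> ` near (E H) (d i))" "{..<8} - \<phi> ` near (E H) (d i) \<subseteq> {..<8}" by auto
    show "finite (?D i)" "finite (?P i)" using fin by auto
    show "?D i \<subseteq> {..<8}" using validD(2)[OF val] by (auto simp: star_def)
    show "2 + card {l. l < g \<and> d l \<in> N (d i)} \<le> card ({..<8} - \<phi> ` near (E H) (d i))" if "i < g"
    proof -
      have "card (\<phi> ` near (E H) (d i)) \<le> card (near (E H) (d i))" by (intro card_image_le) auto
      moreover have "card {..<8::nat} - card (\<phi> ` near (E H) (d i)) \<le> card ({..<8} - \<phi> ` near (E H) (d i))"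
        by (rule diff_card_le_card_Diff) simp
      ultimately show ?thesis using near_d[OF that] by simp
    qed
    show "card (?D i) \<le> 2" if "i < g"
      using card_image_le[OF fin, of \<phi> "d i"] card_star[of H "d i"] deg_d[OF that] by linarith
    show "?P 0 = {}" using K0 by simp
    show "card (?D (i + 1) \<union> ?P i) \<le> 3" if "1 \<le> i" "i + 3 \<le> g"
      using DK[OF that] card_image_le[of "star (E H) (d (i + 1)) \<union> K p (E H) (d i)" \<phi>] fin
      by (simp add: image_Un)
    show "card (?D (g - 2) \<union> ?P (g - 1)) \<le> 3"
      using DK' card_image_le[of "star (E H) (d (g - 2)) \<union> K p (E H) (d (g - 1))" \<phi>] fin
      by (simp add: image_Un)
  qed
  show ?thesis
  proof (rule L.cycle_choice)
    fix v e
    assume ok: "L.ok v {..<g}" and e8: "\<And>i. i < g \<Longrightarrow> e i < 8"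
      and R: "\<And>i. i + 3 \<le> g \<Longrightarrow> e i \<notin> {v i, v (i + 1), v (i + 2)} \<union> (?D (i + 1) \<union> ?P i)"
      and ee: "\<And>i. i + 3 \<le> g \<Longrightarrow> e i \<noteq> e (i + 1) \<and> e i \<noteq> e (i + 2)"
      and L2: "e (g - 2) \<notin> {v (g - 3), v (g - 2), v (g - 1)} \<union> (?D (g - 2) \<union> ?P (g - 1))" "e (g - 2) \<noteq> e (g - 1)"
      and L1: "e (g - 1) \<notin> {v (g - 2), v (g - 1), v 0} \<union> ?D (g - 1)" "e (g - 1) \<noteq> e 0"
    have KD: "x \<notin> ?P i" if "x \<notin> ?D i" for x i using that K_star by blast
    define j where "j i = (if i + 3 \<le> g then i + 1 else i)" for i
    have cases: "i + 3 \<le> g \<or> i = g - 2 \<or> i = g - 1" if "i < g" for i using that by auto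
    have j3: "j i = i + 1" "suc i = i + 1" "suc (i + 1) = i + 2" "prd (i + 1) = i" if "i + 3 \<le> g" for i
      using that by (auto simp: j_def suc_def prd_def)
    have j2: "j (g - 2) = g - 2" "suc (g - 2) = g - 1" "prd (g - 2) = g - 3"
      using g3 by (auto simp: j_def suc_def prd_def)
    have j1: "j (g - 1) = g - 1" "suc (g - 1) = 0" "prd (g - 1) = g - 2"
      using g3 by (auto simp: j_def suc_def prd_def)
    have e1: "e i \<noteq> e (i + 1)" if "i + 1 < g" for i
    proof (cases "i + 3 \<le> g")
      case False
      with that have "i = g - 2" "i + 1 = g - 1" by auto
      with L2(2) show ?thesis by simp
    qed (use ee in auto)
    show ?thesis
    proof (rule cycle_extension[OF val, of j v e])
      fix i assume i: "i < g"
      show "j i = i \<or> j i = suc i" using i by (auto simp: j_def suc_def)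
      show "v i < 8" "v i \<notin> \<phi> ` near (E H) (d i)" using ok i by (auto simp: L.ok_def)
      show "e i < 8" using e8 i .
      show "v i \<noteq> v l" if "l < g" "d l \<in> N (d i)" for l using ok i that by (auto simp: L.ok_def)
      have split: "Q i" if "\<And>i. i + 3 \<le> g \<Longrightarrow> Q i" "Q (g - 2)" "Q (g - 1)" for Q
        using cases[OF i] that by blast
      show "e i \<notin> ?D (j i)"
      proof (rule split)
        show "e i \<notin> ?D (j i)" if "i + 3 \<le> g" for i using R[OF that] unfolding j3[OF that] by blast
        show "e (g - 2) \<notin> ?D (j (g - 2))" using L2(1) unfolding j2 by blast
        show "e (g - 1) \<notin> ?D (j (g - 1))" using L1(1) unfolding j1 by blast
      qed
      show "e i \<notin> ?P i"
      proof (rule split)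
        show "e i \<notin> ?P i" if "i + 3 \<le> g" for i using R[OF that] by blast
        show "e (g - 2) \<notin> ?P (g - 2)" using L2(1) by (intro KD) blast
        show "e (g - 1) \<notin> ?P (g - 1)" using L1(1) by (intro KD) blast
      qed
      show "e i \<notin> ?P (suc i)"
      proof (rule split)
        show "e i \<notin> ?P (suc i)" if "i + 3 \<le> g" for i using R[OF that] unfolding j3[OF that] by (intro KD) blast
        show "e (g - 2) \<notin> ?P (suc (g - 2))" using L2(1) unfolding j2 by blast
        show "e (g - 1) \<notin> ?P (suc (g - 1))" unfolding j1 K0 by blast
      qed
      show "e i \<noteq> v l" if l: "l \<in> {prd (j i), j i, suc (j i)}" for l
      proof -
        have "\<forall>l\<in>{prd (j i), j i, suc (j i)}. e i \<noteq> v l"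
        proof (rule split)
          show "\<forall>l\<in>{prd (j i), j i, suc (j i)}. e i \<noteq> v l" if "i + 3 \<le> g" for i
            using R[OF that] unfolding j3[OF that] by blast
          show "\<forall>l\<in>{prd (j (g - 2)), j (g - 2), suc (j (g - 2))}. e (g - 2) \<noteq> v l"
            using L2(1) unfolding j2 by blast
          show "\<forall>l\<in>{prd (j (g - 1)), j (g - 1), suc (j (g - 1))}. e (g - 1) \<noteq> v l"
            using L1(1) unfolding j1 by blast
        qed
        with l show ?thesis by blast
      qed
      fix l assume l: "l < g" "l \<noteq> i"
        "l \<in> {prd (j i), j i, suc (j i)} \<or> suc l \<in> {prd (j i), j i, suc (j i)}"
      \<comment> \<open>Since the last two edges are turned, the only conflict to be listed across
        index 0 is that of \<open>g - 1\<close> and \<open>0\<close>.\<close>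
      have "l = i + 1 \<or> l = i + 2 \<or> i = l + 1 \<or> i = l + 2 \<or> i = 0 \<and> l = g - 1 \<or> l = 0 \<and> i = g - 1"
        using l i g3 unfolding j_def suc_def prd_def by (auto split: if_splits)
      then show "e i \<noteq> e l"
        using e1[of i] e1[of l] ee[of i] ee[of l] L1(2) i l(1) by (elim disjE conjE) auto
    qed
  qed
qed

end

context subcubic
begin

section \<open>Shortest cycles\<close>

definition path :: "(nat \<Rightarrow> 'a) \<Rightarrow> nat \<Rightarrow> bool" where
  "path c k \<longleftrightarrow> inj_on c {..<k} \<and> (\<forall>i. i + 1 < k \<longrightarrow> c (i + 1) \<in> N (c i))"

definition cyc :: "(nat \<Rightarrow> 'a) \<Rightarrow> nat \<Rightarrow> bool" where
  "cyc c k \<longleftrightarrow> 3 \<le> k \<and> path c k \<and> c 0 \<in> N (c (k - 1))"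

definition mincyc :: "(nat \<Rightarrow> 'a) \<Rightarrow> nat \<Rightarrow> bool" where
  "mincyc c g \<longleftrightarrow> cyc c g \<and> (\<forall>c' k. cyc c' k \<longrightarrow> g \<le> k)"

lemma path_eq: "path c k \<Longrightarrow> i < k \<Longrightarrow> l < k \<Longrightarrow> c i = c l \<longleftrightarrow> i = l"
  by (auto simp: path_def inj_on_def)

lemma path_segment: "path c k \<Longrightarrow> i \<le> l \<Longrightarrow> l < k \<Longrightarrow> path (\<lambda>m. c (i + m)) (l - i + 1)"
  unfolding path_def[of "\<lambda>m. c (i + m)"]
proof (intro conjI allI impI inj_onI)
  assume p: "path c k" "i \<le> l" "l < k"
  fix x y assume "x \<in> {..<l - i + 1}" "y \<in> {..<l - i + 1}" "c (i + x) = c (i + y)"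
  then show "x = y" using path_eq[OF p(1), of "i + x" "i + y"] p by auto
next
  fix m assume "path c k" "i \<le> l" "l < k" "m + 1 < l - i + 1"
  then show "c (i + (m + 1)) \<in> N (c (i + m))" by (auto simp: path_def)
qed

lemma path_snoc:
  assumes "path c (Suc k)" "y \<in> N (c k)" "y \<notin> c ` {..k}"
  shows "path (c(Suc k := y)) (Suc (Suc k))"
  unfolding path_def
proof (intro conjI allI impI)
  have "{..<Suc (Suc k)} = insert (Suc k) {..<Suc k}" by auto
  then show "inj_on (c(Suc k := y)) {..<Suc (Suc k)}"
    using assms by (auto simp: path_def inj_on_def lessThan_Suc_atMost)
  fix i assume "i + 1 < Suc (Suc k)"
  then show "(c(Suc k := y)) (i + 1) \<in> N ((c(Suc k := y)) i)"
    using assms by (cases "i = k") (auto simp: path_def)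
qed

lemma chord_cyc:
  assumes "path c k" "i + 2 \<le> l" "l < k" "c i \<in> N (c l)"
  shows "cyc (\<lambda>m. c (i + m)) (l - i + 1)"
  using path_segment[OF assms(1) _ assms(3), of i] assms by (simp add: cyc_def)

lemma detour_cyc:
  assumes p: "path c k" "i < l" "l < k" and x: "x \<notin> c ` {..<k}" "x \<in> N (c l)" "x \<in> N (c i)"
  shows "\<exists>c. cyc c (l - i + 2)"
proof -
  let ?c = "(\<lambda>m. c (i + m))(Suc (l - i) := x)"
  have "path (\<lambda>m. c (i + m)) (Suc (l - i))" using path_segment[OF p(1) _ p(3), of i] p by simp
  moreover have "x \<notin> (\<lambda>m. c (i + m)) ` {..l - i}" using x(1) p by auto
  ultimately have "path ?c (Suc (Suc (l - i)))" using x p by (intro path_snoc) auto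
  then have "cyc ?c (l - i + 2)" using x(3) N_sym p by (auto simp: cyc_def)
  then show ?thesis by blast
qed

lemma detour_cyc2:
  assumes p: "path c k" "i < l" "l < k" and x: "x \<notin> c ` {..<k}" "y \<notin> c ` {..<k}"
    "y \<in> N (c l)" "x \<in> N y" "x \<in> N (c i)"
  shows "\<exists>c. cyc c (l - i + 3)"
proof -
  let ?c = "(\<lambda>m. c (i + m))(Suc (l - i) := y)"
  have "path (\<lambda>m. c (i + m)) (Suc (l - i))" using path_segment[OF p(1) _ p(3), of i] p by simp
  moreover have "y \<notin> (\<lambda>m. c (i + m)) ` {..l - i}" using x(2) p by auto
  ultimately have p2: "path ?c (Suc (Suc (l - i)))" using x p by (intro path_snoc) auto
  have "x \<noteq> y" using x(4) N_irrefl by auto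
  moreover have "?c ` {..Suc (l - i)} \<subseteq> insert y (c ` {..<k})" using p by auto
  ultimately have "x \<notin> ?c ` {..Suc (l - i)}" using x(1) by auto
  moreover have "x \<in> N (?c (Suc (l - i)))" using x by simp
  ultimately have "path (?c(Suc (Suc (l - i)) := x)) (Suc (Suc (Suc (l - i))))"
    using path_snoc[OF p2] by blast
  then have "cyc (?c(Suc (Suc (l - i)) := x)) (l - i + 3)"
    using x(5) N_sym p by (auto simp: cyc_def numeral_3_eq_3)
  then show ?thesis by blast
qed

lemma cyc_rotate:
  assumes c: "cyc c k" and r: "r < k"
  shows "cyc (\<lambda>m. c ((m + r) mod k)) k" "(\<lambda>m. c ((m + r) mod k)) ` {..<k} = c ` {..<k}"
proof -
  have k: "0 < k" using r by simp
  have inj: "inj_on (\<lambda>m. (m + r) mod k) {..<k}"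
  proof (rule inj_onI)
    fix x y assume "x \<in> {..<k}" "y \<in> {..<k}" "(x + r) mod k = (y + r) mod k"
    moreover have "(m + r) mod k = (if m + r < k then m + r else m + r - k)" if "m < k" for m
      using that r by (simp add: le_mod_geq)
    ultimately show "x = y" using r by (auto split: if_splits)
  qed
  moreover have "(\<lambda>m. (m + r) mod k) ` {..<k} \<subseteq> {..<k}" using k by auto
  ultimately have surj: "(\<lambda>m. (m + r) mod k) ` {..<k} = {..<k}"
    by (intro card_subset_eq) (auto simp: card_image)
  then show "(\<lambda>m. c ((m + r) mod k)) ` {..<k} = c ` {..<k}"
    by (metis image_image)
  have step: "c (Suc m mod k) \<in> N (c (m mod k))" for m
  proof -
    have lt: "m mod k < k" using k by simp
    show ?thesis
    proof (cases "Suc (m mod k) = k")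
      case True
      then have "m mod k = k - 1" by simp
      then show ?thesis using c True by (simp add: cyc_def mod_Suc)
    next
      case False
      then have "m mod k + 1 < k" using lt by simp
      then show ?thesis using c False by (auto simp: cyc_def path_def mod_Suc)
    qed
  qed
  have "inj_on (c \<circ> (\<lambda>m. (m + r) mod k)) {..<k}"
    using inj surj c by (intro comp_inj_on) (auto simp: cyc_def path_def)
  moreover have "c ((0 + r) mod k) \<in> N (c ((k - 1 + r) mod k))"
    using step[of "k - 1 + r"] k by simp
  ultimately show "cyc (\<lambda>m. c ((m + r) mod k)) k"
    using c step by (auto simp: cyc_def path_def comp_def)
qed

lemma mincyc_rotate: "mincyc c k \<Longrightarrow> r < k \<Longrightarrow> mincyc (\<lambda>m. c ((m + r) mod k)) k"
  using cyc_rotate(1) by (auto simp: mincyc_def)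

text \<open>The end of a longest path has all its neighbours on the path.\<close>

lemma cyc_exists:
  assumes "V \<noteq> {}" and deg: "\<And>v. v \<in> V \<Longrightarrow> 2 \<le> card (N v)"
  obtains c k where "cyc c k"
proof -
  define P where "P k \<longleftrightarrow> (\<exists>c. path c (Suc k) \<and> c ` {..k} \<subseteq> V)" for k
  obtain v where "v \<in> V" using assms(1) by blast
  then have "P 0" unfolding P_def by (intro exI[of _ "\<lambda>_. v"]) (auto simp: path_def inj_on_def)
  moreover have "\<forall>k. P k \<longrightarrow> k \<le> card V"
  proof (intro allI impI)
    fix k assume "P k"
    then obtain c where c: "path c (Suc k)" "c ` {..k} \<subseteq> V" by (auto simp: P_def)
    then have "card (c ` {..k}) = Suc k" by (subst card_image) (auto simp: path_def lessThan_Suc_atMost)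
    then show "k \<le> card V" using card_mono[OF finV c(2)] by simp
  qed
  ultimately obtain k where k: "P k" "\<And>l. P l \<Longrightarrow> l \<le> k"
    using Nat.ex_has_greatest_nat[of P 0 "card V"] by metis
  then obtain c where c: "path c (Suc k)" "c ` {..k} \<subseteq> V" by (auto simp: P_def)
  have sub: "N (c k) \<subseteq> c ` {..k}"
  proof
    fix y assume y: "y \<in> N (c k)"
    show "y \<in> c ` {..k}"
    proof (rule ccontr)
      assume "y \<notin> c ` {..k}"
      with path_snoc[OF c(1) y] have p: "path (c(Suc k := y)) (Suc (Suc k))" .
      have "(c(Suc k := y)) ` {..Suc k} \<subseteq> V"
        using c(2) y N_V[of "c k"] by (auto simp: le_Suc_eq)
      with p have "P (Suc k)" unfolding P_def by blast
      from k(2)[OF this] show False by simp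
    qed
  qed
  have "\<exists>i. i + 2 \<le> k \<and> c i \<in> N (c k)"
  proof (rule ccontr)
    assume none: "\<not> ?thesis"
    have "N (c k) \<subseteq> {c (k - 1)}"
    proof
      fix y assume y: "y \<in> N (c k)"
      with sub obtain i where i: "i \<le> k" "y = c i" by auto
      with y N_irrefl have "i \<noteq> k" by auto
      with none i y have "i = k - 1" by (metis Suc_leI add_2_eq_Suc' diff_Suc_1 le_neq_implies_less less_Suc_eq_le not_less_eq_eq order_le_less)
      with i show "y \<in> {c (k - 1)}" by simp
    qed
    then have "card (N (c k)) \<le> 1" using card_mono[of "{c (k - 1)}"] by simp
    with deg[of "c k"] c(2) show False by auto
  qed
  then obtain i where i: "i + 2 \<le> k" "c i \<in> N (c k)" by blast
  with chord_cyc[OF c(1), of i k] that show ?thesis by simp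
qed

lemma mincyc_exists:
  assumes "V \<noteq> {}" "\<And>v. v \<in> V \<Longrightarrow> 2 \<le> card (N v)"
  obtains c g where "mincyc c g"
proof -
  from cyc_exists[OF assms] have "\<exists>k. \<exists>c. cyc c k" by metis
  then have "\<exists>c. cyc c (LEAST k. \<exists>c. cyc c k)" by (rule LeastI_ex)
  moreover have "(LEAST k. \<exists>c. cyc c k) \<le> k" if "cyc c k" for c k using that by (blast intro: Least_le)
  ultimately show ?thesis using that by (metis mincyc_def)
qed

lemma mincyc_chord:
  assumes m: "mincyc c g" and il: "i < l" "l < g" "c l \<in> N (c i)"
  shows "l = i + 1 \<or> i = 0 \<and> l = g - 1"
proof (rule ccontr)
  assume no: "\<not> ?thesis"
  have p: "path c g" using m by (simp add: mincyc_def cyc_def)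
  from no il have "i + 2 \<le> l" by simp
  with chord_cyc[OF p this il(2)] il(3) N_sym have "cyc (\<lambda>m. c (i + m)) (l - i + 1)" by blast
  then have "g \<le> l - i + 1" using m unfolding mincyc_def by blast
  with no il show False by auto
qed

text \<open>Either arc between the two feet closes up through \<open>x\<close>, and neither
  resulting cycle may be shorter than \<open>g\<close>. The second bound comes from the
  complementary arc, made into an initial segment by rotating \<open>l\<close> to index 0.\<close>

lemma mincyc_detour:
  assumes m: "mincyc c g" and il: "i < l" "l < g" and x: "x \<notin> c ` {..<g}" "x \<in> N (c l)" "x \<in> N (c i)"
  shows "g \<le> l - i + 2" "l - i \<le> 2"
proof -
  have p: "path c g" using m by (simp add: mincyc_def cyc_def)
  show "g \<le> l - i + 2" using detour_cyc[OF p il x] m unfolding mincyc_def by blast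
  let ?c = "\<lambda>m. c ((m + l) mod g)"
  have m': "mincyc ?c g" by (rule mincyc_rotate[OF m il(2)])
  then have p': "path ?c g" by (simp add: mincyc_def cyc_def)
  have "cyc c g" using m by (simp add: mincyc_def)
  note im = cyc_rotate(2)[OF this il(2)]
  have c0: "?c 0 = c l" "?c (g - l + i) = c i" using il by simp_all
  have "\<exists>c. cyc c (g - l + i - 0 + 2)"
    by (rule detour_cyc[OF p', of 0 "g - l + i" x]) (use il x im c0 in auto)
  then have "g \<le> g - l + i + 2" using m unfolding mincyc_def by auto
  then show "l - i \<le> 2" using il by simp
qed

lemma mincyc_detour2:
  assumes m: "mincyc c g" and il: "i < l" "l < g" and x: "x \<notin> c ` {..<g}" "y \<notin> c ` {..<g}"
    "y \<in> N (c l)" "x \<in> N y" "x \<in> N (c i)"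
  shows "g \<le> l - i + 3" "l - i \<le> 3"
proof -
  have p: "path c g" using m by (simp add: mincyc_def cyc_def)
  show "g \<le> l - i + 3" using detour_cyc2[OF p il x] m unfolding mincyc_def by blast
  let ?c = "\<lambda>m. c ((m + l) mod g)"
  have m': "mincyc ?c g" by (rule mincyc_rotate[OF m il(2)])
  then have p': "path ?c g" by (simp add: mincyc_def cyc_def)
  have "cyc c g" using m by (simp add: mincyc_def)
  note im = cyc_rotate(2)[OF this il(2)]
  have c0: "?c 0 = c l" "?c (g - l + i) = c i" using il by simp_all
  have "\<exists>c. cyc c (g - l + i - 0 + 3)"
    by (rule detour_cyc2[OF p', of 0 "g - l + i" y x]) (use il x im c0 N_sym in auto)
  then have "g \<le> g - l + i + 3" using m unfolding mincyc_def by auto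
  then show "l - i \<le> 3" using il by simp
qed

text \<open>A chord would shorten the cycle. By the two detour bounds, a common outer neighbour
  leaves a four-cycle with opposite vertices, which are then twins, or a triangle, two of whose
  vertices then have the same closed neighbourhood. Both are excluded.\<close>

lemma mincyc_cycle:
  assumes m: "mincyc c g" and cubic: "\<And>v. v \<in> V \<Longrightarrow> card (N v) = 3"
    and no_diamond: "\<And>a b. b \<in> N a \<Longrightarrow> N a - {b} \<noteq> N b - {a}"
    and no_twins: "\<And>a b. a \<in> V \<Longrightarrow> a \<noteq> b \<Longrightarrow> N a \<noteq> N b"
  obtains d where "cycle V N c d g"
proof -
  have cyc: "cyc c g" using m by (simp add: mincyc_def)
  then have p: "path c g" and g3: "3 \<le> g" and last: "c 0 \<in> N (c (g - 1))" by (auto simp: cyc_def)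
  define suc where "suc i = (if Suc i = g then 0 else Suc i)" for i
  define prd where "prd i = (if i = 0 then g - 1 else i - 1)" for i
  have ceq: "c i = c l \<longleftrightarrow> i = l" if "i < g" "l < g" for i l using path_eq[OF p that] .
  have step: "c (i + 1) \<in> N (c i)" if "i + 1 < g" for i using p that by (auto simp: path_def)
  have nb: "c (suc i) \<in> N (c i)" "c (prd i) \<in> N (c i)" if "i < g" for i
    using that last step[of i] step[of "i - 1"] N_sym by (auto simp: suc_def prd_def)
  have lt: "suc i < g" "prd i < g" "suc i \<noteq> prd i" if "i < g" for i
    using that g3 by (auto simp: suc_def prd_def)
  have ex: "\<exists>z. N (c i) = {c (prd i), c (suc i), z} \<and> z \<notin> c ` {..<g}" if i: "i < g" for i
  proof -
    have "c i \<in> V" using nb[OF i] N_sym N_V by blast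
    moreover have "c (prd i) \<noteq> c (suc i)" using lt[OF i] ceq by simp
    ultimately have "card (N (c i) - {c (prd i), c (suc i)}) = 1"
      using cubic nb[OF i] by (simp add: card_Diff_subset)
    then obtain z where z: "N (c i) - {c (prd i), c (suc i)} = {z}" by (rule card_1_singletonE)
    have "z \<notin> c ` {..<g}"
    proof
      assume "z \<in> c ` {..<g}"
      then obtain l where l: "l < g" "z = c l" by auto
      have cl: "c l \<in> N (c i)" "l \<noteq> prd i" "l \<noteq> suc i" using z l by auto
      moreover have "l \<noteq> i" using cl N_irrefl by auto
      ultimately show False
        using mincyc_chord[OF m, of i l] mincyc_chord[OF m, of l i] i l(1) N_sym[of "c l" "c i"]
        by (cases "i < l") (auto simp: suc_def prd_def split: if_splits)
    qed
    moreover have "N (c i) = {c (prd i), c (suc i), z}" using z nb[OF i] by auto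
    ultimately show ?thesis by blast
  qed
  then obtain d where d: "\<And>i. i < g \<Longrightarrow> N (c i) = {c (prd i), c (suc i), d i}" "\<And>i. i < g \<Longrightarrow> d i \<notin> c ` {..<g}"
    by metis
  have inj: "d i \<noteq> d l" if il: "i < l" "l < g" for i l
  proof
    assume eq: "d i = d l"
    have i: "i < g" using il by simp
    have "d i \<in> N (c l)" "d i \<in> N (c i)" using d(1)[OF i] d(1)[OF il(2)] eq by auto
    note g = mincyc_detour[OF m il d(2)[OF i] this]
    have dc: "d l \<noteq> c k" if "k < g" for k using d(2)[OF il(2)] that by auto
    consider "g = 4" "l = i + 2" | "g = 3" using g g3 il by linarith
    then show False
    proof cases
      case 1
      then have "i = 0 \<and> l = 2 \<or> i = 1 \<and> l = 3" using il by auto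
      moreover have "suc 0 = 1" "prd 0 = 3" "suc 1 = 2" "prd 1 = 0" "suc 2 = 3" "prd 2 = 1" "suc 3 = 0" "prd 3 = 2"
        by (simp_all add: suc_def prd_def 1)
      ultimately have "N (c i) = N (c l)" using d(1)[OF i] d(1)[OF il(2)] eq by auto
      moreover have "c i \<in> V" using nb[OF i] N_sym N_V by blast
      ultimately show False using no_twins ceq[OF i il(2)] il by auto
    next
      case 2
      have "c l \<in> N (c i)" "N (c i) - {c l} = N (c l) - {c i}"
        using d(1)[OF i] d(1)[OF il(2)] eq il 2 ceq[of 0 1] ceq[of 0 2] ceq[of 1 2] dc[of i] dc[of l]
        by (auto simp: suc_def prd_def numeral_2_eq_2 numeral_3_eq_3 less_Suc_eq split: if_splits)
      with no_diamond show False by blast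
    qed
  qed
  have "inj_on d {..<g}"
    using inj by (intro inj_onI) (metis lessThan_iff linorder_neqE_nat)
  then have "cycle V N c d g"
    using p g3 d subcubic_axioms unfolding suc_def prd_def
    by (intro cycle.intro cycle_axioms.intro) (auto simp: path_def)
  then show ?thesis by (rule that)
qed

end

section \<open>Outer vertices of the deleted cycle in a cubic graph\<close>

context cycle
begin

lemma card_star_K:
  assumes v: "valid \<phi> p (E H)" and i: "i < g" and k: "card (K p (E H) (d l)) \<le> 1"
  shows "card (star (E H) (d i) \<union> K p (E H) (d l)) \<le> 3"
  using card_Un_le[of "star (E H) (d i)" "K p (E H) (d l)"] card_star[of H "d i"] deg_d[OF i] k by linarith

lemma d_nbr_C:
  assumes "i < g" "x \<in> N (d i)" "x \<in> C"
  shows "x = c i"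
proof -
  obtain l where l: "l < g" "x = c l" using assms(3) by (rule C_elim)
  then have "d i = d l" using H_nbr[of l "d i"] assms(1,2) d_notin by blast
  with l assms(1) show ?thesis by simp
qed

text \<open>A neighbour of degree three lets \<open>d 0\<close> be freed while every other outer
  vertex keeps at most one private edge; all bounds are then 2 + 1.\<close>

lemma token_colourable:
  assumes cubic: "\<And>v. v \<in> V \<Longrightarrow> card (N v) = 3" and sp: "sparse H"
    and y: "y \<in> N (d 0) \<inter> H" "deg H y = 3"
  shows "\<exists>c p. valid c p (E V)"
proof -
  have g: "0 < g" using g3 by simp
  have "N (d 0) \<inter> H = N (d 0) - {c 0}"
    using d_nbr_C[OF g] N_V[of "d 0"] H_disj[of "c 0"] c_in[OF g] by (auto simp: H_def)
  then have "deg H (d 0) = 2" using cubic[OF in_V(1)[OF g]] d_in_N(2)[OF g] by (simp add: deg_def)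
  then have "rooted H (d 0)" using sparse_colourings(3)[OF sp d_in_H[OF g] _ y] by simp
  then obtain \<phi> p where gd: "good \<phi> p H" and K0: "K p (E H) (d 0) = {}" by (auto simp: rooted_def)
  have v: "valid \<phi> p (E H)" using gd by (simp add: good_def)
  have k: "card (K p (E H) (d i)) \<le> 1" if "i < g" for i
    using gd deg_d[OF that] d_in_H[OF that] by (auto simp: good_def)
  show ?thesis using g3 by (intro cycle_colourable[OF v K0] card_star_K[OF v] k) auto
qed

text \<open>Here all neighbours of the outer vertices \<open>d i\<close> lie on the cycle or are outer vertices, which forces
  the cycle to have length at most five.\<close>

lemma flat_colourable:
  assumes cubic: "\<And>v. v \<in> V \<Longrightarrow> card (N v) = 3" and sp: "sparse H" and m: "mincyc c g"
    and flat: "\<And>i y. i < g \<Longrightarrow> y \<in> N (d i) \<inter> H \<Longrightarrow> deg H y \<le> 2"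
  shows "\<exists>c p. valid c p (E V)"
proof -
  have g: "0 < g" using g3 by simp
  have nbr_d: "\<exists>l<g. y = d l" if iy: "i < g" "y \<in> N (d i) \<inter> H" for i y
  proof -
    have "deg H y < card (N y)" using flat[OF iy] cubic[of y] N_V iy(2) by fastforce
    then have "\<not> N y \<subseteq> H" unfolding deg_def by (metis inf.absorb1 less_irrefl)
    then obtain z where z: "z \<in> N y" "z \<in> C" using N_V by (auto simp: H_def)
    then obtain l where "l < g" "z = c l" by (auto elim: C_elim)
    with z show ?thesis using H_nbr[of l y] H_disj iy(2) by blast
  qed
  have two: "\<exists>j k. j < g \<and> k < g \<and> j \<noteq> i \<and> k \<noteq> i \<and> j < k \<and> N (d i) \<inter> H = {d j, d k}" if i: "i < g" for i
  proof -
    have "N (d i) \<inter> H = N (d i) - {c i}"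
      using d_nbr_C[OF i] N_V[of "d i"] H_disj[of "c i"] c_in[OF i] by (auto simp: H_def)
    then have "deg H (d i) = 2" using cubic[OF in_V(1)[OF i]] d_in_N(2)[OF i] by (simp add: deg_def)
    then obtain x y where xy: "N (d i) \<inter> H = {x, y}" "x \<noteq> y" by (rule deg2_obtain)
    obtain j k where jk: "j < g" "x = d j" "k < g" "y = d k" using nbr_d[OF i, of x] nbr_d[OF i, of y] xy(1) by auto
    have "d i \<notin> {x, y}" using xy(1) N_irrefl by blast
    then have ne: "j \<noteq> i" "k \<noteq> i" using jk by auto
    have NH: "N (d i) \<inter> H = {d j, d k}" "N (d i) \<inter> H = {d k, d j}" using xy(1) jk by auto
    have "j \<noteq> k" using xy(2) jk by auto
    then consider "j < k" | "k < j" by linarith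
    then show ?thesis
    proof cases
      case 1
      with NH(1) ne jk(1,3) show ?thesis by (intro exI[of _ j] exI[of _ k] conjI)
    next
      case 2
      with NH(2) ne jk(1,3) show ?thesis by (intro exI[of _ k] exI[of _ j] conjI)
    qed
  qed
  obtain j k where jk: "j < g" "k < g" "j \<noteq> 0" "j < k" "N (d 0) \<inter> H = {d j, d k}"
    using two[OF g] by blast
  \<comment> \<open>The vertices \<open>d 0\<close> and \<open>d l\<close> form a detour of two
    outside vertices between \<open>c 0\<close> and \<open>c l\<close>.\<close>
  have far: "g \<le> l + 3 \<and> l \<le> 3" if l: "l < g" "0 < l" "d l \<in> N (d 0)" for l
  proof -
    have "d 0 \<in> N (d l)" using l(3) by (rule N_sym)
    then show ?thesis
      using mincyc_detour2[OF m l(2,1), of "d 0" "d l"] d_notin[OF g] d_notin[OF l(1)] d_in_N(1)[OF g] d_in_N(1)[OF l(1)]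
      by (simp add: C_def)
  qed
  have "d j \<in> N (d 0)" "d k \<in> N (d 0)" using jk(5) by auto
  then have jk': "g \<le> j + 3" "k \<le> 3" using far[of j] far[of k] jk by auto
  \<comment> \<open>After deleting \<open>d 0\<close> its neighbour \<open>d x\<close> has degree at
    most one and can be freed. The other neighbour \<open>d w\<close> is left uncontrolled, so
    \<open>w\<close> has to be an index at which that does no harm.\<close>
  have main: "\<exists>\<phi> p. valid \<phi> p (E H) \<and> K p (E H) (d 0) = {} \<and>
      (\<forall>i<g. i \<noteq> w \<longrightarrow> card (K p (E H) (d i)) \<le> 1)"
    if w: "w < g" "x < g" "x \<noteq> w" "N (d 0) \<inter> H = {d x, d w}" for w x
  proof -
    have x: "d x \<in> N (d 0)" using w(4) by auto
    then have x0: "d 0 \<in> N (d x)" by (rule N_sym)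
    have "d x \<noteq> d 0" using x N_irrefl[of "d 0"] by auto
    then have x': "d x \<in> H - {d 0}" using d_in_H[OF w(2)] by simp
    have "deg (H - {d 0}) (d x) \<le> 1"
      using deg_remove[OF x0 d_in_H[OF g]] deg_d[OF w(2)] by simp
    then have r: "rooted (H - {d 0}) (d x)"
      by (intro sparse_colourings(2)[OF sparse_mono[OF sp] x']) auto
    have ne: "d x \<noteq> d w" using w by simp
    show ?thesis
    proof (rule rooted_flat[OF d_in_H[OF g] w(4) ne deg_d[OF w(2)] r])
      fix \<phi> p
      assume "valid \<phi> p (E H)" "K p (E H) (d 0) = {}"
        and k: "\<And>v. v \<in> H \<Longrightarrow> v \<noteq> d w \<Longrightarrow> deg H v \<le> 2 \<Longrightarrow> card (K p (E H) v) \<le> 1"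
      moreover have "\<forall>i<g. i \<noteq> w \<longrightarrow> card (K p (E H) (d i)) \<le> 1"
        using k[OF d_in_H _ deg_d] w(1) by simp
      ultimately show ?thesis by blast
    qed
  qed
  have swap: "N (d 0) \<inter> H = {d k, d j}" using jk(5) by (simp add: insert_commute)
  show ?thesis
  proof (cases "j = g - 2 \<or> k = g - 2")
    case True
    then obtain w x where "w = g - 2" "w < g" "x < g" "x \<noteq> w" "N (d 0) \<inter> H = {d x, d w}"
      using jk swap by (metis less_irrefl)
    from this(1) main[OF this(2-5)] obtain \<phi> p where v: "valid \<phi> p (E H)" and K0: "K p (E H) (d 0) = {}"
      and k: "\<And>i. i < g \<Longrightarrow> i \<noteq> g - 2 \<Longrightarrow> card (K p (E H) (d i)) \<le> 1" by blast
    show ?thesis using g3 by (intro cycle_colourable[OF v K0] card_star_K[OF v] k) auto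
  next
    case False
    \<comment> \<open>From \<open>g \<le> j + 3\<close> and \<open>j < k \<le> 3\<close>: length
      five forces \<open>k = 3 = g - 2\<close>, a triangle forces \<open>j = 1 = g - 2\<close>, and
      among the pairs for length four only 1 and 3 avoid \<open>g - 2\<close>.\<close>
    then have g4: "g = 4" "j = 1" "k = 3" using jk jk' by auto
    have k1: "k \<noteq> j" using jk by simp
    from main[OF jk(1,2) k1 swap] obtain \<phi> p where v: "valid \<phi> p (E H)" and K0: "K p (E H) (d 0) = {}"
      and k: "\<And>i. i < g \<Longrightarrow> i \<noteq> 1 \<Longrightarrow> card (K p (E H) (d i)) \<le> 1" using g4 by blast
    have d01: "d 1 \<in> N (d 0)" "d 3 \<in> N (d 0)" using jk(5) g4 by auto
    have no3: "d 3 \<notin> N (d 1)"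
    proof
      assume 31: "d 3 \<in> N (d 1)"
      let ?c = "\<lambda>m. if m = 0 then d 0 else if m = 1 then d 1 else d 3"
      have "cyc ?c 3"
        using d01 31 N_sym[OF d01(2)] g4
        by (auto simp: cyc_def path_def inj_on_def numeral_3_eq_3 less_Suc_eq)
      with m g4 show False unfolding mincyc_def by fastforce
    qed
    have g1: "1 < g" using g4 by simp
    obtain a b where ab: "a < g" "b < g" "a \<noteq> 1" "b \<noteq> 1" "a < b" "N (d 1) \<inter> H = {d a, d b}"
      using two[OF g1] by blast
    have "d 0 \<in> N (d 1) \<inter> H" using N_sym[OF d01(1)] d_in_H[OF g] by simp
    then have "d 0 = d a \<or> d 0 = d b" unfolding ab(6) by simp
    then have "a = 0" using ab(1,2,5) g by auto
    moreover have "b \<noteq> 3" using no3 ab by auto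
    ultimately have "b = 2" using ab g4 by auto
    have "K p (E H) (d 1) \<subseteq> star (E H) (d 1)"
      using v by (auto simp: K_def star_def valid_def)
    also have "\<dots> = (\<lambda>y. {d 1, y}) ` {d 0, d 2}"
      using star_E[OF d_in_H[OF g1]] ab \<open>a = 0\<close> \<open>b = 2\<close> by simp
    \<comment> \<open>The edge \<open>{d 1, d 2}\<close> is counted at \<open>d 2\<close> already,
      so even two private edges at \<open>d 1\<close> add only one.\<close>
    also have "\<dots> \<subseteq> insert {d 1, d 0} (star (E H) (d 2))"
    proof -
      have "d 2 \<in> N (d 1)" "d 1 \<in> H" "d 2 \<in> H" using ab \<open>b = 2\<close> d_in_H[OF g1] by auto
      then have "{d 1, d 2} \<in> E H" by (simp add: E_iff)
      then show ?thesis by (simp add: star_def)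
    qed
    finally have "star (E H) (d 2) \<union> K p (E H) (d 1) \<subseteq> insert {d 1, d 0} (star (E H) (d 2))" by blast
    then have "card (star (E H) (d 2) \<union> K p (E H) (d 1)) \<le> card (insert {d 1, d 0} (star (E H) (d 2)))"
      by (intro card_mono) (auto simp: star_def)
    also have "\<dots> \<le> Suc (card (star (E H) (d 2)))" by (simp add: card_insert_if star_def)
    also have "\<dots> \<le> 3" using card_star[of H "d 2"] deg_d[of 2] g4 by simp
    finally have c1: "card (star (E H) (d 2) \<union> K p (E H) (d 1)) \<le> 3" .
    show ?thesis
    proof (rule cycle_colourable[OF v K0])
      fix i assume "1 \<le> i" "i + 3 \<le> g"
      then have "i = 1" using g4 by simp
      then show "card (star (E H) (d (i + 1)) \<union> K p (E H) (d i)) \<le> 3" using c1 by (simp add: numeral_2_eq_2)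
    next
      show "card (star (E H) (d (g - 2)) \<union> K p (E H) (d (g - 1))) \<le> 3"
        using g4 by (intro card_star_K[OF v] k) auto
    qed
  qed
qed

end

context subcubic
begin

text \<open>Connectivity enters as a statement on cuts: a proper nonempty vertex set has an edge
  leaving it, hence a vertex of degree at most two inside. This makes the complement of the cycle
  sparse.\<close>

lemma twin_free_colourable:
  assumes "V \<noteq> {}" and cubic: "\<And>v. v \<in> V \<Longrightarrow> card (N v) = 3"
    and conn: "\<And>B. B \<subseteq> V \<Longrightarrow> B \<noteq> {} \<Longrightarrow> B \<noteq> V \<Longrightarrow> \<exists>x\<in>B. \<exists>y\<in>N x. y \<notin> B"
    and no_diamond: "\<And>a b. b \<in> N a \<Longrightarrow> N a - {b} \<noteq> N b - {a}"
    and no_twins: "\<And>a b. a \<in> V \<Longrightarrow> a \<noteq> b \<Longrightarrow> N a \<noteq> N b"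
  shows "\<exists>c p. valid c p (E V)"
proof -
  have "2 \<le> card (N v)" if "v \<in> V" for v using cubic[OF that] by simp
  from mincyc_exists[OF assms(1) this] obtain c g where m: "mincyc c g" by blast
  have colour: "\<exists>c p. valid c p (E V)" if m: "mincyc c g" and cy: "cycle V N c d g"
    and tok: "(\<exists>y\<in>N (d 0) \<inter> (V - c ` {..<g}). deg (V - c ` {..<g}) y = 3) \<or>
      (\<forall>i<g. \<forall>y\<in>N (d i) \<inter> (V - c ` {..<g}). deg (V - c ` {..<g}) y \<le> 2)" for c d g
  proof -
    interpret cycle V N c d g "\<lambda>i. if Suc i = g then 0 else Suc i" "\<lambda>i. if i = 0 then g - 1 else i - 1"
      "c ` {..<g}" "V - c ` {..<g}" by (rule cy) auto
    have sp: "sparse (V - c ` {..<g})"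
      unfolding sparse_def
    proof (intro conjI allI impI)
      fix B assume B: "B \<subseteq> V - c ` {..<g}" "B \<noteq> {}"
      have "c 0 \<in> V" "c 0 \<in> c ` {..<g}" using in_V(2)[of 0] g3 by auto
      with B have "B \<noteq> V" "B \<subseteq> V" by auto
      with conn B(2) obtain x y where xy: "x \<in> B" "y \<in> N x" "y \<notin> B" by blast
      have "deg B x \<le> card (N x - {y})" unfolding deg_def using xy by (intro card_mono) auto
      then show "\<exists>v\<in>B. deg B v \<le> 2" using xy N_le3[of x] by (intro bexI[of _ x]) simp_all
    qed simp
    from tok show ?thesis
    proof
      assume "\<exists>y\<in>N (d 0) \<inter> (V - c ` {..<g}). deg (V - c ` {..<g}) y = 3"
      then show ?thesis using token_colourable[OF cubic sp] by blast
    next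
      assume "\<forall>i<g. \<forall>y\<in>N (d i) \<inter> (V - c ` {..<g}). deg (V - c ` {..<g}) y \<le> 2"
      then show ?thesis using flat_colourable[OF cubic sp m] by blast
    qed
  qed
  obtain d where cy: "cycle V N c d g" by (rule mincyc_cycle[OF m cubic no_diamond no_twins])
  let ?H = "V - c ` {..<g}"
  show ?thesis
  proof (cases "\<forall>i<g. \<forall>y\<in>N (d i) \<inter> ?H. deg ?H y \<le> 2")
    case True
    then show ?thesis using colour[OF m cy] by blast
  next
    case False
    then obtain i y where i: "i < g" "y \<in> N (d i) \<inter> ?H" "\<not> deg ?H y \<le> 2" by blast
    then have y3: "deg ?H y = 3" using deg_le3[of ?H y] by linarith
    \<comment> \<open>Rotation brings the outer vertex with a neighbour of degree three to index 0.
      The new \<open>d' 0\<close> is the old \<open>d i\<close> because \<open>c i\<close> has a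
      single neighbour off the cycle.\<close>
    let ?c = "\<lambda>m. c ((m + i) mod g)"
    have m': "mincyc ?c g" by (rule mincyc_rotate[OF m i(1)])
    obtain d' where cy': "cycle V N ?c d' g" by (rule mincyc_cycle[OF m' cubic no_diamond no_twins])
    have "cyc c g" using m by (simp add: mincyc_def)
    then have im: "?c ` {..<g} = c ` {..<g}" using cyc_rotate(2) i(1) by blast
    have "0 < g" using i by simp
    have "d' 0 \<in> N (?c 0)" "d' 0 \<notin> ?c ` {..<g}"
      using cy' \<open>0 < g\<close> unfolding cycle_def cycle_axioms_def by blast+
    then have "d' 0 \<in> N (c i)" "d' 0 \<notin> c ` {..<g}" using i(1) im by simp_all
    moreover have "N (c i) \<subseteq> insert (d i) (c ` {..<g})"
    proof -
      have "N (c i) = {c (if i = 0 then g - 1 else i - 1), c (if Suc i = g then 0 else Suc i), d i}"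
        using cy i(1) unfolding cycle_def cycle_axioms_def by blast
      moreover have "(if i = 0 then g - 1 else i - 1) < g" "(if Suc i = g then 0 else Suc i) < g"
        using i(1) by auto
      ultimately show ?thesis by blast
    qed
    ultimately have d'0: "d' 0 = d i" by blast
    have "\<exists>y\<in>N (d' 0) \<inter> (V - ?c ` {..<g}). deg (V - ?c ` {..<g}) y = 3"
      unfolding im d'0 using i(2) y3 by blast
    then show ?thesis using colour[OF m' cy'] by blast
  qed
qed

section \<open>Vertices with the same neighbours\<close>

text \<open>Any order works: an edge of \<open>F\<close> sees at most \<open>card F - 1\<close>
  others of \<open>F\<close>. On \<open>M\<close> the colours are counted rather than the edges, so
  that a repeated colour can be exploited.\<close>

lemma greedy_extension:
  assumes v: "valid c p M" and fin: "finite M" "finite F"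
    and new: "\<And>e. e \<in> F \<Longrightarrow> e = {pr e, ot e} \<and> ot e \<in> N (pr e) \<and> e \<notin> M"
    and few: "\<And>e. e \<in> F \<Longrightarrow> card (c ` blocked p M (pr e) (ot e)) + card F \<le> 8"
  shows "\<exists>c' p'. valid c' p' (M \<union> F) \<and> (\<forall>f\<in>M. c' f = c f \<and> p' f = p f)"
proof -
  have "\<exists>c' p'. valid c' p' (M \<union> S) \<and> (\<forall>f\<in>M. c' f = c f \<and> p' f = p f)" if "S \<subseteq> F" for S
    using finite_subset[OF that fin(2)] that
  proof (induction S rule: finite_induct)
    case empty
    then show ?case using v by (intro exI[of _ c] exI[of _ p]) simp
  next
    case (insert e S)
    then obtain c' p' where c': "valid c' p' (M \<union> S)" and agree: "\<And>f. f \<in> M \<Longrightarrow> c' f = c f \<and> p' f = p f"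
      by auto
    have eF: "e \<in> F" "e \<notin> S" "finite S" "insert e S \<subseteq> F" using insert by auto
    let ?x = "pr e" and ?y = "ot e"
    let ?b = "blocked p M ?x ?y" and ?b' = "blocked p' (M \<union> S) ?x ?y"
    have finb: "finite ?b" using fin by (simp add: blocked_def)
    have "?b' \<subseteq> ?b \<union> S" using agree by (auto simp: blocked_def near_def)
    then have "c' ` ?b' \<subseteq> c' ` ?b \<union> c' ` S" by blast
    moreover have "c' ` ?b = c ` ?b" using agree by (intro image_cong) (auto simp: blocked_def near_def)
    ultimately have sub: "c' ` ?b' \<subseteq> c ` ?b \<union> c' ` S" by simp
    have "card (c' ` ?b') \<le> card (c ` ?b \<union> c' ` S)" using finb eF(3) by (intro card_mono sub) auto
    also have "\<dots> \<le> card (c ` ?b) + card (c' ` S)" by (rule card_Un_le)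
    also have "card (c' ` S) \<le> card S" by (rule card_image_le[OF eF(3)])
    finally have "card (c' ` ?b') \<le> card (c ` ?b) + card S" by simp
    moreover have "card S < card F" using eF fin(2) by (intro psubset_card_mono) auto
    ultimately have "card (c' ` ?b') \<le> 7" using few[OF eF(1)] by linarith
    moreover have "finite (c' ` ?b')" using fin eF(3) by (simp add: blocked_def)
    ultimately obtain k where k: "k < 8" "k \<notin> id ` (c' ` ?b')" using ex_colour[of "c' ` ?b'" id] by metis
    have e: "e = {?x, ?y}" "?y \<in> N ?x" "e \<notin> M \<union> S" using new[OF eF(1)] eF(2) by auto
    have n: "{?x, ?y} \<notin> M \<union> S" using e(1,3) by metis
    have "k \<notin> c' ` ?b'" using k(2) by simp
    then have "valid (c'({?x, ?y} := k)) (p'({?x, ?y} := ?x)) (insert {?x, ?y} (M \<union> S))"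
      by (rule add_edge[OF c' e(2) n k(1)])
    then have "valid (c'(e := k)) (p'(e := ?x)) (M \<union> insert e S)"
      using e(1) by (metis Un_insert_right)
    moreover have "\<forall>f\<in>M. (c'(e := k)) f = c f \<and> (p'(e := ?x)) f = p f" using agree e(3) by auto
    ultimately show ?case by blast
  qed
  from this[OF order_refl] show ?thesis .
qed

lemma valid_subset: "valid c p M \<Longrightarrow> L \<subseteq> M \<Longrightarrow> valid c p L"
  unfolding valid_def by (meson subsetD)

lemma few_edges:
  assumes "card (E V) \<le> 8"
  shows "\<exists>c p. valid c p (E V)"
proof -
  have "card (E V) \<le> card {..<8::nat}" using assms by simp
  then obtain c :: "'a set \<Rightarrow> nat" where c: "c ` E V \<subseteq> {..<8}" "inj_on c (E V)"
    by (metis card_le_inj finE finite_lessThan)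
  have "(SOME x. x \<in> e) \<in> e" if e: "e \<in> E V" for e
  proof -
    obtain x y where "e = {x, y}" using e by (rule E_elim)
    then have "x \<in> e" by simp
    then show ?thesis by (rule someI)
  qed
  then have "valid c (\<lambda>e. SOME x. x \<in> e) (E V)"
    using c unfolding valid_def inj_on_def by blast
  then show ?thesis by blast
qed

text \<open>With its private end at \<open>d\<close>, the pendant edge keeps all private ends inside
  \<open>A0\<close>, away from the small configuration that is filled in afterwards.\<close>

lemma pendant:
  assumes v: "valid c p (E A)" and x: "x \<notin> A" "N x \<inter> A = {d}" and K: "\<And>w. w \<notin> A0 \<Longrightarrow> K p (E A) w = {}" "d \<in> A0"
  obtains c' p' where "valid c' p' (E (insert x A))" "\<And>w. w \<notin> A0 \<Longrightarrow> K p' (E (insert x A)) w = {}"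
proof (rule add1[OF x v])
  fix c' p'
  assume v': "valid c' p' (E (insert x A))"
    and K': "\<And>w. K p' (E (insert x A)) w = (if w = d then insert {d, x} (K p (E A) d) else K p (E A) w)"
  show thesis
  proof (rule that[OF v'])
    fix w assume "w \<notin> A0"
    then show "K p' (E (insert x A)) w = {}" using K K'[of w] by auto
  qed
qed

lemma near_single:
  assumes "N x \<inter> A = {d}" "x \<in> A"
  shows "near (E A) x \<subseteq> star (E A) d"
  using near_E_subset[OF assms(2)] assms(1) by auto

text \<open>\<open>x\<close> has only one coloured edge, and no private end is adjacent to
  \<open>y\<close>; so only the at most three edges at the outer neighbour \<open>d\<close>
  count.\<close>

lemma blocked_inner:
  assumes v: "valid c p (E A)" and x: "x \<in> A" "N x \<inter> A = {d}"
    and K: "\<And>w. w \<in> N y \<Longrightarrow> K p (E A) w = {}"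
  shows "blocked p (E A) x y \<subseteq> star (E A) d"
  using near_single[OF x(2,1)] K unfolding blocked_def K_def by blast

lemma card_c_star: "card (c ` star (E A) d) \<le> 3"
proof -
  have "card (c ` star (E A) d) \<le> card (star (E A) d)" by (intro card_image_le) (simp add: star_def)
  with card_star[of A d] deg_le3[of A d] show ?thesis by linarith
qed

lemma card_blocked_inner:
  assumes "valid c p (E A)" "x \<in> A" "N x \<inter> A = {d}" "\<And>w. w \<in> N y \<Longrightarrow> K p (E A) w = {}"
  shows "card (c ` blocked p (E A) x y) \<le> 3"
proof -
  have "card (c ` blocked p (E A) x y) \<le> card (c ` star (E A) d)"
    using blocked_inner[OF assms] by (intro card_mono image_mono) (auto simp: star_def)
  with card_c_star[of c A d] show ?thesis by linarith
qed

text \<open>After the pendant edges at \<open>x1\<close> and \<open>x2\<close> have received outer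
  private ends, five edges remain. Each sees at most three earlier colours, and 3 + 5 = 8.\<close>

lemma diamond_colourable:
  assumes N: "N a = {b, x1, x2}" "N b = {a, x1, x2}" "N x1 = {a, b, d1}" "N x2 = {a, b, d2}"
    and d: "d1 \<notin> {a, b, x1, x2}" "d2 \<notin> {a, b, x1, x2}" and x: "x1 \<noteq> x2"
    and sp: "sparse (V - {a, b, x1, x2})"
  shows "\<exists>c p. valid c p (E V)"
proof -
  let ?B = "V - {a, b, x1, x2}"
  have ne: "a \<noteq> b" "a \<noteq> x1" "a \<noteq> x2" "b \<noteq> x1" "b \<noteq> x2"
    using N N_irrefl[of a] N_irrefl[of b] by auto
  have inV: "a \<in> V" "b \<in> V" "x1 \<in> V" "x2 \<in> V" "d1 \<in> V" "d2 \<in> V"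
    using N N_V[of a] N_V[of b] N_V[of x1] N_V[of x2] by auto
  obtain c0 p0 where v0: "valid c0 p0 (E ?B)"
    using sparse_colourings(1)[OF sp] by (auto simp: colourable_def good_def)
  have K0: "\<And>w. w \<notin> ?B \<Longrightarrow> K p0 (E ?B) w = {}" using K_out[OF v0] .
  have s1: "x1 \<notin> ?B" "N x1 \<inter> ?B = {d1}" "d1 \<in> ?B" using N d inV by auto
  obtain c1 p1 where v1: "valid c1 p1 (E (insert x1 ?B))" and
    K1: "\<And>w. w \<notin> ?B \<Longrightarrow> K p1 (E (insert x1 ?B)) w = {}"
    using pendant[OF v0 s1(1,2) K0 s1(3)] by metis
  have s2: "x2 \<notin> insert x1 ?B" "N x2 \<inter> insert x1 ?B = {d2}" "d2 \<in> ?B" using N d inV x ne by auto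
  have A: "insert x2 (insert x1 ?B) = V - {a, b}" using inV ne by auto
  let ?A = "V - {a, b}"
  obtain c p where v: "valid c p (E ?A)" and K: "\<And>w. w \<notin> ?B \<Longrightarrow> K p (E ?A) w = {}"
    using pendant[OF v1 s2(1,2) K1 s2(3)] unfolding A by metis
  have NA: "N x1 \<inter> ?A = {d1}" "N x2 \<inter> ?A = {d2}" "x1 \<in> ?A" "x2 \<in> ?A" using N d inV ne by auto
  have Kab: "K p (E ?A) w = {}" if "w \<in> N a \<or> w \<in> N b" for w using that N K by auto
  let ?F = "{{x1, a}, {x1, b}, {x2, a}, {x2, b}, {a, b}}"
  define pr where "pr e = (if x1 \<in> e then x1 else if x2 \<in> e then x2 else a)" for e
  define ot where "ot e = (if b \<in> e then b else a)" for e
  have po: "pr {x1, a} = x1" "pr {x1, b} = x1" "pr {x2, a} = x2" "pr {x2, b} = x2" "pr {a, b} = a"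
    "ot {x1, a} = a" "ot {x1, b} = b" "ot {x2, a} = a" "ot {x2, b} = b" "ot {a, b} = b"
    using ne x by (auto simp: pr_def ot_def)
  have b1: "card (c ` blocked p (E ?A) x1 y) \<le> 3" "card (c ` blocked p (E ?A) x2 y) \<le> 3" if "y = a \<or> y = b" for y
    using that Kab by (auto intro!: card_blocked_inner[OF v NA(3,1)] card_blocked_inner[OF v NA(4,2)])
  have b2: "blocked p (E ?A) a b \<subseteq> {{x1, d1}, {x2, d2}}"
  proof
    fix f assume "f \<in> blocked p (E ?A) a b"
    then have f: "f \<in> E ?A" "f \<inter> ball a \<noteq> {}" using Kab by (auto simp: blocked_def near_def K_def)
    have "x1 \<in> f \<or> x2 \<in> f" using E_subset[OF f(1)] f(2) N(1) by (auto simp: ball_def)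
    then have "f \<in> star (E ?A) x1 \<or> f \<in> star (E ?A) x2" using f(1) by (auto simp: star_def)
    then show "f \<in> {{x1, d1}, {x2, d2}}" unfolding star_E[OF NA(3)] star_E[OF NA(4)] NA(1,2) by auto
  qed
  have "c ` blocked p (E ?A) a b \<subseteq> set [c {x1, d1}, c {x2, d2}]" using b2 by auto
  then have "card (c ` blocked p (E ?A) a b) \<le> card (set [c {x1, d1}, c {x2, d2}])"
    by (intro card_mono) auto
  then have b3: "card (c ` blocked p (E ?A) a b) \<le> 3" using card_length[of "[c {x1, d1}, c {x2, d2}]"] by simp
  have cF: "card ?F \<le> 5" using card_length[of "[{x1, a}, {x1, b}, {x2, a}, {x2, b}, {a, b}]"] by simp
  have "\<exists>c' p'. valid c' p' (E ?A \<union> ?F) \<and> (\<forall>f\<in>E ?A. c' f = c f \<and> p' f = p f)"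
  proof (rule greedy_extension[OF v])
    fix e assume e: "e \<in> ?F"
    have "card (c ` blocked p (E ?A) (pr e) (ot e)) \<le> 3"
      using e b1[of a] b1[of b] b3 by (elim insertE) (simp_all add: po)
    with cF show "card (c ` blocked p (E ?A) (pr e) (ot e)) + card ?F \<le> 8" by linarith
    have "e \<notin> E ?A" using e by (auto simp: E_iff)
    moreover have "e = {pr e, ot e} \<and> ot e \<in> N (pr e)"
      using e N by (elim insertE) (simp_all add: po)
    ultimately show "e = {pr e, ot e} \<and> ot e \<in> N (pr e) \<and> e \<notin> E ?A" by blast
  qed auto
  moreover have "E V \<subseteq> E ?A \<union> ?F"
  proof
    fix f assume "f \<in> E V"
    have all: "{a, b} \<in> E ?A \<union> ?F" "{a, x1} \<in> E ?A \<union> ?F" "{a, x2} \<in> E ?A \<union> ?F" "{b, a} \<in> E ?A \<union> ?F" "{b, x1} \<in> E ?A \<union> ?F" "{b, x2} \<in> E ?A \<union> ?F"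
      by (simp_all add: insert_commute)
    have inner: "{s, r} \<in> E ?A \<union> ?F" if s: "s \<in> {a, b}" and r: "r \<in> N s" for s r
    proof (cases "s = a")
      case True
      with r N(1) have "r = b \<or> r = x1 \<or> r = x2" by simp
      with True all show ?thesis by (elim disjE) (simp_all only:)
    next
      case False
      with s have "s = b" by simp
      with r N(2) have "r = a \<or> r = x1 \<or> r = x2" by simp
      with \<open>s = b\<close> all show ?thesis by (elim disjE) (simp_all only:)
    qed
    from \<open>f \<in> E V\<close> obtain u w where f: "f = {u, w}" "u \<in> V" "w \<in> V" "w \<in> N u" "u \<in> N w" by (rule E_elim)
    show "f \<in> E ?A \<union> ?F"
    proof (cases "u \<in> {a, b} \<or> w \<in> {a, b}")
      case True
      then show ?thesis
      proof
        assume "u \<in> {a, b}"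
        then show ?thesis unfolding f(1) by (rule inner[OF _ f(4)])
      next
        assume "w \<in> {a, b}"
        then have "{w, u} \<in> E ?A \<union> ?F" by (rule inner[OF _ f(5)])
        moreover have "{w, u} = {u, w}" by (rule insert_commute)
        ultimately show ?thesis unfolding f(1) by (simp only:)
      qed
    next
      case False
      then show ?thesis using f by (auto simp: E_iff)
    qed
  qed
  ultimately show ?thesis by (meson valid_subset)
qed

text \<open>The six inner edges all see each other, but the edges at \<open>x1\<close> are already barred from the
  colour \<open>t\<close>, which is free for an edge at \<open>x2\<close>.\<close>

lemma twins_finish:
  assumes N: "N a = {x1, x2, x3}" "N b = {x1, x2, x3}" "a \<noteq> b" "x1 \<noteq> x2" "x1 \<noteq> x3" "x2 \<noteq> x3"
    and v: "valid c p (E (V - {a, b}))"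
    and x: "N x1 \<inter> (V - {a, b}) = {d1}" "N x2 \<inter> (V - {a, b}) = {d2}" "N x3 \<inter> (V - {a, b}) = {d3}"
    and K: "\<And>w. w \<in> N a \<Longrightarrow> K p (E (V - {a, b})) w = {}"
    and t: "t \<in> c ` star (E (V - {a, b})) d1" "t \<notin> c ` star (E (V - {a, b})) d2"
  shows "\<exists>c p. valid c p (E V)"
proof -
  let ?A = "V - {a, b}"
  let ?S1 = "c ` star (E ?A) d1" and ?S2 = "c ` star (E ?A) d2" and ?S3 = "c ` star (E ?A) d3"
  have Nab: "N b = N a" using N by simp
  have ne: "a \<noteq> x1" "a \<noteq> x2" "a \<noteq> x3" "b \<noteq> x1" "b \<noteq> x2" "b \<noteq> x3" "a \<notin> N b"
    using N N_irrefl[of a] N_irrefl[of b] by auto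
  have aN: "a \<in> N x1" "a \<in> N x2" "a \<in> N x3" "b \<in> N x1" "b \<in> N x2" "b \<in> N x3"
    using N(1,2) N_sym[of x1 a] N_sym[of x2 a] N_sym[of x3 a] N_sym[of x1 b] N_sym[of x2 b] N_sym[of x3 b] by auto
  have xA: "x1 \<in> ?A" "x2 \<in> ?A" "x3 \<in> ?A" using N(1) N_V[of a] ne by auto
  have K': "\<And>w. w \<in> N y \<Longrightarrow> K p (E ?A) w = {}" if "y \<in> {a, b}" for y using that K Nab by auto
  have bl: "blocked p (E ?A) x1 y \<subseteq> star (E ?A) d1" "blocked p (E ?A) x2 y \<subseteq> star (E ?A) d2"
    "blocked p (E ?A) x3 y \<subseteq> star (E ?A) d3" if "y \<in> {a, b}" for y
    using blocked_inner[OF v xA(1) x(1) K'[OF that]] blocked_inner[OF v xA(2) x(2) K'[OF that]]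
      blocked_inner[OF v xA(3) x(3) K'[OF that]] by blast+
  have outE: "{x, y} \<notin> E ?A" if "y \<in> {a, b}" for x y using that by (auto simp: E_iff)
  have t8: "t < 8" using t(1) validD(2)[OF v] by (auto simp: star_def)
  have t2: "t \<notin> c ` blocked p (E ?A) x2 a" using bl(2)[of a] t(2) by blast
  define e0 where "e0 = {x2, a}"
  define c0 where "c0 = c(e0 := t)"
  define p0 where "p0 = p(e0 := x2)"
  define M0 where "M0 = insert e0 (E ?A)"
  have e0_out: "e0 \<notin> E ?A" unfolding e0_def by (rule outE) simp
  have v0: "valid c0 p0 M0"
    unfolding c0_def p0_def M0_def e0_def
    by (rule add_edge[OF v aN(2) _ t8 t2]) (simp add: outE)
  have fs: "finite (c ` star (E ?A) z)" for z by (simp add: star_def)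
  have bl0: "c0 ` blocked p0 M0 x y \<subseteq> insert t (c ` blocked p (E ?A) x y)" for x y
    using e0_out by (auto simp: blocked_def near_def c0_def p0_def M0_def)
  have b23: "card (c0 ` blocked p0 M0 x2 y) \<le> 4" "card (c0 ` blocked p0 M0 x3 y) \<le> 4" if "y \<in> {a, b}" for y
  proof -
    have "c0 ` blocked p0 M0 x2 y \<subseteq> insert t ?S2" "c0 ` blocked p0 M0 x3 y \<subseteq> insert t ?S3"
      using bl0[of x2 y] bl0[of x3 y] bl(2,3)[OF that] by blast+
    then have "card (c0 ` blocked p0 M0 x2 y) \<le> card (insert t ?S2)"
      "card (c0 ` blocked p0 M0 x3 y) \<le> card (insert t ?S3)"
      using fs by (auto intro!: card_mono)
    moreover have "card (insert t ?S2) \<le> Suc (card ?S2)" "card (insert t ?S3) \<le> Suc (card ?S3)"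
      using fs by (simp_all add: card_insert_if)
    ultimately show "card (c0 ` blocked p0 M0 x2 y) \<le> 4" "card (c0 ` blocked p0 M0 x3 y) \<le> 4"
      using card_c_star[of c ?A d2] card_c_star[of c ?A d3] by linarith+
  qed
  define F where "F = {{x2, b}, {x3, a}, {x3, b}}"
  define G where "G = {{x1, a}, {x1, b}}"
  define ot where "ot e = (if b \<in> e then b else a)" for e
  define pr where "pr e = (if x2 \<in> e then x2 else x3)" for e
  have po: "pr {x2, b} = x2" "pr {x3, a} = x3" "pr {x3, b} = x3"
    "ot {x2, b} = b" "ot {x3, a} = a" "ot {x3, b} = b" "ot {x1, a} = a" "ot {x1, b} = b"
    using ne N(3-6) by (auto simp: pr_def ot_def)
  have ne0: "{x2, b} \<noteq> e0" "{x3, a} \<noteq> e0" "{x3, b} \<noteq> e0" "{x1, a} \<noteq> e0" "{x1, b} \<noteq> e0"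
    unfolding e0_def using N(3-6) ne by (auto simp: doubleton_eq_iff)
  have notM0: "{x2, b} \<notin> M0" "{x3, a} \<notin> M0" "{x3, b} \<notin> M0" "{x1, a} \<notin> M0" "{x1, b} \<notin> M0"
    unfolding M0_def using ne0 outE[of b x2] outE[of a x3] outE[of b x3] outE[of a x1] outE[of b x1] by simp_all
  have cF: "card F \<le> 3" "card G \<le> 2" unfolding F_def G_def
    using card_length[of "[{x2, b}, {x3, a}, {x3, b}]"] card_length[of "[{x1, a}, {x1, b}]"] by simp_all
  have finF: "finite F" "finite G" "finite M0" by (simp_all add: F_def G_def M0_def)
  have F_cases: "e = {pr e, ot e} \<and> ot e \<in> N (pr e) \<and> e \<notin> M0 \<and> (pr e = x2 \<or> pr e = x3)" if "e \<in> F" for e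
    using that aN notM0 unfolding F_def by (elim insertE) (simp_all add: po)
  have "\<exists>c' p'. valid c' p' (M0 \<union> F) \<and> (\<forall>f\<in>M0. c' f = c0 f \<and> p' f = p0 f)"
  proof (rule greedy_extension[OF v0 finF(3,1)])
    fix e assume e: "e \<in> F"
    then show "e = {pr e, ot e} \<and> ot e \<in> N (pr e) \<and> e \<notin> M0" using F_cases by simp
    have "ot e \<in> {a, b}" by (simp add: ot_def)
    then have "card (c0 ` blocked p0 M0 (pr e) (ot e)) \<le> 4" using F_cases[OF e] b23[of "ot e"] by auto
    with cF show "card (c0 ` blocked p0 M0 (pr e) (ot e)) + card F \<le> 8" by linarith
  qed
  then obtain c1 p1 where v1: "valid c1 p1 (M0 \<union> F)"
    and ag: "\<And>f. f \<in> M0 \<Longrightarrow> c1 f = c0 f \<and> p1 f = p0 f" by auto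
  have c1: "card (c1 ` blocked p1 (M0 \<union> F) x1 y) \<le> 6" if y: "y \<in> {a, b}" for y
  proof -
    have "blocked p1 (M0 \<union> F) x1 y \<subseteq> blocked p0 M0 x1 y \<union> F"
      using ag by (auto simp: blocked_def near_def)
    then have "c1 ` blocked p1 (M0 \<union> F) x1 y \<subseteq> c1 ` blocked p0 M0 x1 y \<union> c1 ` F" by blast
    also have "c1 ` blocked p0 M0 x1 y = c0 ` blocked p0 M0 x1 y"
      using ag by (intro image_cong) (auto simp: blocked_def near_def)
    finally have 1: "c1 ` blocked p1 (M0 \<union> F) x1 y \<subseteq> c0 ` blocked p0 M0 x1 y \<union> c1 ` F" .
    have "c ` blocked p (E ?A) x1 y \<subseteq> ?S1" by (intro image_mono bl(1) y)
    \<comment> \<open>The edge \<open>e0\<close> adds nothing, as its colour \<open>t\<close>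
      already occurs at \<open>d1\<close>. This brings the total for the last two edges down to 3 +
      3 + 2 = 8.\<close>
    then have "c0 ` blocked p0 M0 x1 y \<subseteq> ?S1" using bl0[of x1 y] t(1) by (meson insert_subset order_trans)
    with 1 have "c1 ` blocked p1 (M0 \<union> F) x1 y \<subseteq> ?S1 \<union> c1 ` F" by (meson Un_mono order_refl order_trans)
    then have "card (c1 ` blocked p1 (M0 \<union> F) x1 y) \<le> card (?S1 \<union> c1 ` F)"
      using fs finF by (intro card_mono) auto
    also have "\<dots> \<le> card ?S1 + card (c1 ` F)" by (rule card_Un_le)
    also have "\<dots> \<le> 3 + 3"
      using card_c_star[of c ?A d1] card_image_le[OF finF(1), of c1] cF by (intro add_mono) auto
    finally show ?thesis by simp
  qed
  have notF: "{x1, a} \<notin> F" "{x1, b} \<notin> F" unfolding F_def using N(3-6) ne by (auto simp: doubleton_eq_iff)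
  have "\<exists>c' p'. valid c' p' (M0 \<union> F \<union> G) \<and> (\<forall>f\<in>M0 \<union> F. c' f = c1 f \<and> p' f = p1 f)"
  proof (rule greedy_extension[OF v1 _ finF(2)])
    show "finite (M0 \<union> F)" using finF by simp
    fix e assume e: "e \<in> G"
    have "card (c1 ` blocked p1 (M0 \<union> F) x1 (ot e)) \<le> 6" by (rule c1) (simp add: ot_def)
    with cF show "card (c1 ` blocked p1 (M0 \<union> F) x1 (ot e)) + card G \<le> 8" by linarith
    show "e = {x1, ot e} \<and> ot e \<in> N x1 \<and> e \<notin> M0 \<union> F"
      using e aN notM0 notF unfolding G_def by (elim insertE) (simp_all add: po)
  qed
  moreover have "E V \<subseteq> M0 \<union> F \<union> G"
  proof
    fix f assume "f \<in> E V"
    have all: "{a, x1} \<in> G" "{a, x2} \<in> M0" "{a, x3} \<in> F" "{b, x1} \<in> G" "{b, x2} \<in> F" "{b, x3} \<in> F"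
      by (simp_all add: G_def M0_def F_def e0_def insert_commute)
    have inner: "{s, r} \<in> M0 \<union> F \<union> G" if s: "s \<in> {a, b}" and r: "r \<in> N s" for s r
    proof (cases "s = a")
      case True
      with r N(1) have "r = x1 \<or> r = x2 \<or> r = x3" by simp
      with True all show ?thesis by (elim disjE) (simp_all only: Un_iff simp_thms)
    next
      case False
      with s have "s = b" by simp
      with r N(2) have "r = x1 \<or> r = x2 \<or> r = x3" by simp
      with \<open>s = b\<close> all show ?thesis by (elim disjE) (simp_all only: Un_iff simp_thms)
    qed
    from \<open>f \<in> E V\<close> obtain u w where f: "f = {u, w}" "u \<in> V" "w \<in> V" "w \<in> N u" "u \<in> N w" by (rule E_elim)
    show "f \<in> M0 \<union> F \<union> G"
    proof (cases "u \<in> {a, b} \<or> w \<in> {a, b}")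
      case True
      then show ?thesis
      proof
        assume "u \<in> {a, b}"
        then show ?thesis unfolding f(1) by (rule inner[OF _ f(4)])
      next
        assume "w \<in> {a, b}"
        then have "{w, u} \<in> M0 \<union> F \<union> G" by (rule inner[OF _ f(5)])
        moreover have "{w, u} = {u, w}" by (rule insert_commute)
        ultimately show ?thesis unfolding f(1) by (simp only:)
      qed
    next
      case False
      then have "{u, w} \<in> E ?A" using f by (simp add: E_iff)
      then show ?thesis unfolding f(1) M0_def by simp
    qed
  qed
  ultimately show ?thesis by (meson valid_subset)
qed

text \<open>The edge from \<open>x1\<close> to \<open>d1\<close> is coloured last among the pendant
  ones. It has two possible colours, and at most one makes the colour sets at \<open>d1\<close> and
  \<open>d2\<close> equal; since \<open>d1 \<noteq> d2\<close>, the choice does not change the set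
  at \<open>d2\<close>. Sets that differ supply a \<open>t\<close>, possibly with \<open>x1\<close>
  and \<open>x2\<close> exchanged.\<close>

lemma twins_colourable:
  assumes N: "N a = {x1, x2, x3}" "N b = {x1, x2, x3}" "a \<noteq> b" "x1 \<noteq> x2" "x1 \<noteq> x3" "x2 \<noteq> x3"
    and x: "N x1 = {a, b, d1}" "N x2 = {a, b, d2}" "N x3 = {a, b, d3}"
    and d: "d1 \<notin> {a, b, x1, x2, x3}" "d2 \<notin> {a, b, x1, x2, x3}" "d3 \<notin> {a, b, x1, x2, x3}" "d1 \<noteq> d2"
    and sp: "sparse (V - {a, b, x1, x2, x3})"
  shows "\<exists>c p. valid c p (E V)"
proof -
  let ?B = "V - {a, b, x1, x2, x3}"
  have ne: "a \<noteq> x1" "a \<noteq> x2" "a \<noteq> x3" "b \<noteq> x1" "b \<noteq> x2" "b \<noteq> x3"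
    using N N_irrefl[of a] N_irrefl[of b] by auto
  have inV: "x1 \<in> V" "x2 \<in> V" "x3 \<in> V" "d1 \<in> V" "d2 \<in> V" "d3 \<in> V"
    using N(1) x N_V[of a] N_V[of x1] N_V[of x2] N_V[of x3] by auto
  obtain c0 p0 where v0: "valid c0 p0 (E ?B)"
    using sparse_colourings(1)[OF sp] by (auto simp: colourable_def good_def)
  have K0: "\<And>w. w \<notin> ?B \<Longrightarrow> K p0 (E ?B) w = {}" using K_out[OF v0] .
  have s3: "x3 \<notin> ?B" "N x3 \<inter> ?B = {d3}" "d3 \<in> ?B" using x d inV by auto
  obtain c3 p3 where v3: "valid c3 p3 (E (insert x3 ?B))" and
    K3: "\<And>w. w \<notin> ?B \<Longrightarrow> K p3 (E (insert x3 ?B)) w = {}"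
    using pendant[OF v0 s3(1,2) K0 s3(3)] by metis
  let ?C = "V - {a, b, x1}"
  have C: "insert x2 (insert x3 ?B) = ?C" using inV ne N(4-6) by auto
  have s2: "x2 \<notin> insert x3 ?B" "N x2 \<inter> insert x3 ?B = {d2}" "d2 \<in> ?B" using x d inV ne N(4-6) by auto
  obtain c p where v: "valid c p (E ?C)" and K: "\<And>w. w \<notin> ?B \<Longrightarrow> K p (E ?C) w = {}"
    using pendant[OF v3 s2(1,2) K3 s2(3)] unfolding C by metis
  let ?A = "V - {a, b}"
  have A: "insert x1 ?C = ?A" using inV ne by auto
  have s1: "x1 \<notin> ?C" "N x1 \<inter> ?C = {d1}" "d1 \<in> ?C" "d1 \<in> ?B" "x1 \<in> N d1" using x d inV N_sym[of d1 x1] by auto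
  have new: "{d1, x1} \<notin> E ?C" by (simp add: E_iff)
  have EA: "E ?A = insert {d1, x1} (E ?C)" using E_insert[OF s1(1)] s1(2) A by simp
  have "blocked p (E ?C) d1 x1 = near (E ?C) d1"
    using K_sub_near[OF v, of d1] priv_nbr[OF v, of x1] s1(2) by (auto simp: blocked_def)
  moreover have "deg ?C d1 \<le> 2" using deg_insert[OF s1(1), of d1] deg_le3[of "insert x1 ?C" d1] s1 N_sym[of x1 d1] by simp
  ultimately have b6: "card (blocked p (E ?C) d1 x1) \<le> 6" using card_near_le[OF s1(3)] by simp
  let ?bl = "c ` blocked p (E ?C) d1 x1" and ?T = "c ` star (E ?C) d2" and ?D = "c ` star (E ?C) d1"
  have finb: "finite ?bl" by (simp add: blocked_def)
  have "card ?bl \<le> 6" using card_image_le[of "blocked p (E ?C) d1 x1" c] b6 by (simp add: blocked_def)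
  have D_bl: "?D \<subseteq> ?bl" by (auto simp: star_def blocked_def near_def ball_def)
  obtain k where k: "k < 8" "k \<notin> ?bl" "insert k ?D \<noteq> ?T"
  proof -
    obtain k1 where k1: "k1 < 8" "k1 \<notin> id ` ?bl" using ex_colour[of ?bl id] finb \<open>card ?bl \<le> 6\<close> by auto
    have "card (insert k1 ?bl) \<le> 7" using finb \<open>card ?bl \<le> 6\<close> by (simp add: card_insert_if)
    then obtain k2 where k2: "k2 < 8" "k2 \<notin> id ` insert k1 ?bl" using ex_colour[of "insert k1 ?bl" id] finb by auto
    have kD: "k1 \<notin> ?D" "k2 \<noteq> k1" using k1(2) k2(2) D_bl by auto
    have "insert k1 ?D \<noteq> ?T \<or> insert k2 ?D \<noteq> ?T"
    proof (rule ccontr)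
      assume "\<not> ?thesis"
      then have "insert k1 ?D = insert k2 ?D" by simp
      then have "k1 \<in> insert k2 ?D" by (metis insertI1)
      with kD show False by simp
    qed
    then show thesis using that k1 k2 by auto
  qed
  have v': "valid (c({d1, x1} := k)) (p({d1, x1} := d1)) (E ?A)"
    unfolding EA by (rule add_edge[OF v s1(5) new k(1,2)])
  let ?c = "c({d1, x1} := k)" and ?p = "p({d1, x1} := d1)"
  have st1: "?c ` star (E ?A) d1 = insert k ?D"
    using new unfolding EA star_def by (auto simp: image_iff)
  have "d2 \<notin> {d1, x1}" using d by auto
  then have st2: "?c ` star (E ?A) d2 = ?T"
    using new unfolding EA star_def by (auto simp: image_iff)
  have KA: "K ?p (E ?A) w = {}" if "w \<in> {x1, x2, x3}" for w
  proof -
    have "K p (E ?C) w = {}" using that by (intro K) auto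
    moreover have "w \<noteq> d1" using that d by auto
    ultimately show ?thesis unfolding EA K_def by auto
  qed
  have NA: "N x1 \<inter> ?A = {d1}" "N x2 \<inter> ?A = {d2}" "N x3 \<inter> ?A = {d3}" using x d inV by auto
  have "?c ` star (E ?A) d1 \<noteq> ?c ` star (E ?A) d2" unfolding st1 st2 by (rule k(3))
  then consider t where "t \<in> ?c ` star (E ?A) d1" "t \<notin> ?c ` star (E ?A) d2"
    | t where "t \<in> ?c ` star (E ?A) d2" "t \<notin> ?c ` star (E ?A) d1" by blast
  then show ?thesis
  proof cases
    case 1
    show ?thesis by (rule twins_finish[OF N v' NA _ 1]) (use KA N(1) in auto)
  next
    case 2
    have N': "N a = {x2, x1, x3}" "N b = {x2, x1, x3}" using N by auto
    show ?thesis
      by (rule twins_finish[OF N' N(3) N(4)[symmetric] N(6,5) v' NA(2,1,3) _ 2]) (use KA N(1) in auto)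
  qed
qed

section \<open>Simple graphs\<close>

definition K33 :: bool where
  "K33 \<longleftrightarrow> (\<exists>X Y. card X = 3 \<and> card Y = 3 \<and> X \<inter> Y = {} \<and> V = X \<union> Y \<and>
     (\<forall>x\<in>X. N x = Y) \<and> (\<forall>y\<in>Y. N y = X))"

lemma third_nbr:
  assumes "card (N x) = 3" "a \<in> N x" "b \<in> N x" "a \<noteq> b"
  obtains d where "N x = {a, b, d}" "d \<noteq> a" "d \<noteq> b" "d \<noteq> x"
proof -
  have "card (N x - {a, b}) = 1" using assms by (simp add: card_Diff_subset)
  then obtain d where d: "N x - {a, b} = {d}" by (rule card_1_singletonE)
  moreover from this have "d \<in> N x" by auto
  then have "d \<noteq> x" using N_irrefl[of x] by auto
  ultimately show ?thesis using that[of d] assms by auto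
qed

theorem simple_colourable:
  assumes "V \<noteq> {}"
    and conn: "\<And>B. B \<subseteq> V \<Longrightarrow> B \<noteq> {} \<Longrightarrow> B \<noteq> V \<Longrightarrow> \<exists>x\<in>B. \<exists>y\<in>N x. y \<notin> B"
    and not_K33: "\<not> K33"
  shows "\<exists>c p. valid c p (E V)"
proof -
  have low: "\<exists>v\<in>B. deg B v \<le> 2" if B: "B \<subseteq> V" "B \<noteq> {}" "B \<noteq> V" for B
  proof -
    obtain x y where xy: "x \<in> B" "y \<in> N x" "y \<notin> B" using conn[OF B] by blast
    have "deg B x \<le> card (N x - {y})" unfolding deg_def using xy by (intro card_mono) auto
    then show ?thesis using xy N_le3[of x] by (intro bexI[of _ x]) simp_all
  qed
  have sparse_proper: "sparse (V - A)" if "u \<in> A" "u \<in> V" for A u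
    unfolding sparse_def using low that by blast
  show ?thesis
  proof (cases "\<forall>v\<in>V. card (N v) = 3")
    case False
    then obtain v where v: "v \<in> V" "card (N v) \<noteq> 3" by blast
    have "deg V v \<le> card (N v)" unfolding deg_def by (intro card_mono) auto
    then have v2: "deg V v \<le> 2" using N_le3[of v] v(2) by linarith
    have "\<exists>v\<in>B. deg B v \<le> 2" if "B \<subseteq> V" "B \<noteq> {}" for B
      using low[OF that] v(1) v2 by (cases "B = V") auto
    then have "sparse V" unfolding sparse_def by simp
    then show ?thesis using sparse_colourings(1) unfolding colourable_def good_def by blast
  next
    case True
    then have cubic: "card (N v) = 3" if "v \<in> V" for v using that by blast
    have all_V: "B = V" if "B \<subseteq> V" "B \<noteq> {}" "\<And>x. x \<in> B \<Longrightarrow> N x \<subseteq> B" for B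
      using conn[of B] that by blast
    show ?thesis
    proof (cases "\<exists>a b. b \<in> N a \<and> N a - {b} = N b - {a}")
      case True
      then obtain a b where ab: "b \<in> N a" "N a - {b} = N b - {a}" by blast
      have a: "a \<in> N b" "a \<in> V" "b \<in> V" using N_sym[OF ab(1)] N_V[of a] N_V[of b] ab(1) by auto
      have "card (N a - {b}) = 2" using cubic[OF a(2)] ab(1) by simp
      then obtain x1 x2 where x: "N a - {b} = {x1, x2}" "x1 \<noteq> x2" unfolding card_2_iff by blast
      then have N: "N a = {b, x1, x2}" "N b = {a, x1, x2}" using ab a(1) by auto
      have ne: "a \<noteq> b" using N_irrefl[of a] ab(1) by auto
      have xV: "x1 \<in> V" "x2 \<in> V" using N(1) N_V[of a] by auto
      have xab: "a \<in> N x1" "b \<in> N x1" "a \<in> N x2" "b \<in> N x2"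
        using N N_sym[of x1 a] N_sym[of x1 b] N_sym[of x2 a] N_sym[of x2 b] by auto
      obtain d1 where d1: "N x1 = {a, b, d1}" "d1 \<noteq> a" "d1 \<noteq> b" "d1 \<noteq> x1"
        by (rule third_nbr[OF cubic[OF xV(1)] xab(1,2) ne])
      obtain d2 where d2: "N x2 = {a, b, d2}" "d2 \<noteq> a" "d2 \<noteq> b" "d2 \<noteq> x2"
        by (rule third_nbr[OF cubic[OF xV(2)] xab(3,4) ne])
      have xne: "x1 \<notin> {a, b}" "x2 \<notin> {a, b}" using N N_irrefl[of a] N_irrefl[of b] by auto
      show ?thesis
      proof (cases "d1 = x2")
        case True
        then have "x1 \<in> N x2" using d1(1) N_sym[of x2 x1] by simp
        then have d2x: "d2 = x1" using d2(1) xne by auto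
        \<comment> \<open>This is the complete graph on four vertices, which has few enough edges
          for distinct colours.\<close>
        have "{a, b, x1, x2} = V"
          by (rule all_V) (use a xV N d1(1) d2(1) True d2x in auto)
        then have V: "V = {a, b, x1, x2}" by simp
        have "E V \<subseteq> star (E V) a \<union> star (E V) b \<union> {{x1, x2}}"
        proof
          fix f assume f: "f \<in> E V"
          then obtain u w where uw: "f = {u, w}" "u \<in> V" "w \<in> V" "u \<noteq> w" by (rule E_elim)
          show "f \<in> star (E V) a \<union> star (E V) b \<union> {{x1, x2}}"
          proof (cases "a \<in> f \<or> b \<in> f")
            case True
            then show ?thesis using f by (auto simp: star_def)
          next
            case False
            then have "u \<in> {x1, x2}" "w \<in> {x1, x2}" using uw V by auto
            then have "f = {x1, x2}" using uw(1,4) by auto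
            then show ?thesis by simp
          qed
        qed
        then have "card (E V) \<le> card (star (E V) a \<union> star (E V) b \<union> {{x1, x2}})"
          by (intro card_mono) (auto simp: star_def)
        also have "\<dots> \<le> card (star (E V) a) + card (star (E V) b) + card {{x1, x2}}"
          using card_Un_le[of "star (E V) a \<union> star (E V) b" "{{x1, x2}}"]
            card_Un_le[of "star (E V) a" "star (E V) b"] by linarith
        also have "\<dots> \<le> 8" using card_star[of V a] card_star[of V b] deg_le3[of V a] deg_le3[of V b] by simp
        finally show ?thesis by (rule few_edges)
      next
        case False
        have "d2 \<noteq> x1"
        proof
          assume "d2 = x1"
          then have "x2 \<in> N x1" using d2(1) N_sym[of x1 x2] by simp
          with d1(1) xne False show False by auto
        qed
        then show ?thesis
          using d1(2-4) d2(2-4) False sparse_proper[of a "{a, b, x1, x2}"] a(2)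
          by (intro diamond_colourable[OF N d1(1) d2(1) _ _ x(2)]) auto
      qed
    next
      case False
      then have no_diamond: "N a - {b} \<noteq> N b - {a}" if "b \<in> N a" for a b using that by blast
      show ?thesis
      proof (cases "\<exists>a b. a \<in> V \<and> a \<noteq> b \<and> N a = N b")
        case False
        then have no_twins: "N a \<noteq> N b" if "a \<in> V" "a \<noteq> b" for a b using that by blast
        show ?thesis
        proof (rule twin_free_colourable[OF assms(1)])
          show "card (N v) = 3" if "v \<in> V" for v by (rule cubic[OF that])
          show "\<exists>x\<in>B. \<exists>y\<in>N x. y \<notin> B" if "B \<subseteq> V" "B \<noteq> {}" "B \<noteq> V" for B by (rule conn[OF that])
          show "N a - {b} \<noteq> N b - {a}" if "b \<in> N a" for a b by (rule no_diamond[OF that])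
          show "N a \<noteq> N b" if "a \<in> V" "a \<noteq> b" for a b by (rule no_twins[OF that])
        qed
      next
        case True
        then obtain a b where a: "a \<in> V" and ne: "a \<noteq> b" and ab: "N a = N b" by blast
        obtain x1 x2 x3 where N: "N a = {x1, x2, x3}" "x1 \<noteq> x2" "x1 \<noteq> x3" "x2 \<noteq> x3"
          using cubic[OF a] unfolding card_3_iff by metis
        have Nb: "N b = {x1, x2, x3}" using N(1) ab by simp
        have third: "\<exists>d. N x = {a, b, d} \<and> d \<notin> {a, b, x1, x2, x3}" if x: "x \<in> {x1, x2, x3}" for x
        proof -
          have xab: "x \<in> V" "a \<in> N x" "b \<in> N x"
            using x N(1) Nb N_V[of a] N_sym[of x a] N_sym[of x b] by auto
          obtain d where d: "N x = {a, b, d}" "d \<noteq> a" "d \<noteq> b" "d \<noteq> x"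
            by (rule third_nbr[OF cubic[OF xab(1)] xab(2,3) ne])
          \<comment> \<open>Two adjacent vertices among these three would share \<open>a\<close> and
            \<open>b\<close> as well and have the same closed neighbourhood, a case already
            settled.\<close>
          have "d \<notin> {x1, x2, x3}"
          proof
            assume dx: "d \<in> {x1, x2, x3}"
            then have dab: "d \<in> V" "a \<in> N d" "b \<in> N d"
              using N(1) Nb N_V[of a] N_sym[of d a] N_sym[of d b] by auto
            obtain z where z: "N d = {a, b, z}" "z \<noteq> a" "z \<noteq> b" "z \<noteq> d"
              by (rule third_nbr[OF cubic[OF dab(1)] dab(2,3) ne])
            have "x \<noteq> a" "x \<noteq> b" using x N(1) Nb N_irrefl[of a] N_irrefl[of b] by auto
            moreover have "x \<in> N d" using d(1) N_sym[of d x] by simp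
            ultimately have "z = x" using z(1) by auto
            then have "N x - {d} = N d - {x}" using d z by auto
            moreover have "d \<in> N x" using d(1) by simp
            ultimately show False using no_diamond by blast
          qed
          with d show ?thesis by auto
        qed
        obtain d1 where d1: "N x1 = {a, b, d1}" "d1 \<notin> {a, b, x1, x2, x3}" using third[of x1] by auto
        obtain d2 where d2: "N x2 = {a, b, d2}" "d2 \<notin> {a, b, x1, x2, x3}" using third[of x2] by auto
        obtain d3 where d3: "N x3 = {a, b, d3}" "d3 \<notin> {a, b, x1, x2, x3}" using third[of x3] by auto
        have sp: "sparse (V - {a, b, x1, x2, x3})" by (rule sparse_proper[OF _ a]) simp
        \<comment> \<open>Relabelling makes the first two outer neighbours differ whenever possible.
          If all three agree, the six vertices are closed under adjacency and form
          \<open>K33\<close>.\<close>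
        consider "d1 \<noteq> d2" | "d1 \<noteq> d3" | "d1 = d2" "d1 = d3" by blast
        then show ?thesis
        proof cases
          case 1
          then show ?thesis
            by (rule twins_colourable[OF N(1) Nb ne N(2-4) d1(1) d2(1) d3(1) d1(2) d2(2) d3(2) _ sp])
        next
          case 2
          have eq: "{x1, x2, x3} = {x1, x3, x2}" "{a, b, x1, x2, x3} = {a, b, x1, x3, x2}" by auto
          show ?thesis
            by (rule twins_colourable[OF N(1)[unfolded eq] Nb[unfolded eq] ne N(3,2) N(4)[symmetric]
                d1(1) d3(1) d2(1) d1(2)[unfolded eq] d3(2)[unfolded eq] d2(2)[unfolded eq] 2 sp[unfolded eq]])
        next
          case 3
          have bV: "b \<in> V" "x1 \<in> V" "x2 \<in> V" "x3 \<in> V" "d1 \<in> V"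
            using N(1) d1(1) N_V[of a] N_V[of x1] by auto
          have "{x1, x2, x3} \<subseteq> N d1"
            using d1(1) d2(1) d3(1) 3 N_sym[of d1 x1] N_sym[of d1 x2] N_sym[of d1 x3] by auto
          then have Nd: "N d1 = {x1, x2, x3}"
            using cubic[OF bV(5)] N(2-4) by (intro card_subset_eq[symmetric]) auto
          have cl: "N x \<subseteq> {a, b, d1} \<union> {x1, x2, x3}" if "x \<in> {a, b, d1} \<union> {x1, x2, x3}" for x
            using that N(1) Nb Nd d1(1) d2(1) d3(1) 3 by auto
          have "{a, b, d1} \<union> {x1, x2, x3} = V"
            by (rule all_V[OF _ _ cl]) (use a bV in auto)
          moreover have "{a, b, d1} \<inter> {x1, x2, x3} = {}"
            using N(1) Nb N_irrefl[of a] N_irrefl[of b] d1(2) by auto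
          moreover have "card {a, b, d1} = 3" "card {x1, x2, x3} = 3" using ne d1(2) N(2-4) by auto
          moreover have "\<forall>x\<in>{a, b, d1}. N x = {x1, x2, x3}" using N(1) Nb Nd by simp
          moreover have "\<forall>x\<in>{x1, x2, x3}. N x = {a, b, d1}" using d1(1) d2(1) d3(1) 3 by simp
          ultimately have K33 unfolding K33_def by metis
          with not_K33 show ?thesis by simp
        qed
      qed
    qed
  qed
qed

end

section \<open>Parallel edges\<close>

locale subcubic_multigraph =
  fixes G :: "('a, 'e) multigraph"
  assumes fin: "finite_loopless G" and conn: "connected_graph G" and max3: "max_degree G = 3"
begin

section \<open>The underlying simple graph and its representing edges\<close>

definition nbrs :: "'a \<Rightarrow> 'a set" where
  "nbrs x = {y. adjacent G x y}"

definition inc :: "'e set \<Rightarrow> 'a \<Rightarrow> 'e set" where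
  "inc M x = {e \<in> M. x \<in> endverts G e}"

lemma finite_edges [simp]: "finite (edges G)"
  using fin by (simp add: finite_loopless_def)

lemma endverts_V: "e \<in> edges G \<Longrightarrow> endverts G e \<subseteq> verts G"
  using fin by (simp add: finite_loopless_def)

lemma endverts_obtain:
  assumes "e \<in> edges G"
  obtains x y where "endverts G e = {x, y}" "x \<noteq> y"
proof -
  have "card (endverts G e) = 2" using fin assms by (simp add: finite_loopless_def)
  then show ?thesis using that unfolding card_2_iff by blast
qed

lemma card_inc: "card (inc (edges G) x) \<le> 3"
proof (cases "x \<in> verts G")
  case True
  have "finite (verts G)" using fin by (simp add: finite_loopless_def)
  then have "vertex_degree G x \<le> max_degree G" using True unfolding max_degree_def by (intro Max_ge) auto
  with max3 show ?thesis by (simp add: vertex_degree_def inc_def)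
next
  case False
  then have "inc (edges G) x = {}" using endverts_V by (auto simp: inc_def)
  then show ?thesis by simp
qed

lemma finite_inc: "M \<subseteq> edges G \<Longrightarrow> finite (inc M x)"
  using finite_subset[of "inc M x" "edges G"] by (auto simp: inc_def)

lemma card_inc_mono: "M \<subseteq> edges G \<Longrightarrow> card (inc M x) \<le> 3"
  using card_mono[of "inc (edges G) x" "inc M x"] card_inc[of x] finite_inc[of "edges G" x]
  by (fastforce simp: inc_def)

lemma nbrs_iff: "y \<in> nbrs x \<longleftrightarrow> (\<exists>e\<in>edges G. endverts G e = {x, y})"
  by (simp add: nbrs_def adjacent_def)

definition rep :: "'a set \<Rightarrow> 'e" where
  "rep s = (SOME e. e \<in> edges G \<and> endverts G e = s)"

lemma rep: "y \<in> nbrs x \<Longrightarrow> rep {x, y} \<in> edges G \<and> endverts G (rep {x, y}) = {x, y}"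
  unfolding rep_def by (rule someI_ex) (auto simp: nbrs_iff)

lemma nbrs_card:
  assumes "M \<subseteq> edges G" "\<And>y. y \<in> nbrs x \<Longrightarrow> rep {x, y} \<in> M"
  shows "card (nbrs x) \<le> card (inc M x)"
proof (rule card_inj_on_le)
  show "inj_on (\<lambda>y. rep {x, y}) (nbrs x)"
  proof (rule inj_onI)
    fix y z assume "y \<in> nbrs x" "z \<in> nbrs x" "rep {x, y} = rep {x, z}"
    then have "{x, y} = {x, z}" using rep by metis
    then show "y = z" by (auto simp: doubleton_eq_iff)
  qed
  show "(\<lambda>y. rep {x, y}) ` nbrs x \<subseteq> inc M x" using rep assms(2) by (auto simp: inc_def)
  show "finite (inc M x)" by (rule finite_inc[OF assms(1)])
qed

sublocale S: subcubic "verts G" nbrs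
proof
  show "finite (verts G)" using fin by (simp add: finite_loopless_def)
  fix x y
  show "x \<in> nbrs y" if "y \<in> nbrs x" using that by (simp add: nbrs_iff insert_commute)
  show "x \<notin> nbrs x"
  proof
    assume "x \<in> nbrs x"
    then obtain e where "e \<in> edges G" "endverts G e = {x, x}" by (auto simp: nbrs_iff)
    then show False using fin by (auto simp: finite_loopless_def)
  qed
  show "nbrs x \<subseteq> verts G" using endverts_V by (fastforce simp: nbrs_iff)
  show "card (nbrs x) \<le> 3"
    using nbrs_card[of "edges G" x] rep card_inc[of x] by (meson order_refl order_trans)
qed

lemma escape:
  assumes "B \<subseteq> verts G" "B \<noteq> {}" "B \<noteq> verts G"
  shows "\<exists>x\<in>B. \<exists>y\<in>nbrs x. y \<notin> B"
proof (rule ccontr)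
  assume no: "\<not> ?thesis"
  obtain u v where uv: "u \<in> B" "v \<in> verts G" "v \<notin> B" using assms by blast
  then have "(adjacent G)\<^sup>*\<^sup>* u v" using conn assms(1) unfolding connected_graph_def by blast
  then have "v \<in> B"
  proof (induction rule: rtranclp_induct)
    case base
    then show ?case by (rule uv(1))
  next
    case (step y z)
    then show ?case using no by (auto simp: nbrs_def)
  qed
  with uv show False by simp
qed

text \<open>The representing edges to three distinct neighbours use up the whole degree of a vertex.
  This links \<open>K33\<close>, which speaks only of neighbourhoods, to an isomorphism of
  multigraphs.\<close>

lemma cubic_simple:
  assumes "\<And>x. x \<in> verts G \<Longrightarrow> card (nbrs x) = 3"
  shows "simple_graph G"
  unfolding simple_graph_def
proof (rule inj_onI)
  fix e f assume e: "e \<in> edges G" and f: "f \<in> edges G" and ef: "endverts G e = endverts G f"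
  obtain x y where xy: "endverts G e = {x, y}" by (rule endverts_obtain[OF e])
  have "x \<in> verts G" using endverts_V[OF e] xy by simp
  let ?r = "\<lambda>y. rep {x, y}"
  have inj: "inj_on ?r (nbrs x)"
  proof (rule inj_onI)
    fix y z assume "y \<in> nbrs x" "z \<in> nbrs x" "?r y = ?r z"
    then have "{x, y} = {x, z}" using rep by metis
    then show "y = z" by (auto simp: doubleton_eq_iff)
  qed
  have "?r ` nbrs x \<subseteq> inc (edges G) x" using rep by (auto simp: inc_def)
  moreover have "card (?r ` nbrs x) = 3" using assms[OF \<open>x \<in> verts G\<close>] card_image[OF inj] by simp
  ultimately have img: "?r ` nbrs x = inc (edges G) x"
    using card_inc[of x] finite_inc[of "edges G" x] by (intro card_seteq) auto
  have "e \<in> inc (edges G) x" "f \<in> inc (edges G) x" using e f xy ef by (auto simp: inc_def)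
  then obtain y1 y2 where y: "y1 \<in> nbrs x" "e = ?r y1" "y2 \<in> nbrs x" "f = ?r y2" unfolding img[symmetric] by auto
  then have "{x, y1} = {x, y2}" using rep[OF y(1)] rep[OF y(3)] ef by simp
  then have "y1 = y2" by (auto simp: doubleton_eq_iff)
  with y show "e = f" by simp
qed

lemma K33_isomorphic:
  assumes "S.K33"
  shows "isomorphic_graph G (complete_bipartite 3 3)"
proof -
  obtain X Y where A: "card X = 3 \<and> card Y = 3 \<and> X \<inter> Y = {} \<and> verts G = X \<union> Y \<and>
      (\<forall>x\<in>X. nbrs x = Y) \<and> (\<forall>y\<in>Y. nbrs y = X)"
    using assms unfolding S.K33_def by (elim exE)
  then have XY: "card X = 3" "card Y = 3" "X \<inter> Y = {}" "verts G = X \<union> Y" by simp_all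
  have NX: "nbrs x = Y" if "x \<in> X" for x using A that by simp
  have NY: "nbrs y = X" if "y \<in> Y" for y using A that by simp
  have "finite X" by (rule card_ge_0_finite) (simp add: XY)
  then obtain h where h: "bij_betw h X {..<3::nat}"
    using ex_bij_betw_finite_nat[of X] unfolding XY lessThan_atLeast0 by metis
  have "finite Y" by (rule card_ge_0_finite) (simp add: XY)
  then obtain k where k: "bij_betw k Y {..<3::nat}"
    using ex_bij_betw_finite_nat[of Y] unfolding XY lessThan_atLeast0 by metis
  have simple: "inj_on (endverts G) (edges G)"
  proof -
    have "card (nbrs x) = 3" if "x \<in> verts G" for x
    proof (cases "x \<in> X")
      case True
      then show ?thesis using NX XY(2) by simp
    next
      case False
      then have "x \<in> Y" using that XY(4) by simp
      then show ?thesis using NY XY(1) by simp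
    qed
    from cubic_simple[OF this] show ?thesis by (simp add: simple_graph_def)
  qed
  define f :: "'a \<Rightarrow> nat + nat" where "f x = (if x \<in> X then Inl (h x) else Inr (k x))" for x
  have fX: "f x = Inl (h x)" if "x \<in> X" for x using that by (simp add: f_def)
  have fY: "f y = Inr (k y)" if "y \<in> Y" for y using that XY(3) by (auto simp: f_def)
  have hX: "h ` X = {..<3}" "inj_on h X" and kY: "k ` Y = {..<3}" "inj_on k Y"
    using h k by (simp_all add: bij_betw_def)
  have "f ` X = (\<lambda>x. Inl (h x)) ` X" "f ` Y = (\<lambda>y. Inr (k y)) ` Y"
    using fX fY by (simp_all cong: image_cong_simp)
  then have imf: "f ` X = Inl ` h ` X" "f ` Y = Inr ` k ` Y"
    by (simp_all only: image_image)
  have "inj_on f X" "inj_on f Y" using hX(2) kY(2) by (auto simp: inj_on_def fX fY)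
  moreover have "f ` X \<inter> f ` Y = {}" unfolding imf by auto
  then have "f ` (X - Y) \<inter> f ` (Y - X) = {}" by blast
  ultimately have injf: "inj_on f (X \<union> Y)" unfolding inj_on_Un by simp
  have bf: "bij_betw f (verts G) (verts (complete_bipartite 3 3))"
    using injf imf[unfolded hX(1) kY(1)] XY(4) by (simp add: bij_betw_def complete_bipartite_def image_Un)
  have edge_XY: "\<exists>x\<in>X. \<exists>y\<in>Y. endverts G e = {x, y}" if e: "e \<in> edges G" for e
  proof -
    obtain x y where xy: "endverts G e = {x, y}" by (rule endverts_obtain[OF e])
    have n: "y \<in> nbrs x" using e xy unfolding nbrs_iff by (rule bexI[rotated])
    have xV: "x \<in> X \<union> Y" using xy endverts_V[OF e] unfolding XY(4) by simp
    show ?thesis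
    proof (cases "x \<in> X")
      case True
      moreover have "y \<in> Y" using n NX[OF True] by simp
      ultimately show ?thesis using xy by blast
    next
      case False
      then have "x \<in> Y" using xV by simp
      then have "y \<in> X" using n NY by simp
      moreover have "endverts G e = {y, x}" using xy by (simp add: insert_commute)
      ultimately show ?thesis using \<open>x \<in> Y\<close> by blast
    qed
  qed
  let ?g = "\<lambda>e. f ` endverts G e"
  have "inj_on ?g (edges G)"
  proof (rule inj_onI)
    fix e e' assume e: "e \<in> edges G" "e' \<in> edges G" "?g e = ?g e'"
    then have "endverts G e = endverts G e'"
      using inj_on_image_eq_iff[OF injf, of "endverts G e" "endverts G e'"]
        endverts_V[OF e(1)] endverts_V[OF e(2)] XY(4) by simp
    with simple e show "e = e'" by (auto simp: inj_on_def)
  qed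
  moreover have "?g ` edges G = edges (complete_bipartite 3 3)"
  proof (intro set_eqI iffI)
    fix s assume "s \<in> ?g ` edges G"
    then obtain e where e: "e \<in> edges G" "s = ?g e" by blast
    then obtain x y where "x \<in> X" "y \<in> Y" "endverts G e = {x, y}" using edge_XY by blast
    then have "s = {Inl (h x), Inr (k y)}" "h x < 3" "k y < 3"
      using e fX fY bij_betwE[OF h] bij_betwE[OF k] by auto
    then show "s \<in> edges (complete_bipartite 3 3)" by (auto simp: complete_bipartite_def)
  next
    fix s assume "s \<in> edges (complete_bipartite 3 3)"
    then obtain i j where ij: "s = {Inl i, Inr j}" "i < 3" "j < 3" by (auto simp: complete_bipartite_def)
    then have "i \<in> h ` X" "j \<in> k ` Y" using hX(1) kY(1) by simp_all
    then obtain x y where x: "x \<in> X" "i = h x" and y: "y \<in> Y" "j = k y" by blast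
    have "y \<in> nbrs x" using NX[OF x(1)] y(1) by simp
    then obtain e where e: "e \<in> edges G" "endverts G e = {x, y}" unfolding nbrs_iff by blast
    have "?g e = s" using e(2) ij(1) x y fX[OF x(1)] fY[OF y(1)] by simp
    with e(1) show "s \<in> ?g ` edges G" by blast
  qed
  ultimately have "bij_betw ?g (edges G) (edges (complete_bipartite 3 3))" by (simp add: bij_betw_def)
  with bf show ?thesis
    unfolding isomorphic_graph_def by (intro exI[of _ f] exI[of _ ?g]) (simp add: complete_bipartite_def)
qed

text \<open>The analogue of \<open>valid\<close> on edge names: parallel edges are distinct members
  of \<open>M\<close>, and the last clause forces them to have distinct colours.\<close>

definition mvalid :: "('e \<Rightarrow> nat) \<Rightarrow> ('e \<Rightarrow> 'a) \<Rightarrow> 'e set \<Rightarrow> bool" where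
  "mvalid c p M \<longleftrightarrow> (\<forall>e\<in>M. p e \<in> endverts G e \<and> c e < 8) \<and>
     (\<forall>e\<in>M. \<forall>f\<in>M. e \<noteq> f \<and> c e = c f \<longrightarrow> endverts G f \<inter> S.ball (p e) = {})"

definition reps :: "'e set" where
  "reps = rep ` S.E (verts G)"

lemma rep_edge:
  assumes "s \<in> S.E (verts G)"
  shows "rep s \<in> edges G" "endverts G (rep s) = s"
proof -
  obtain x y where "s = {x, y}" "y \<in> nbrs x" using assms by (rule S.E_elim)
  then show "rep s \<in> edges G" "endverts G (rep s) = s" using rep by simp_all
qed

lemma reps_nbr: "y \<in> nbrs x \<Longrightarrow> rep {x, y} \<in> reps"
  unfolding reps_def using S.N_V S.N_sym by (intro imageI) (auto simp: S.E_iff)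

lemma mvalid_reps:
  assumes "S.valid c p (S.E (verts G))"
  shows "mvalid (c \<circ> endverts G) (p \<circ> endverts G) reps"
proof -
  have r: "endverts G e \<in> S.E (verts G)" "rep (endverts G e) = e" if "e \<in> reps" for e
    using that rep_edge by (auto simp: reps_def)
  show ?thesis
    unfolding mvalid_def comp_def
  proof (intro conjI ballI impI)
    fix e assume "e \<in> reps"
    from r(1)[OF this] S.validD[OF assms]
    show "p (endverts G e) \<in> endverts G e" "c (endverts G e) < 8" by blast+
  next
    fix e f assume ef: "e \<in> reps" "f \<in> reps" "e \<noteq> f \<and> c (endverts G e) = c (endverts G f)"
    then have "endverts G e \<noteq> endverts G f" using r by metis
    then show "endverts G f \<inter> S.ball (p (endverts G e)) = {}"
      using ef r(1) assms unfolding S.valid_def by blast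
  qed
qed

text \<open>An edge parallel to a coloured edge sees at most seven coloured edges.\<close>

lemma parallel_edge:
  assumes v: "mvalid c p M" and M: "reps \<subseteq> M" "M \<subseteq> edges G" and e: "e \<in> edges G" "e \<notin> M"
  shows "\<exists>c p. mvalid c p (insert e M)"
proof -
  obtain x y where xy: "endverts G e = {x, y}" "x \<noteq> y" by (rule endverts_obtain[OF e(1)])
  have finM: "finite M" by (rule finite_subset[OF M(2) finite_edges])
  have yx: "y \<in> nbrs x" "x \<in> nbrs y" using e(1) xy by (auto simp: nbrs_iff insert_commute)
  have inc2: "card (inc M z) \<le> 2" if "z \<in> {x, y}" for z
  proof -
    have "e \<notin> inc M z" using e(2) by (simp add: inc_def)
    then have "card (insert e (inc M z)) = Suc (card (inc M z))"
      by (rule card_insert_disjoint[OF finite_inc[OF M(2)]])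
    moreover have "insert e (inc M z) \<subseteq> inc (edges G) z"
      using that M(2) e(1) xy(1) unfolding inc_def by blast
    then have "card (insert e (inc M z)) \<le> card (inc (edges G) z)"
      by (rule card_mono[OF finite_inc[OF order_refl]])
    ultimately have "Suc (card (inc M z)) \<le> card (inc (edges G) z)" by simp
    with card_inc[of z] show ?thesis by linarith
  qed
  have repM: "rep {w, z} \<in> M" if "z \<in> nbrs w" for z w using reps_nbr[OF that] M(1) by blast
  have n2: "card (nbrs z) \<le> 2" if "z \<in> {x, y}" for z
    using nbrs_card[OF M(2) repM, of z] inc2[OF that] by simp
  have other: "\<exists>b. nbrs z \<subseteq> {w, b} \<and> b \<in> nbrs z" if zw: "z \<in> {x, y}" "w \<in> nbrs z" for z w
  proof -
    have "card (nbrs z - {w}) \<le> Suc 0" using n2[OF zw(1)] zw(2) by simp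
    then have one: "u = v" if "u \<in> nbrs z - {w}" "v \<in> nbrs z - {w}" for u v
      using card_le_Suc0_iff_eq[of "nbrs z - {w}"] that by simp
    show ?thesis
    proof (cases "nbrs z - {w} = {}")
      case True
      with zw(2) show ?thesis by (intro exI[of _ w]) auto
    next
      case False
      then obtain b where b: "b \<in> nbrs z - {w}" by blast
      have "nbrs z \<subseteq> {w, b}"
      proof
        fix u assume "u \<in> nbrs z"
        then show "u \<in> {w, b}" using one[of u b] b by (cases "u = w") simp_all
      qed
      with b show ?thesis by blast
    qed
  qed
  obtain a where a: "nbrs x \<subseteq> {y, a}" using other[OF insertI1 yx(1)] by blast
  obtain b where b: "nbrs y \<subseteq> {x, b}" "b \<in> nbrs y" using other[OF insertI2[OF singletonI] yx(2)] by blast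
  let ?B = "{f \<in> M. endverts G f \<inter> S.ball x \<noteq> {}} \<union> {f \<in> M. p f \<in> nbrs y}"
  \<comment> \<open>The count is 2 + 3 + 2: the edges at \<open>y\<close> without \<open>e\<close>,
    those at the other neighbour \<open>a\<close> of \<open>x\<close>, and those at the other
    neighbour \<open>b\<close> of \<open>y\<close> that are not already at \<open>y\<close>. An edge
    with private end \<open>x\<close> belongs to the first two groups.\<close>
  have sub: "?B \<subseteq> inc M y \<union> inc M a \<union> (inc M b - inc M y)"
  proof
    fix f assume f: "f \<in> ?B"
    then have fM: "f \<in> M" by (elim UnE) simp_all
    have at_x: "f \<in> inc M y \<union> inc M a" if "endverts G f \<inter> S.ball x \<noteq> {}"
    proof -
      have fE: "f \<in> edges G" using M(2) fM by (rule subsetD)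
      obtain u w where uw: "endverts G f = {u, w}" "u \<noteq> w" by (rule endverts_obtain[OF fE])
      have wu: "w \<in> nbrs u" unfolding nbrs_iff using fE uw(1) by (rule bexI[rotated])
      then have uw': "u \<in> nbrs w" by (rule S.N_sym)
      have "u \<in> S.ball x \<or> w \<in> S.ball x" using that uw(1) by auto
      then have "u \<in> nbrs x \<or> w \<in> nbrs x" using wu uw' unfolding S.ball_def by auto
      then have "u \<in> {y, a} \<or> w \<in> {y, a}" using a by auto
      then show ?thesis using uw(1) fM unfolding inc_def by auto
    qed
    show "f \<in> inc M y \<union> inc M a \<union> (inc M b - inc M y)"
    proof (cases "endverts G f \<inter> S.ball x \<noteq> {}")
      case True
      then show ?thesis using at_x by blast
    next
      case False
      then have "p f \<in> nbrs y" using f by blast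
      moreover have "p f \<in> endverts G f" using v fM by (simp add: mvalid_def)
      moreover have "x \<notin> endverts G f" using False by (auto simp: S.ball_def)
      ultimately have "b \<in> endverts G f" using b(1) by auto
      then show ?thesis using fM by (auto simp: inc_def)
    qed
  qed
  have "card (inc M b - inc M y) \<le> 2"
  proof -
    have "rep {y, b} \<in> inc M b \<inter> inc M y"
      using rep[OF b(2)] repM[OF b(2)] by (simp add: inc_def)
    then have "card (inc M b - inc M y) < card (inc M b)"
      using finite_inc[OF M(2), of b] by (intro psubset_card_mono) auto
    with card_inc_mono[OF M(2), of b] show ?thesis by linarith
  qed
  moreover have "card (inc M y \<union> inc M a \<union> (inc M b - inc M y)) \<le>
      card (inc M y) + card (inc M a) + card (inc M b - inc M y)"
    using card_Un_le[of "inc M y \<union> inc M a" "inc M b - inc M y"] card_Un_le[of "inc M y" "inc M a"] by linarith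
  moreover have "card ?B \<le> card (inc M y \<union> inc M a \<union> (inc M b - inc M y))"
    using finite_inc[OF M(2)] by (intro card_mono sub) auto
  ultimately have "card ?B \<le> 7" using inc2[of y] card_inc_mono[OF M(2), of a] by simp
  moreover have "finite ?B" using finM by simp
  ultimately obtain k where k: "k < 8" "k \<notin> c ` ?B" using S.ex_colour[of ?B c] by blast
  have "mvalid (c(e := k)) (p(e := x)) (insert e M)"
    unfolding mvalid_def
  proof (intro conjI ballI impI)
    fix f assume "f \<in> insert e M"
    then show "(p(e := x)) f \<in> endverts G f" "(c(e := k)) f < 8"
      using v k(1) xy by (auto simp: mvalid_def)
  next
    fix f h assume f: "f \<in> insert e M" and h: "h \<in> insert e M"
      and fh: "f \<noteq> h \<and> (c(e := k)) f = (c(e := k)) h"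
    consider "f = e" "h \<in> M" "h \<noteq> e" | "h = e" "f \<in> M" "f \<noteq> e" | "f \<in> M" "h \<in> M" "f \<noteq> e" "h \<noteq> e"
      using f h fh e(2) by fastforce
    then show "endverts G h \<inter> S.ball ((p(e := x)) f) = {}"
    proof cases
      case 1
      then have "c h = k" using fh by simp
      then have "h \<notin> ?B" using k(2) by blast
      then show ?thesis using 1 by simp
    next
      case 2
      then have "c f = k" using fh by simp
      then have "f \<notin> ?B" using k(2) by blast
      then have *: "endverts G f \<inter> S.ball x = {}" "p f \<notin> nbrs y" using 2 by auto
      moreover have "p f \<in> endverts G f" using v 2 by (simp add: mvalid_def)
      ultimately have "p f \<notin> S.ball x" by blast
      then have "p f \<noteq> x" "p f \<noteq> y" "x \<notin> nbrs (p f)" "y \<notin> nbrs (p f)"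
        using yx S.N_sym[of x "p f"] S.N_sym[of y "p f"] *(2) by (auto simp: S.ball_def)
      then show ?thesis using 2 xy by (auto simp: S.ball_def)
    next
      case 3
      then show ?thesis using v fh by (simp add: mvalid_def)
    qed
  qed
  then show ?thesis by blast
qed

lemma all_edges:
  assumes "mvalid c p reps"
  shows "\<exists>c p. mvalid c p (edges G)"
proof -
  have "reps \<subseteq> edges G" using rep_edge by (auto simp: reps_def)
  have "\<exists>c p. mvalid c p (reps \<union> T)" if "finite T" "T \<subseteq> edges G" for T
    using that
  proof (induction T rule: finite_induct)
    case empty
    then show ?case using assms by auto
  next
    case (insert e T)
    then obtain c p where v: "mvalid c p (reps \<union> T)" by auto
    show ?case
    proof (cases "e \<in> reps \<union> T")
      case True
      then have "reps \<union> insert e T = reps \<union> T" by auto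
      with v show ?thesis by metis
    next
      case False
      then show ?thesis
        using parallel_edge[OF v] insert.prems \<open>reps \<subseteq> edges G\<close> by simp
    qed
  qed
  from this[of "edges G"] \<open>reps \<subseteq> edges G\<close> show ?thesis by (simp add: Un_absorb1)
qed

text \<open>Both ends of \<open>f\<close> lie in \<open>ball (p e)\<close> and are covered by the
  colour class, whose only member meeting this ball is \<open>e\<close>. So \<open>f\<close> is
  parallel to \<open>e\<close>, and \<open>p e\<close> is the end of degree one that a semistrong
  matching requires.\<close>

lemma mvalid_class:
  assumes v: "mvalid c p (edges G)" and e: "e \<in> color_class G c k"
    and f: "f \<in> edges G" "endverts G f \<subseteq> \<Union> (endverts G ` color_class G c k)" "p e \<in> endverts G f"
  shows "endverts G f = endverts G e"
proof -
  have eE: "e \<in> edges G" "c e = k" using e by (simp_all add: color_class_def)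
  then have pe: "p e \<in> endverts G e" using v by (simp add: mvalid_def)
  have "endverts G f \<subseteq> endverts G e"
  proof
    fix w assume w: "w \<in> endverts G f"
    then obtain h where h: "h \<in> color_class G c k" "w \<in> endverts G h" using f(2) by blast
    obtain u z where uz: "endverts G f = {u, z}" by (rule endverts_obtain[OF f(1)])
    then have "w \<in> S.ball (p e)" using w f(1,3) by (auto simp: S.ball_def nbrs_iff insert_commute)
    moreover have "endverts G h \<inter> S.ball (p e) = {}" if "h \<noteq> e"
    proof -
      have "h \<in> edges G" "e \<noteq> h \<and> c e = c h" using h(1) eE that by (auto simp: color_class_def)
      with v eE(1) show ?thesis by (simp add: mvalid_def)
    qed
    ultimately have "h = e" using h(2) by blast
    with h show "w \<in> endverts G e" by simp
  qed
  moreover have "card (endverts G f) = 2" "card (endverts G e) = 2"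
    using fin f(1) eE(1) by (simp_all add: finite_loopless_def)
  ultimately show ?thesis by (metis card.infinite card_subset_eq zero_neq_numeral)
qed

lemma mvalid_disjoint:
  assumes "mvalid c p (edges G)" "e \<in> edges G" "f \<in> edges G" "e \<noteq> f" "c e = c f"
  shows "endverts G e \<inter> endverts G f = {}"
proof -
  have disj: "endverts G f \<inter> S.ball (p e) = {}" "p e \<in> endverts G e" using assms by (auto simp: mvalid_def)
  obtain x y where "endverts G e = {x, y}" by (rule endverts_obtain[OF assms(2)])
  then have "endverts G e \<subseteq> S.ball (p e)"
    using disj(2) assms(2) by (auto simp: S.ball_def nbrs_iff insert_commute)
  with disj(1) show ?thesis by blast
qed

lemma semistrong:
  assumes v: "mvalid c p (edges G)"
  shows "semistrong_edge_coloring G c"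
proof -
  let ?U = "underlying_simple G"
  have "proper_edge_coloring G c"
    using mvalid_disjoint[OF v] unfolding proper_edge_coloring_def by blast
  moreover have "semistrong_matching G (color_class G c k)" if s: "simple_graph G" for k
    unfolding semistrong_matching_def
  proof (intro conjI ballI)
    show "matching G (color_class G c k)"
      using mvalid_disjoint[OF v] by (auto simp: matching_def color_class_def)
    fix e assume e: "e \<in> color_class G c k"
    then have eE: "e \<in> edges G" "p e \<in> endverts G e" using v by (auto simp: color_class_def mvalid_def)
    let ?I = "induced_subgraph G (covered_verts G (color_class G c k))"
    have "{f \<in> edges ?I. p e \<in> endverts ?I f} = {e}"
    proof (intro set_eqI iffI)
      fix f assume "f \<in> {f \<in> edges ?I. p e \<in> endverts ?I f}"
      then have f: "f \<in> edges G" "endverts G f \<subseteq> \<Union> (endverts G ` color_class G c k)" "p e \<in> endverts G f"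
        by (auto simp: induced_subgraph_def covered_verts_def)
      from mvalid_class[OF v e f] s f(1) eE(1) show "f \<in> {e}"
        by (auto simp: simple_graph_def inj_on_def)
    next
      fix f assume "f \<in> {e}"
      then show "f \<in> {f \<in> edges ?I. p e \<in> endverts ?I f}"
        using e eE by (auto simp: induced_subgraph_def covered_verts_def)
    qed
    then have "vertex_degree ?I (p e) = 1" by (simp add: vertex_degree_def)
    with eE(2) show "\<exists>w\<in>endverts G e. vertex_degree ?I w = 1" by blast
  qed
  moreover have "semistrong_matching ?U (endverts G ` color_class G c k)" for k
    unfolding semistrong_matching_def
  proof (intro conjI ballI)
    have "s \<inter> t = {}" if st: "s \<in> endverts G ` color_class G c k" "t \<in> endverts G ` color_class G c k" "s \<noteq> t" for s t
    proof -
      obtain e f where "e \<in> color_class G c k" "f \<in> color_class G c k" "s = endverts G e" "t = endverts G f"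
        using st(1,2) by blast
      with st(3) mvalid_disjoint[OF v, of e f] show ?thesis by (auto simp: color_class_def)
    qed
    then show "matching ?U (endverts G ` color_class G c k)"
      by (auto simp: matching_def color_class_def underlying_simple_def)
    fix s assume "s \<in> endverts G ` color_class G c k"
    then obtain e where e: "e \<in> color_class G c k" "s = endverts G e" by blast
    then have eE: "e \<in> edges G" "p e \<in> endverts G e" using v by (auto simp: color_class_def mvalid_def)
    let ?I = "induced_subgraph ?U (covered_verts ?U (endverts G ` color_class G c k))"
    have "{t \<in> edges ?I. p e \<in> endverts ?I t} = {s}"
    proof (intro set_eqI iffI)
      fix t assume t: "t \<in> {t \<in> edges ?I. p e \<in> endverts ?I t}"
      then obtain f where "f \<in> edges G" "t = endverts G f"
        by (auto simp: induced_subgraph_def underlying_simple_def)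
      moreover from this t have "endverts G f \<subseteq> \<Union> (endverts G ` color_class G c k)" "p e \<in> endverts G f"
        by (auto simp: induced_subgraph_def covered_verts_def underlying_simple_def)
      ultimately show "t \<in> {s}" using mvalid_class[OF v e(1)] e(2) by simp
    next
      fix t assume "t \<in> {s}"
      then show "t \<in> {t \<in> edges ?I. p e \<in> endverts ?I t}"
        using e eE by (auto simp: induced_subgraph_def covered_verts_def underlying_simple_def)
    qed
    then have "vertex_degree ?I (p e) = 1" by (simp add: vertex_degree_def)
    with eE(2) e(2) show "\<exists>w\<in>endverts ?U s. vertex_degree ?I w = 1"
      by (auto simp: underlying_simple_def)
  qed
  ultimately show ?thesis by (simp add: semistrong_edge_coloring_def)
qed

theorem index_le_8:
  assumes "\<not> isomorphic_graph G (complete_bipartite 3 3)"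
  shows "semistrong_chromatic_index G \<le> 8"
proof -
  have "verts G \<noteq> {}" using conn by (simp add: connected_graph_def)
  then obtain c p where "S.valid c p (S.E (verts G))"
    using S.simple_colourable[OF _ escape] assms K33_isomorphic by blast
  then obtain c p where v: "mvalid c p (edges G)" using all_edges[OF mvalid_reps] by blast
  have "c ` edges G \<subseteq> {..<8}" using v by (auto simp: mvalid_def)
  then have "card (c ` edges G) \<le> 8" using card_mono[of "{..<8::nat}"] by fastforce
  with semistrong[OF v] show ?thesis
    unfolding semistrong_chromatic_index_def by (blast intro: Least_le)
qed

end

theorem theorem4:
  fixes G :: "('a, 'e) multigraph"
  assumes "finite_loopless G"
    and "connected_graph G"
    and "max_degree G = 3"
    and "\<not> isomorphic_graph G (complete_bipartite 3 3)"
  shows "semistrong_chromatic_index G \<le> 8"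
proof -
  interpret subcubic_multigraph G by standard (use assms in auto)
  show ?thesis using assms(4) by (rule index_le_8)
qed

end
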